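(* The assignment $v\mapsto\partial_v$ ($v\in V$), together with the $W$-action on $C^\infty(V)$ determined by $s_a\mapsto Q_{k,a}$ ($a\in I$), extends uniquely to a representation $Q_k:H_k\to\mathrm{End}(C^\infty(V))$.
   Context: Root systems. Let $V$ be a Euclidean space of dimension $n$ and $V^*$ the dual Euclidean space, with norm $\|\cdot\|$ and inner product $\langle\cdot,\cdot\rangle$ on $V^*$. Let $\Sigma_0\subset V^*$ be a finite, irreducible, reduced crystallographic root system. The co-root $\alpha^\vee\in V$ of $\alpha\in\Sigma_0$ is determined by $\xi(\alpha^\vee)=2\langle\xi,\alpha\rangle/\|\alpha\|^2$ for all $\xi\in V^*$. Fix a basis $I_0=\{a_1,\ldots,a_n\}$ of $\Sigma_0$, with highest root $\varphi$. For $\alpha\in\Sigma_0$, $s_\alpha v=v-\alpha(v)\alpha^\vee$ on $V$. $S(V)_{\mathbb{C}}$ is the complexified symmetric algebra of $V$. Affine root system. Affine linear functionals on $V$ are written as elements of $V^*\oplus\mathbb{R}$, and $D$ denotes the projection onto $V^*$ (the gradient). The affine root system is $\Sigma=\Sigma_0+\mathbb{Z}$, with basis $I=\{a_0=-\varphi+1,a_1,\ldots,a_n\}$. For $a\in\Sigma$ write $Da^\vee=(Da)^\vee$ and $s_a(v)=v-a(v)Da^\vee$. The affine Weyl group $W$ is generated by all $s_a$ ($a\in\Sigma$); it is a Coxeter group with generators $s_a$ ($a\in I$), and acts on $\Sigma$ by $(wa)(v)=a(w^{-1}v)$. Multiplicity function. $k:\Sigma\to\mathbb{R}_{>0}$ is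 a fixed $W$-invariant function with $k(a)=k(Da)$ for all $a\in\Sigma$; write $k_a=k(a)$. The algebra $H_k$. $H_k$ is the unique complex unital associative algebra with $H_k=S(V)_{\mathbb{C}}\otimes\mathbb{C}[W]$ as vector spaces, containing $S(V)_{\mathbb{C}}$ and $\mathbb{C}[W]$ as subalgebras via $p\mapsto p\otimes e$, $w\mapsto1\otimes w$, and with cross relations $s_a\cdot v-(s_{Da}v)\cdot s_a=k_aDa(v)$ for $a\in I$, $v\in V$. Integral-reflection operators. On the space $C(V)$ of complex-valued continuous functions on $V$ put, for $a\in\Sigma$, $$(Q_{k,a}f)(v)=f(s_av)+k_a\int_0^{a(v)}f(v-tDa^\vee)\,dt.$$ By a theorem of Gutkin the assignment $s_a\mapsto Q_{k,a}$ ($a\in I$) extends to a representation of $W$ on $C(V)$; it preserves the space $C^\infty(V)$ of complex-valued smooth functions. $\partial_v$ is the derivative in direction $v$. *)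

theory Defs
  imports "HOL-Analysis.Analysis" "HOL-Library.Poly_Mapping" "HOL-Library.Multiset"
begin

section \<open>Root systems in the dual of a Euclidean space\<close>

text \<open>The dual Euclidean space \<open>V\<^sup>*\<close> is the type of bounded linear functionals on \<open>V\<close>; its inner
  product is the one for which the dual of an orthonormal basis of \<open>V\<close> is orthonormal.\<close>

definition dual_inner ::
    "('a::euclidean_space \<Rightarrow>\<^sub>L real) \<Rightarrow> ('a \<Rightarrow>\<^sub>L real) \<Rightarrow> real" where
  "dual_inner \<xi> \<eta> = (\<Sum>b\<in>Basis. blinfun_apply \<xi> b * blinfun_apply \<eta> b)"

definition coroot :: "('a::euclidean_space \<Rightarrow>\<^sub>L real) \<Rightarrow> 'a" where
  "coroot \<alpha> = (THE x. \<forall>\<xi>. blinfun_apply \<xi> x = 2 * dual_inner \<xi> \<alpha> / dual_inner \<alpha> \<alpha>)"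

lemma coroot_unique:
  fixes \<alpha> :: "'a::euclidean_space \<Rightarrow>\<^sub>L real"
  shows "\<exists>!x. \<forall>\<xi>. blinfun_apply \<xi> x = 2 * dual_inner \<xi> \<alpha> / dual_inner \<alpha> \<alpha>"
proof (rule ex1I)
  let ?x = "\<Sum>b\<in>Basis. (2 * blinfun_apply \<alpha> b / dual_inner \<alpha> \<alpha>) *\<^sub>R b"
  show x: "\<forall>\<xi>. blinfun_apply \<xi> ?x = 2 * dual_inner \<xi> \<alpha> / dual_inner \<alpha> \<alpha>"
    by (auto simp: blinfun.sum_right blinfun.scaleR_right dual_inner_def[of _ \<alpha>]
        sum_distrib_left sum_divide_distrib intro!: sum.cong)
  fix y assume y: "\<forall>\<xi>. blinfun_apply \<xi> y = 2 * dual_inner \<xi> \<alpha> / dual_inner \<alpha> \<alpha>"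
  have "z \<bullet> y = z \<bullet> ?x" for z
    using x[rule_format, of "blinfun_inner_left z"] y[rule_format, of "blinfun_inner_left z"]
    by (simp add: blinfun_inner_left.rep_eq inner_commute)
  then show "y = ?x"
    by (metis inner_commute vector_eq_ldot)
qed

lemma coroot_apply:
  "blinfun_apply \<xi> (coroot \<alpha>) = 2 * dual_inner \<xi> \<alpha> / dual_inner \<alpha> \<alpha>"
  using theI'[OF coroot_unique[of \<alpha>]] unfolding coroot_def by blast

definition lin_refl :: "('a::euclidean_space \<Rightarrow>\<^sub>L real) \<Rightarrow> 'a \<Rightarrow> 'a" where
  "lin_refl \<alpha> v = v - blinfun_apply \<alpha> v *\<^sub>R coroot \<alpha>"

text \<open>The reflection of \<open>\<beta>\<close> in \<open>\<alpha>\<close> is \<open>\<beta> - \<beta>(\<alpha>\<^sup>\<or>)\<alpha>\<close>.\<close>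

definition root_system :: "('a::euclidean_space \<Rightarrow>\<^sub>L real) set \<Rightarrow> bool" where
  "root_system R \<longleftrightarrow>
     finite R \<and> 0 \<notin> R \<and> span R = UNIV \<and>
     (\<forall>\<alpha>\<in>R. \<forall>\<beta>\<in>R. \<beta> - blinfun_apply \<beta> (coroot \<alpha>) *\<^sub>R \<alpha> \<in> R)"

definition crystallographic :: "('a::euclidean_space \<Rightarrow>\<^sub>L real) set \<Rightarrow> bool" where
  "crystallographic R \<longleftrightarrow> (\<forall>\<alpha>\<in>R. \<forall>\<beta>\<in>R. blinfun_apply \<beta> (coroot \<alpha>) \<in> \<int>)"

definition reduced_rs :: "('a::euclidean_space \<Rightarrow>\<^sub>L real) set \<Rightarrow> bool" where
  "reduced_rs R \<longleftrightarrow> (\<forall>\<alpha>\<in>R. \<forall>c::real. c *\<^sub>R \<alpha> \<in> R \<longrightarrow> c = 1 \<or> c = -1)"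

definition irreducible_rs :: "('a::euclidean_space \<Rightarrow>\<^sub>L real) set \<Rightarrow> bool" where
  "irreducible_rs R \<longleftrightarrow> R \<noteq> {} \<and>
     \<not> (\<exists>A B. A \<noteq> {} \<and> B \<noteq> {} \<and> A \<union> B = R \<and> A \<inter> B = {} \<and>
              (\<forall>\<alpha>\<in>A. \<forall>\<beta>\<in>B. dual_inner \<alpha> \<beta> = 0))"

definition root_basis ::
    "('a::euclidean_space \<Rightarrow>\<^sub>L real) set \<Rightarrow> ('a \<Rightarrow>\<^sub>L real) set \<Rightarrow> bool" where
  "root_basis R I0 \<longleftrightarrow>
     I0 \<subseteq> R \<and> independent I0 \<and> span I0 = UNIV \<and>
     (\<forall>\<beta>\<in>R. \<exists>c :: ('a \<Rightarrow>\<^sub>L real) \<Rightarrow> nat.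
        \<beta> = (\<Sum>\<alpha>\<in>I0. real (c \<alpha>) *\<^sub>R \<alpha>) \<or> \<beta> = - (\<Sum>\<alpha>\<in>I0. real (c \<alpha>) *\<^sub>R \<alpha>))"

definition highest_root ::
    "('a::euclidean_space \<Rightarrow>\<^sub>L real) set \<Rightarrow> ('a \<Rightarrow>\<^sub>L real) set \<Rightarrow> ('a \<Rightarrow>\<^sub>L real) \<Rightarrow> bool" where
  "highest_root R I0 \<phi> \<longleftrightarrow>
     \<phi> \<in> R \<and>
     (\<forall>\<beta>\<in>R. \<exists>c :: ('a \<Rightarrow>\<^sub>L real) \<Rightarrow> nat. \<phi> - \<beta> = (\<Sum>\<alpha>\<in>I0. real (c \<alpha>) *\<^sub>R \<alpha>))"


section \<open>Affine root systems\<close>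

text \<open>An affine functional \<open>v \<mapsto> \<xi>(v) + r\<close> is the pair \<open>(\<xi>, r)\<close>; its gradient is \<open>fst\<close>.\<close>

type_synonym 'a affine_functional = "('a \<Rightarrow>\<^sub>L real) \<times> real"

definition aff_apply :: "'a::euclidean_space affine_functional \<Rightarrow> 'a \<Rightarrow> real" where
  "aff_apply a v = blinfun_apply (fst a) v + snd a"

definition affine_roots ::
    "('a::euclidean_space \<Rightarrow>\<^sub>L real) set \<Rightarrow> 'a affine_functional set" where
  "affine_roots R = R \<times> \<int>"

definition affine_basis ::
    "('a::euclidean_space \<Rightarrow>\<^sub>L real) set \<Rightarrow> ('a \<Rightarrow>\<^sub>L real) \<Rightarrow> 'a affine_functional set" where
  "affine_basis I0 \<phi> = insert (- \<phi>, 1) ((\<lambda>\<alpha>. (\<alpha>, 0)) ` I0)"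

definition aff_refl :: "'a::euclidean_space affine_functional \<Rightarrow> 'a \<Rightarrow> 'a" where
  "aff_refl a v = v - aff_apply a v *\<^sub>R coroot (fst a)"

text \<open>No closure under inverses is needed, since the generators are involutions.\<close>

inductive_set affine_weyl :: "('a::euclidean_space \<Rightarrow>\<^sub>L real) set \<Rightarrow> ('a \<Rightarrow> 'a) set"
  for R :: "('a::euclidean_space \<Rightarrow>\<^sub>L real) set" where
    id: "id \<in> affine_weyl R"
  | refl: "a \<in> affine_roots R \<Longrightarrow> aff_refl a \<in> affine_weyl R"
  | comp: "w \<in> affine_weyl R \<Longrightarrow> w' \<in> affine_weyl R \<Longrightarrow> w \<circ> w' \<in> affine_weyl R"

text \<open>In the second clause \<open>b = wa\<close>, i.e. \<open>b(v) = a(w\<^sup>-\<^sup>1 v)\<close> for all \<open>v\<close>.\<close>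

definition multiplicity_function ::
    "('a::euclidean_space \<Rightarrow>\<^sub>L real) set \<Rightarrow> ('a affine_functional \<Rightarrow> real) \<Rightarrow> bool" where
  "multiplicity_function R k \<longleftrightarrow>
     (\<forall>a\<in>affine_roots R. k a > 0) \<and>
     (\<forall>w\<in>affine_weyl R. \<forall>a\<in>affine_roots R. \<forall>b\<in>affine_roots R.
        (\<forall>v. aff_apply b v = aff_apply a (inv w v)) \<longrightarrow> k b = k a) \<and>
     (\<forall>a\<in>affine_roots R. k a = k (fst a, 0))"


section \<open>The complexified symmetric algebra\<close>

text \<open>\<open>S(V)\<^sub>\<complex>\<close> is the free commutative complex algebra on the set \<open>V\<close> (the monoid algebra of the
  finite multisets in \<open>V\<close>) modulo the relations making \<open>V \<rightarrow> S(V)\<^sub>\<complex>\<close> real linear.\<close>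

type_synonym 'a free_calg = "'a multiset \<Rightarrow>\<^sub>0 complex"

definition free_const :: "complex \<Rightarrow> 'a free_calg" where
  "free_const c = Poly_Mapping.single {#} c"

definition free_gen :: "'a \<Rightarrow> 'a free_calg" where
  "free_gen v = Poly_Mapping.single {#v#} 1"

inductive_set sym_ideal :: "'a::real_vector free_calg set" where
    zero: "0 \<in> sym_ideal"
  | gen_add: "free_gen (v + w) - free_gen v - free_gen w \<in> sym_ideal"
  | gen_scaleR: "free_gen (r *\<^sub>R v) - free_const (of_real r) * free_gen v \<in> sym_ideal"
  | add: "p \<in> sym_ideal \<Longrightarrow> q \<in> sym_ideal \<Longrightarrow> p + q \<in> sym_ideal"
  | mult: "p \<in> sym_ideal \<Longrightarrow> x * p \<in> sym_ideal"

lemma sym_ideal_uminus: "p \<in> sym_ideal \<Longrightarrow> - p \<in> sym_ideal"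
  using sym_ideal.mult[of p "- 1"] by simp

lemma sym_ideal_diff: "p \<in> sym_ideal \<Longrightarrow> q \<in> sym_ideal \<Longrightarrow> p - q \<in> sym_ideal"
  using sym_ideal.add[OF _ sym_ideal_uminus, of p q] by simp

definition sym_rel :: "'a::real_vector free_calg \<Rightarrow> 'a free_calg \<Rightarrow> bool" where
  "sym_rel p q \<longleftrightarrow> p - q \<in> sym_ideal"

lemma equivp_sym_rel: "equivp (sym_rel :: 'a::real_vector free_calg \<Rightarrow> _)"
proof (rule equivpI)
  show "reflp (sym_rel :: 'a free_calg \<Rightarrow> _)"
    by (simp add: reflp_def sym_rel_def sym_ideal.zero)
  show "symp (sym_rel :: 'a free_calg \<Rightarrow> _)"
    unfolding symp_def sym_rel_def by (metis minus_diff_eq sym_ideal_uminus)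
  show "transp (sym_rel :: 'a free_calg \<Rightarrow> _)"
  proof (rule transpI)
    fix p q r :: "'a free_calg"
    assume "sym_rel p q" "sym_rel q r"
    then have "(p - q) + (q - r) \<in> sym_ideal"
      unfolding sym_rel_def by (rule sym_ideal.add)
    then show "sym_rel p r" by (simp add: sym_rel_def)
  qed
qed

quotient_type (overloaded) 'a sym_alg = "'a::real_vector free_calg" / sym_rel
  by (rule equivp_sym_rel)

lemma lookup_mult_empty:
  fixes p q :: "'a free_calg"
  shows "Poly_Mapping.lookup (p * q) {#} =
    Poly_Mapping.lookup p {#} * Poly_Mapping.lookup q {#}"
proof -
  have "Sum_any (\<lambda>r. Poly_Mapping.lookup q r when 0 = l + r) =
    (Poly_Mapping.lookup q {#} when l = {#})" for l
  proof (cases "l = {#}")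
    case True
    then show ?thesis by (simp add: when_def)
  next
    case False
    then show ?thesis by (simp add: when_def)
  qed
  then have "Poly_Mapping.lookup (p * q) {#} =
    Sum_any (\<lambda>l. Poly_Mapping.lookup p l * Poly_Mapping.lookup q {#} when l = {#})"
    by (simp add: lookup_mult mult_when)
  then show ?thesis by simp
qed

lemma sym_ideal_lookup_empty: "p \<in> sym_ideal \<Longrightarrow> Poly_Mapping.lookup p {#} = 0"
  by (induction rule: sym_ideal.induct)
    (auto simp: lookup_add lookup_minus lookup_mult_empty free_gen_def lookup_single when_def)

instantiation sym_alg :: (real_vector) comm_ring_1
begin

lift_definition zero_sym_alg :: "'a sym_alg" is 0 .
lift_definition one_sym_alg :: "'a sym_alg" is 1 .

lift_definition plus_sym_alg :: "'a sym_alg \<Rightarrow> 'a sym_alg \<Rightarrow> 'a sym_alg" is "(+)"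
proof -
  fix p p' q q' :: "'a free_calg"
  assume "sym_rel p p'" "sym_rel q q'"
  moreover have "(p + q) - (p' + q') = (p - p') + (q - q')" by simp
  ultimately show "sym_rel (p + q) (p' + q')"
    unfolding sym_rel_def by (metis sym_ideal.add)
qed

lift_definition uminus_sym_alg :: "'a sym_alg \<Rightarrow> 'a sym_alg" is uminus
proof -
  fix p p' :: "'a free_calg"
  assume "sym_rel p p'"
  moreover have "- p - - p' = - (p - p')" by simp
  ultimately show "sym_rel (- p) (- p')"
    unfolding sym_rel_def by (metis sym_ideal_uminus)
qed

lift_definition minus_sym_alg :: "'a sym_alg \<Rightarrow> 'a sym_alg \<Rightarrow> 'a sym_alg" is "(-)"
proof -
  fix p p' q q' :: "'a free_calg"
  assume "sym_rel p p'" "sym_rel q q'"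
  moreover have "(p - q) - (p' - q') = (p - p') - (q - q')" by simp
  ultimately show "sym_rel (p - q) (p' - q')"
    unfolding sym_rel_def by (metis sym_ideal_diff)
qed

lift_definition times_sym_alg :: "'a sym_alg \<Rightarrow> 'a sym_alg \<Rightarrow> 'a sym_alg" is "(*)"
proof -
  fix p p' q q' :: "'a free_calg"
  assume "sym_rel p p'" "sym_rel q q'"
  moreover have "p * q - p' * q' = q * (p - p') + p' * (q - q')" by (simp add: algebra_simps)
  ultimately show "sym_rel (p * q) (p' * q')"
    unfolding sym_rel_def by (metis sym_ideal.add sym_ideal.mult)
qed

instance
proof
  fix a b c :: "'a sym_alg"
  note refl = sym_rel_def sym_ideal.zero
  show "a + b + c = a + (b + c)" by transfer (simp add: refl add.assoc)
  show "a + b = b + a" by transfer (simp add: refl add.commute)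
  show "0 + a = a" by transfer (simp add: refl)
  show "- a + a = 0" by transfer (simp add: refl)
  show "a - b = a + - b" by transfer (simp add: refl)
  show "a * b * c = a * (b * c)" by transfer (simp add: refl mult.assoc)
  show "a * b = b * a" by transfer (simp add: refl mult.commute)
  show "1 * a = a" by transfer (simp add: refl)
  show "(a + b) * c = a * c + b * c" by transfer (simp add: refl distrib_right)
  show "(0::'a sym_alg) \<noteq> 1"
    by transfer (auto simp: sym_rel_def lookup_minus lookup_one dest!: sym_ideal_lookup_empty)
qed

end

lift_definition sym_const :: "complex \<Rightarrow> 'a::real_vector sym_alg" is free_const .

lift_definition sym_gen :: "'a::real_vector \<Rightarrow> 'a sym_alg" is free_gen .

definition sym_scale :: "complex \<Rightarrow> 'a::real_vector sym_alg \<Rightarrow> 'a sym_alg" where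
  "sym_scale c p = sym_const c * p"

lemma sym_gen_add: "sym_gen (v + w) = sym_gen v + sym_gen w"
  by transfer (simp add: sym_rel_def diff_diff_eq[symmetric] sym_ideal.gen_add)

lemma sym_gen_scaleR: "sym_gen (r *\<^sub>R v) = sym_scale (of_real r) (sym_gen v)"
  unfolding sym_scale_def by transfer (simp add: sym_rel_def sym_ideal.gen_scaleR)


section \<open>The algebra \<open>H\<^sub>k\<close>\<close>

locale complex_algebra = vector_space cscale
  for cscale :: "complex \<Rightarrow> 'h::ring_1 \<Rightarrow> 'h" +
  assumes scale_mult_left: "cscale c x * y = cscale c (x * y)"
    and scale_mult_right: "x * cscale c y = cscale c (x * y)"

text \<open>The algebra \<open>H\<^sub>k\<close> is determined up to isomorphism only, so it is described by its
  structure: a complex algebra \<open>H\<close> with maps \<open>iS\<close> (for \<open>p \<mapsto> p \<otimes> e\<close>) and \<open>iW\<close> (for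
  \<open>w \<mapsto> 1 \<otimes> w\<close>). As \<open>\<complex>[W]\<close> has basis \<open>W\<close>, the elements of \<open>S(V)\<^sub>\<complex> \<otimes> \<complex>[W]\<close> are the sums
  \<open>\<Sum>\<^sub>w f(w) \<otimes> w\<close> for unique finitely supported \<open>f : W \<rightarrow> S(V)\<^sub>\<complex>\<close>; the assumption \<open>tensor\<close>
  says that the multiplication map \<open>S(V)\<^sub>\<complex> \<otimes> \<complex>[W] \<rightarrow> H\<close>, \<open>p \<otimes> w \<mapsto> iS p * iW w\<close>, is bijective.
  In particular \<open>iS\<close> and the linear extension of \<open>iW\<close> to \<open>\<complex>[W]\<close> are injective.\<close>

locale Hk_algebra = complex_algebra cscale
  for cscale :: "complex \<Rightarrow> 'h::ring_1 \<Rightarrow> 'h" +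
  fixes R I0 :: "('a::euclidean_space \<Rightarrow>\<^sub>L real) set"
    and \<phi> :: "'a \<Rightarrow>\<^sub>L real"
    and k :: "'a affine_functional \<Rightarrow> real"
    and iS :: "'a sym_alg \<Rightarrow> 'h"
    and iW :: "('a \<Rightarrow> 'a) \<Rightarrow> 'h"
  assumes iS_add: "iS (p + q) = iS p + iS q"
    and iS_mult: "iS (p * q) = iS p * iS q"
    and iS_one: "iS 1 = 1"
    and iS_scale: "iS (sym_scale c p) = cscale c (iS p)"
    and iW_id: "iW id = 1"
    and iW_comp: "w \<in> affine_weyl R \<Longrightarrow> w' \<in> affine_weyl R \<Longrightarrow> iW (w \<circ> w') = iW w * iW w'"
    and tensor: "\<exists>!f :: ('a \<Rightarrow> 'a) \<Rightarrow>\<^sub>0 'a sym_alg.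
       Poly_Mapping.keys f \<subseteq> affine_weyl R \<and>
       h = (\<Sum>w\<in>Poly_Mapping.keys f. iS (Poly_Mapping.lookup f w) * iW w)"
    and cross: "a \<in> affine_basis I0 \<phi> \<Longrightarrow>
       iW (aff_refl a) * iS (sym_gen v) - iS (sym_gen (lin_refl (fst a) v)) * iW (aff_refl a)
         = cscale (of_real (k a * blinfun_apply (fst a) v)) 1"


section \<open>Operators on smooth functions\<close>

definition dir_deriv :: "'a::euclidean_space \<Rightarrow> ('a \<Rightarrow> complex) \<Rightarrow> 'a \<Rightarrow> complex" where
  "dir_deriv v f x = vector_derivative (\<lambda>t. f (x + t *\<^sub>R v)) (at 0)"

primrec Ck_fun :: "nat \<Rightarrow> ('a::euclidean_space \<Rightarrow> complex) \<Rightarrow> bool" where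
  "Ck_fun 0 f \<longleftrightarrow> continuous_on UNIV f"
| "Ck_fun (Suc n) f \<longleftrightarrow> f differentiable_on UNIV \<and> (\<forall>v. Ck_fun n (dir_deriv v f))"

definition Cinf :: "('a::euclidean_space \<Rightarrow> complex) set" where
  "Cinf = {f. \<forall>n. Ck_fun n f}"

text \<open>The interval integral is oriented, so \<open>a(v) < 0\<close> is covered.\<close>

definition int_refl ::
    "('a::euclidean_space affine_functional \<Rightarrow> real) \<Rightarrow> 'a affine_functional \<Rightarrow>
      ('a \<Rightarrow> complex) \<Rightarrow> 'a \<Rightarrow> complex" where
  "int_refl k a f v =
     f (aff_refl a v) + of_real (k a) *
       (LBINT t=ereal 0..ereal (aff_apply a v). f (v - t *\<^sub>R coroot (fst a)))"

text \<open>Endomorphisms of \<open>C\<^sup>\<infinity>(V)\<close> are extensional, i.e. fixed to be \<open>undefined\<close> off \<open>Cinf\<close>, so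
  that equality of endomorphisms is equality of functions.\<close>

definition End_Cinf :: "(('a::euclidean_space \<Rightarrow> complex) \<Rightarrow> ('a \<Rightarrow> complex)) set" where
  "End_Cinf = {T \<in> Cinf \<rightarrow>\<^sub>E Cinf.
     (\<forall>f\<in>Cinf. \<forall>g\<in>Cinf. T (\<lambda>x. f x + g x) = (\<lambda>x. T f x + T g x)) \<and>
     (\<forall>c. \<forall>f\<in>Cinf. T (\<lambda>x. c * f x) = (\<lambda>x. c * T f x))}"

definition representation_on_Cinf ::
    "(complex \<Rightarrow> 'h::ring_1 \<Rightarrow> 'h) \<Rightarrow>
      ('h \<Rightarrow> ('a::euclidean_space \<Rightarrow> complex) \<Rightarrow> ('a \<Rightarrow> complex)) \<Rightarrow> bool" where
  "representation_on_Cinf cscale Q \<longleftrightarrow>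
     (\<forall>h. Q h \<in> End_Cinf) \<and>
     (\<forall>f\<in>Cinf. Q 1 f = f) \<and>
     (\<forall>h h'. \<forall>f\<in>Cinf. Q (h * h') f = Q h (Q h' f)) \<and>
     (\<forall>h h'. \<forall>f\<in>Cinf. Q (h + h') f = (\<lambda>x. Q h f x + Q h' f x)) \<and>
     (\<forall>c h. \<forall>f\<in>Cinf. Q (cscale c h) f = (\<lambda>x. c * Q h f x))"

end

theory Submission
  imports Defs
begin

text \<open>Attach to a word \<open>u\<close> in the simple affine roots the composite \<open>word_op k u\<close> of integral-reflection
  operators. The point is Gutkin's theorem: \<open>word_op k u\<close> depends only on the element of \<open>W\<close>
  that \<open>u\<close> represents. Let \<open>u\<close>, \<open>u'\<close> represent the same element and argue by induction on the length.
  Moving \<open>\<partial>\<^sub>v\<close> through \<open>u\<close> and \<open>u'\<close> produces the same correction terms as in \<open>H\<^sub>k\<close>, along shorter words.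
  In \<open>H\<^sub>k\<close> the group elements are linearly independent, so these terms cancel, and by induction
  they cancel as operators; hence \<open>D = word_op k u - word_op k u'\<close> satisfies \<open>\<partial>\<^sub>v D = D \<partial>\<^bsub>w\<^sup>-\<^sup>1 v\<^esub>\<close>.
  If moreover all functions \<open>D f\<close> vanish at one common point, then \<open>D\<close> kills polynomials, by induction
  on the degree, and then everything, by density. A point of this kind is found where the first
  letters of \<open>u\<close> and \<open>u'\<close> both vanish, so the rank two braid relations never have to be computed.\<close>


section \<open>Smooth functions and integral-reflection operators\<close>

text \<open>The decomposition \<open>tensor\<close> is part of what H is assumed to satisfy, so its
  cancellations are available before any action on functions exists and only have to be transferred
  to operators. Density is enough because \<open>int_refl\<close> involves values of f but no
  derivatives: all word operators are bounded for sup norms on balls, and uniform approximation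
  gives nothing more. Words that are not reduced cannot be avoided, since letters are deleted at
  arbitrary places; they are shortened with Q_a Q_a = 1, itself an instance of the intertwiner
  argument, and with the exchange property of positive affine roots. Two simple walls may be
  parallel, in rank one; the group is then infinite dihedral, and no element can be shortened from
  the left by both generators. Once Q_w is available, p \<otimes> w must act by p(\<partial>) Q_w,
  and multiplicativity has only to be tested for left multiplication by generators, where the cross
  relation meets the derivative formula for \<open>int_refl\<close>.\<close>

lemma dir_deriv_eqI:
  assumes "(f has_derivative D) (at x)"
  shows "dir_deriv v f x = D v"
proof -
  have "((\<lambda>t. f (x + t *\<^sub>R v)) has_derivative (\<lambda>t. D (t *\<^sub>R v))) (at (0::real))"
    by (rule has_derivative_compose[where f="\<lambda>t. x + t *\<^sub>R v"])
       (auto intro!: derivative_eq_intros assms)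
  moreover have "D (t *\<^sub>R v) = t *\<^sub>R D v" for t
    using assms has_derivative_bounded_linear bounded_linear.linear linear_cmul by blast
  ultimately show ?thesis
    unfolding dir_deriv_def by (intro vector_derivative_at) (simp add: has_vector_derivative_def)
qed

lemma Ck_fun_SucI:
  assumes "\<And>x. (f has_derivative f' x) (at x)" and "\<And>v. Ck_fun n (\<lambda>x. f' x v)"
  shows "Ck_fun (Suc n) f"
proof -
  have "dir_deriv v f = (\<lambda>x. f' x v)" for v
    using dir_deriv_eqI[OF assms(1)] by (simp add: fun_eq_iff)
  with assms show ?thesis
    by (auto simp: differentiable_on_def differentiable_def has_derivative_at_withinI)
qed

lemma Cinf_has_derivative:
  assumes "f \<in> Cinf"
  shows "(f has_derivative (\<lambda>v. dir_deriv v f x)) (at x)"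
proof -
  have "Ck_fun (Suc 0) f" using assms by (simp add: Cinf_def del: Ck_fun.simps)
  then obtain D where D: "(f has_derivative D) (at x)"
    by (auto simp: differentiable_on_def differentiable_def)
  then show ?thesis using dir_deriv_eqI[OF D] by (metis (no_types, lifting) ext)
qed

lemma Cinf_continuous_on: "f \<in> Cinf \<Longrightarrow> continuous_on S f"
  by (metis Cinf_has_derivative has_derivative_continuous continuous_at_imp_continuous_on)

lemma Cinf_dir_deriv: "f \<in> Cinf \<Longrightarrow> dir_deriv v f \<in> Cinf"
  by (force simp: Cinf_def dest: spec[of _ "Suc _"])

lemma Cinf_coinduct [consumes 1, case_names deriv]:
  assumes "X f"
    and "\<And>f. X f \<Longrightarrow> \<exists>f'. (\<forall>x. (f has_derivative f' x) (at x)) \<and> (\<forall>v. X (\<lambda>x. f' x v))"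
  shows "f \<in> Cinf"
proof -
  have "Ck_fun n f" if "X f" for n f using that
  proof (induction n arbitrary: f)
    case 0
    with assms(2) show ?case
      by (metis Ck_fun.simps(1) has_derivative_continuous continuous_at_imp_continuous_on)
  next
    case (Suc n)
    with assms(2) show ?case by (metis Ck_fun_SucI)
  qed
  with assms(1) show ?thesis by (simp add: Cinf_def)
qed

text \<open>Stated level by level because the inductions for products and for
  \<open>int_refl\<close> know some summands only at the level of the induction hypothesis.\<close>

lemma Ck_fun_add: "Ck_fun n f \<Longrightarrow> Ck_fun n g \<Longrightarrow> Ck_fun n (\<lambda>x. f x + g x)"
proof (induction n arbitrary: f g)
  case (Suc n)
  have d: "(h has_derivative (\<lambda>v. dir_deriv v h x)) (at x)" if "Ck_fun (Suc n) h" for h :: "'a \<Rightarrow> complex" and x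
  proof -
    have "h differentiable (at x)" using that by (simp add: differentiable_on_def)
    then obtain D where D: "(h has_derivative D) (at x)"
      unfolding differentiable_def by blast
    then show ?thesis using dir_deriv_eqI[OF D] by (metis (no_types, lifting) ext)
  qed
  show ?case
    by (rule Ck_fun_SucI[where f'="\<lambda>x v. dir_deriv v f x + dir_deriv v g x"])
       (use Suc d in \<open>auto intro!: has_derivative_add\<close>)
qed (auto intro: continuous_intros)

lemma Cinf_add: "f \<in> Cinf \<Longrightarrow> g \<in> Cinf \<Longrightarrow> (\<lambda>x. f x + g x) \<in> Cinf"
  by (simp add: Cinf_def Ck_fun_add)

lemma Cinf_const: "(\<lambda>x. c) \<in> Cinf"
  by (rule Cinf_coinduct[where X="\<lambda>f. \<exists>c. f = (\<lambda>x. c)"])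
     (auto intro!: exI[of _ "\<lambda>x v. 0"])

lemma Cinf_bounded_linear: "bounded_linear f \<Longrightarrow> f \<in> Cinf"
  unfolding Cinf_def
proof safe
  fix n assume f: "bounded_linear f"
  show "Ck_fun n f"
  proof (cases n)
    case 0
    then show ?thesis by (simp add: f linear_continuous_on)
  next
    case (Suc m)
    have "Ck_fun (Suc m) f"
      using f Cinf_const
      by (intro Ck_fun_SucI[where f'="\<lambda>x v. f v"])
         (auto simp: Cinf_def bounded_linear_imp_has_derivative)
    with Suc show ?thesis by simp
  qed
qed

lemma Cinf_mult:
  assumes "f \<in> Cinf" "g \<in> Cinf"
  shows "(\<lambda>x. f x * g x) \<in> Cinf"
proof -
  have "Ck_fun n (\<lambda>x. f x * g x)" if "f \<in> Cinf" "g \<in> Cinf" for n f g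
    using that
  proof (induction n arbitrary: f g)
    case 0
    then show ?case by (simp add: continuous_on_mult Cinf_continuous_on)
  next
    case (Suc n)
    show ?case
      by (rule Ck_fun_SucI[where f'="\<lambda>x v. f x * dir_deriv v g x + dir_deriv v f x * g x"])
         (use Suc in \<open>auto intro!: Ck_fun_add has_derivative_mult Cinf_has_derivative Cinf_dir_deriv\<close>)
  qed
  from this[OF assms] show ?thesis by (simp add: Cinf_def)
qed

lemma Cinf_cmult: "f \<in> Cinf \<Longrightarrow> (\<lambda>x. c * f x) \<in> Cinf"
  by (intro Cinf_mult Cinf_const)

lemma Cinf_diff: "f \<in> Cinf \<Longrightarrow> g \<in> Cinf \<Longrightarrow> (\<lambda>x. f x - g x) \<in> Cinf"
  using Cinf_add[of f "\<lambda>x. - 1 * g x"] Cinf_cmult[of g "-1"] by simp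

lemma Cinf_sum: "(\<And>i. i \<in> S \<Longrightarrow> f i \<in> Cinf) \<Longrightarrow> (\<lambda>x. \<Sum>i\<in>S. f i x) \<in> Cinf"
  by (induction S rule: infinite_finite_induct) (auto intro: Cinf_add Cinf_const)

lemma dir_deriv_add_fun:
  "f \<in> Cinf \<Longrightarrow> g \<in> Cinf \<Longrightarrow> dir_deriv v (\<lambda>x. f x + g x) = (\<lambda>x. dir_deriv v f x + dir_deriv v g x)"
  by (rule ext) (rule dir_deriv_eqI has_derivative_add Cinf_has_derivative | assumption)+

lemma dir_deriv_const: "dir_deriv v (\<lambda>x. c) = (\<lambda>x. 0)"
  by (rule ext) (rule dir_deriv_eqI has_derivative_const)+

lemma dir_deriv_bounded_linear: "bounded_linear f \<Longrightarrow> dir_deriv v f = (\<lambda>x. f v)"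
  by (rule ext) (rule dir_deriv_eqI bounded_linear_imp_has_derivative | assumption)+

lemma dir_deriv_mult:
  "f \<in> Cinf \<Longrightarrow> g \<in> Cinf \<Longrightarrow>
    dir_deriv v (\<lambda>x. f x * g x) = (\<lambda>x. f x * dir_deriv v g x + dir_deriv v f x * g x)"
  by (rule ext) (rule dir_deriv_eqI has_derivative_mult Cinf_has_derivative | assumption)+

lemma dir_deriv_cmult: "f \<in> Cinf \<Longrightarrow> dir_deriv v (\<lambda>x. c * f x) = (\<lambda>x. c * dir_deriv v f x)"
  by (simp add: dir_deriv_mult Cinf_const dir_deriv_const)

lemma dir_deriv_diff_fun:
  "f \<in> Cinf \<Longrightarrow> g \<in> Cinf \<Longrightarrow> dir_deriv v (\<lambda>x. f x - g x) = (\<lambda>x. dir_deriv v f x - dir_deriv v g x)"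
  by (rule ext) (rule dir_deriv_eqI has_derivative_diff Cinf_has_derivative | assumption)+

lemma linear_dir_deriv: "f \<in> Cinf \<Longrightarrow> linear (\<lambda>v. dir_deriv v f x)"
  using Cinf_has_derivative has_derivative_linear by blast

lemmas dir_deriv_add = linear_add[OF linear_dir_deriv]
lemmas dir_deriv_diff = linear_diff[OF linear_dir_deriv]
lemmas dir_deriv_scaleR = linear_cmul[OF linear_dir_deriv]

lemma dir_deriv_zero_imp_const:
  assumes "f \<in> Cinf" and "\<And>v. dir_deriv v f = (\<lambda>x. 0)"
  shows "f x = f y"
proof -
  have "(f has_derivative (\<lambda>v. 0)) (at x within UNIV)" for x
    using Cinf_has_derivative[OF assms(1), of x] assms(2) by (simp add: fun_eq_iff)
  then obtain c where "\<And>x. f x = c"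
    using has_derivative_zero_constant[of UNIV f] by auto
  then show ?thesis by simp
qed

section \<open>Differentiation under the integral sign and the derivative formula for
  \<open>int_refl\<close>\<close>

lemma dir_deriv_blinfun:
  assumes f: "f \<in> Cinf"
  defines "B \<equiv> \<lambda>y. \<Sum>i\<in>Basis. blinfun_scaleR_left (dir_deriv i f y) o\<^sub>L blinfun_inner_left i"
  shows "blinfun_apply (B y) v = dir_deriv v f y" and "continuous_on S B"
proof -
  have "dir_deriv v f y = dir_deriv (\<Sum>i\<in>Basis. (v \<bullet> i) *\<^sub>R i) f y"
    by (simp add: euclidean_representation)
  also have "\<dots> = (\<Sum>i\<in>Basis. (v \<bullet> i) *\<^sub>R dir_deriv i f y)"
    by (simp add: linear_sum[OF linear_dir_deriv[OF f]] linear_cmul[OF linear_dir_deriv[OF f]])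
  also have "\<dots> = blinfun_apply (B y) v"
    unfolding B_def by (simp add: blinfun.sum_left blinfun_inner_left.rep_eq inner_commute)
  finally show "blinfun_apply (B y) v = dir_deriv v f y" ..
  show "continuous_on S B"
    unfolding B_def by (intro continuous_intros Cinf_continuous_on Cinf_dir_deriv f)
qed

text \<open>On the fixed interval [0,1] the point x enters through the integrand only, so the
  Leibniz rule applies; it wants the derivative as a continuous map into bounded linear maps. The
  direction b is left free for the use in \<open>dir_deriv_commute\<close>.\<close>

lemma has_derivative_segment_integral:
  fixes f :: "'a::euclidean_space \<Rightarrow> complex" and a :: "'a affine_functional"
  assumes f: "f \<in> Cinf"
  shows "((\<lambda>x. integral {0..1} (\<lambda>s. f (x - (s * aff_apply a x) *\<^sub>R b))) has_derivative
    (\<lambda>v. integral {0..1} (\<lambda>s. dir_deriv (v - (s * blinfun_apply (fst a) v) *\<^sub>R b) f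
       (x - (s * aff_apply a x) *\<^sub>R b)))) (at x)"
proof -
  let ?p = "\<lambda>x s. x - (s * aff_apply a x) *\<^sub>R b"
  obtain B :: "'a \<Rightarrow> 'a \<Rightarrow>\<^sub>L complex" where B: "\<And>y v. blinfun_apply (B y) v = dir_deriv v f y"
    and contB: "\<And>S. continuous_on S B"
    using that[OF dir_deriv_blinfun[OF f]] .
  \<comment> \<open>The derivative in x of the point at parameter s; the second summand records that
    the length of the segment varies with x.\<close>
  define L where "L s = id_blinfun - s *\<^sub>R (blinfun_scaleR_left b o\<^sub>L fst a)" for s :: real
  have L: "blinfun_apply (L s) v = v - (s * blinfun_apply (fst a) v) *\<^sub>R b" for s v
    by (simp add: L_def blinfun.diff_left blinfun.scaleR_left)
  define fx where "fx x s = B (?p x s) o\<^sub>L L s" for x s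
  have fx: "blinfun_apply (fx x s) v = dir_deriv (v - (s * blinfun_apply (fst a) v) *\<^sub>R b) f (?p x s)" for x s v
    by (simp add: fx_def B L)
  have cont_fx: "continuous_on (UNIV \<times> cbox 0 1) (\<lambda>(x, s). fx x s)"
    unfolding fx_def L_def split_beta aff_apply_def
    by (intro continuous_intros continuous_on_compose2[OF contB[of UNIV]]) auto
  have "((\<lambda>x. integral (cbox 0 1) (\<lambda>s. f (?p x s))) has_derivative integral (cbox 0 1) (fx x)) (at x within UNIV)"
  proof (rule leibniz_rule[OF _ _ cont_fx])
    fix x s
    have p: "((\<lambda>x. ?p x s) has_derivative (\<lambda>v. v - (s * blinfun_apply (fst a) v) *\<^sub>R b)) (at x)"
      unfolding aff_apply_def by (auto intro!: derivative_eq_intros)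
    have "((\<lambda>x. f (?p x s)) has_derivative blinfun_apply (fx x s)) (at x)"
      by (rule has_derivative_eq_rhs[OF has_derivative_compose[OF p Cinf_has_derivative[OF f]]])
         (simp add: fx fun_eq_iff)
    then show "((\<lambda>x. f (?p x s)) has_derivative blinfun_apply (fx x s)) (at x within UNIV)" .
  next
    fix x show "(\<lambda>s. f (?p x s)) integrable_on cbox 0 1"
      by (intro integrable_continuous continuous_on_compose2[OF Cinf_continuous_on[OF f, of UNIV]] continuous_intros) auto
  qed auto
  moreover have "blinfun_apply (integral (cbox 0 1) (fx x)) v = integral (cbox 0 1) (\<lambda>s. blinfun_apply (fx x s) v)" for v
  proof (rule blinfun_apply_integral)
    show "fx x integrable_on cbox 0 1"
      by (intro integrable_continuous continuous_on_compose2[OF cont_fx, of _ "\<lambda>s. (x, s)", simplified] continuous_intros) auto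
  qed
  then have "blinfun_apply (integral (cbox 0 1) (fx x)) = (\<lambda>v. integral {0..1} (\<lambda>s.
      dir_deriv (v - (s * blinfun_apply (fst a) v) *\<^sub>R b) f (?p x s)))" by (simp add: fx fun_eq_iff)
  ultimately show ?thesis by simp
qed

text \<open>Substitution t = s A; the orientation of the interval integral covers negative
  A.\<close>

lemma interval_integral_eq_unit:
  fixes g :: "real \<Rightarrow> complex"
  assumes "continuous_on UNIV g"
  shows "(LBINT t=ereal 0..ereal A. g t) = of_real A * integral {0..1} (\<lambda>s. g (s * A))"
proof -
  have g: "continuous_on S g" for S using assms continuous_on_subset by blast
  have i: "set_integrable lborel {0..1} (\<lambda>s. A *\<^sub>R g (s * A))"
    by (intro borel_integrable_atLeastAtMost' continuous_intros continuous_on_compose2[OF assms]) auto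
  have "(LBINT s=ereal 0..ereal 1. A *\<^sub>R g (s * A)) = (LBINT t=ereal (0 * A)..ereal (1 * A). g t)"
    by (rule interval_integral_substitution_finite)
       (auto intro!: derivative_eq_intros continuous_intros g)
  also have "(LBINT s=ereal 0..ereal 1. A *\<^sub>R g (s * A)) = integral {0..1} (\<lambda>s. A *\<^sub>R g (s * A))"
    using i by (intro interval_integral_eq_integral) auto
  finally show ?thesis by (simp add: scaleR_conv_of_real)
qed

lemma int_refl_eq:
  assumes "f \<in> Cinf"
  shows "int_refl k a f x = f (aff_refl a x) + of_real (k a * aff_apply a x) *
    integral {0..1} (\<lambda>s. f (x - (s * aff_apply a x) *\<^sub>R coroot (fst a)))"
proof -
  have "continuous_on UNIV (\<lambda>t. f (x - t *\<^sub>R coroot (fst a)))"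
    by (intro continuous_on_compose2[OF Cinf_continuous_on[OF assms, of UNIV]] continuous_intros) auto
  from interval_integral_eq_unit[OF this] show ?thesis
    by (simp add: int_refl_def)
qed


text \<open>The fundamental theorem of calculus for f along the segment, and for s times f
  (integration by parts). The factor A stays on the left, so A = 0 needs no separate case.\<close>

lemma segment_integrals:
  fixes f :: "'a::euclidean_space \<Rightarrow> complex"
  assumes f: "f \<in> Cinf"
  shows "of_real A * integral {0..1} (\<lambda>s. dir_deriv b f (x - (s * A) *\<^sub>R b)) = f x - f (x - A *\<^sub>R b)"
    and "of_real A * integral {0..1} (\<lambda>s. of_real s * dir_deriv b f (x - (s * A) *\<^sub>R b)) =
      integral {0..1} (\<lambda>s. f (x - (s * A) *\<^sub>R b)) - f (x - A *\<^sub>R b)"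
    and "continuous_on S (\<lambda>s::real. f (x - (s * A) *\<^sub>R b))"
proof -
  have cont: "continuous_on S (\<lambda>s::real. f (x - (s * A) *\<^sub>R b))" if "f \<in> Cinf" for f :: "'a \<Rightarrow> complex" and S
    by (intro continuous_on_compose2[OF Cinf_continuous_on[OF that, of UNIV]] continuous_intros) auto
  from cont[OF f] show "continuous_on S (\<lambda>s::real. f (x - (s * A) *\<^sub>R b))" .
  let ?p = "\<lambda>s. x - (s * A) *\<^sub>R b"
  have d: "((\<lambda>s. f (?p s)) has_vector_derivative - (of_real A * dir_deriv b f (?p s))) (at s within S)" for s S
  proof -
    have "(?p has_derivative (\<lambda>h. - (h * A) *\<^sub>R b)) (at s)"
      by (auto intro!: derivative_eq_intros)
    from has_derivative_compose[OF this Cinf_has_derivative[OF f]]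
    have "((\<lambda>s. f (?p s)) has_vector_derivative - (of_real A * dir_deriv b f (?p s))) (at s)"
      by (simp add: has_vector_derivative_def dir_deriv_scaleR[OF f] scaleR_conv_of_real
          linear_neg[OF linear_dir_deriv[OF f]] mult_ac)
    then show ?thesis by (rule has_vector_derivative_at_within)
  qed
  have "((\<lambda>s. - (of_real A * dir_deriv b f (?p s))) has_integral f (?p 1) - f (?p 0)) {0..1}"
    by (rule fundamental_theorem_of_calculus[OF _ d]) simp
  from has_integral_neg[OF this] show "of_real A * integral {0..1} (\<lambda>s. dir_deriv b f (?p s)) = f x - f (x - A *\<^sub>R b)"
    by (simp add: integral_unique flip: integral_mult_right)
  have "((\<lambda>s. s *\<^sub>R f (?p s)) has_vector_derivative s *\<^sub>R (- (of_real A * dir_deriv b f (?p s))) + 1 *\<^sub>R f (?p s)) (at s within {0..1})" for s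
    by (rule has_vector_derivative_scaleR[OF _ d]) auto
  then have "((\<lambda>s. s *\<^sub>R (- (of_real A * dir_deriv b f (?p s))) + 1 *\<^sub>R f (?p s)) has_integral 1 *\<^sub>R f (?p 1) - 0 *\<^sub>R f (?p 0)) {0..1}"
    by (intro fundamental_theorem_of_calculus) auto
  then have 1: "((\<lambda>s. f (?p s) - of_real A * (of_real s * dir_deriv b f (?p s))) has_integral f (x - A *\<^sub>R b)) {0..1}"
    by (simp add: scaleR_conv_of_real algebra_simps)
  have "((\<lambda>s. f (?p s)) has_integral integral {0..1} (\<lambda>s. f (?p s))) {0..1}"
    by (intro integrable_integral integrable_continuous_real cont f)
  from has_integral_diff[OF this 1]
  show "of_real A * integral {0..1} (\<lambda>s. of_real s * dir_deriv b f (?p s)) =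
      integral {0..1} (\<lambda>s. f (?p s)) - f (x - A *\<^sub>R b)"
    by (simp add: integral_unique flip: integral_mult_right)
qed

text \<open>The cross relation at the level of operators, \<open>\<partial>\<^sub>v\<close> Q_a =
  Q_a \<open>\<partial>\<^sub>w\<close> + k_a Da(v) with w = s_a v. The product rule and
  differentiation under the integral give it up to integrals of the derivative along the co-root,
  which are boundary terms.\<close>

lemma int_refl_has_derivative:
  assumes f: "f \<in> Cinf"
  shows "(int_refl k a f has_derivative (\<lambda>v. int_refl k a (dir_deriv (lin_refl (fst a) v) f) x
    + of_real (k a * blinfun_apply (fst a) v) * f x)) (at x)"
proof -
  let ?b = "coroot (fst a)" and ?A = "aff_apply a x"
  let ?p = "\<lambda>s. x - (s * ?A) *\<^sub>R ?b"
  have A: "(aff_apply a has_derivative blinfun_apply (fst a)) (at x)"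
    unfolding aff_apply_def by (auto intro!: derivative_eq_intros)
  have "(aff_refl a has_derivative lin_refl (fst a)) (at x)"
    unfolding aff_refl_def lin_refl_def by (auto intro!: derivative_eq_intros A)
  note 1 = has_derivative_compose[OF this Cinf_has_derivative[OF f]]
  have 2: "((\<lambda>x. complex_of_real (k a * aff_apply a x)) has_derivative
      (\<lambda>v. of_real (k a * blinfun_apply (fst a) v))) (at x)"
    by (auto intro!: derivative_eq_intros A)
  note cont = segment_integrals(3)
  have d: "integral {0..1} (\<lambda>s. dir_deriv (v - (s * c) *\<^sub>R ?b) f (?p s)) =
      integral {0..1} (\<lambda>s. dir_deriv v f (?p s)) -
      of_real c * integral {0..1} (\<lambda>s. of_real s * dir_deriv ?b f (?p s))" for v c
  proof -
    have "integral {0..1} (\<lambda>s. dir_deriv (v - (s * c) *\<^sub>R ?b) f (?p s)) =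
       integral {0..1} (\<lambda>s. dir_deriv v f (?p s) - of_real c * (of_real s * dir_deriv ?b f (?p s)))"
      by (simp add: dir_deriv_diff[OF f] dir_deriv_scaleR[OF f] scaleR_conv_of_real mult_ac)
    also have "\<dots> = integral {0..1} (\<lambda>s. dir_deriv v f (?p s)) -
      integral {0..1} (\<lambda>s. of_real c * (of_real s * dir_deriv ?b f (?p s)))"
      by (intro integral_diff integrable_continuous_real continuous_intros cont Cinf_dir_deriv f)
    finally show ?thesis by simp
  qed
  have d': "integral {0..1} (\<lambda>s. dir_deriv (v - c *\<^sub>R ?b) f (?p s)) =
      integral {0..1} (\<lambda>s. dir_deriv v f (?p s)) -
      of_real c * integral {0..1} (\<lambda>s. dir_deriv ?b f (?p s))" for v c
  proof -
    have "integral {0..1} (\<lambda>s. dir_deriv (v - c *\<^sub>R ?b) f (?p s)) =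
       integral {0..1} (\<lambda>s. dir_deriv v f (?p s) - of_real c * (dir_deriv ?b f (?p s)))"
      by (simp add: dir_deriv_diff[OF f] dir_deriv_scaleR[OF f] scaleR_conv_of_real mult_ac)
    also have "\<dots> = integral {0..1} (\<lambda>s. dir_deriv v f (?p s)) -
      integral {0..1} (\<lambda>s. of_real c * dir_deriv ?b f (?p s))"
      by (intro integral_diff integrable_continuous_real continuous_intros cont Cinf_dir_deriv f)
    finally show ?thesis by simp
  qed
  have Q: "int_refl k a f = (\<lambda>x. f (aff_refl a x) + of_real (k a * aff_apply a x) *
    integral {0..1} (\<lambda>s. f (x - (s * aff_apply a x) *\<^sub>R ?b)))"
    by (rule ext) (rule int_refl_eq[OF f])
  show ?thesis unfolding Q
  proof (rule has_derivative_eq_rhs[OF has_derivative_add[OF 1 has_derivative_mult[OF 2 has_derivative_segment_integral[OF f]]]], rule ext)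
    fix v
    let ?c = "blinfun_apply (fst a) v" and ?I = "integral {0..1} (\<lambda>s. dir_deriv v f (?p s))"
    let ?J = "integral {0..1} (\<lambda>s. of_real s * dir_deriv ?b f (?p s))"
      and ?K = "integral {0..1} (\<lambda>s. dir_deriv ?b f (?p s))" and ?M = "integral {0..1} (\<lambda>s. f (?p s))"
    note s = segment_integrals(1,2)[OF f, where A="?A" and b="?b" and x=x]
    have sx: "x - ?A *\<^sub>R ?b = aff_refl a x" by (simp add: aff_refl_def)
    \<comment> \<open>J comes from the varying length of the segment, K from replacing v by s_a v
      inside Q_a. After multiplication by A both are explicit, and what remains of their difference
      is the term with f x.\<close>
    have "of_real (k a * ?A) * (?I - of_real ?c * ?J) + of_real (k a * ?c) * ?M
      = of_real (k a * ?A) * ?I - of_real (k a * ?c) * (of_real ?A * ?J) + of_real (k a * ?c) * ?M"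
      by (simp add: algebra_simps)
    also have "\<dots> = of_real (k a * ?A) * ?I + of_real (k a * ?c) * f (aff_refl a x)"
      unfolding s sx by (simp add: algebra_simps)
    also have "\<dots> = of_real (k a * ?A) * ?I - of_real (k a * ?c) * (f x - f (aff_refl a x)) + of_real (k a * ?c) * f x"
      by (simp add: algebra_simps)
    also have "\<dots> = of_real (k a * ?A) * (?I - of_real ?c * ?K) + of_real (k a * ?c) * f x"
      unfolding s(1)[unfolded sx, symmetric] by (simp add: algebra_simps)
    finally have *: "of_real (k a * ?A) * (?I - of_real ?c * ?J) + of_real (k a * ?c) * ?M
       = of_real (k a * ?A) * (?I - of_real ?c * ?K) + of_real (k a * ?c) * f x" .
    show "dir_deriv (lin_refl (fst a) v) f (aff_refl a x) +
         (of_real (k a * ?A) * integral {0..1} (\<lambda>s. dir_deriv (v - (s * ?c) *\<^sub>R ?b) f (?p s)) +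
          of_real (k a * ?c) * ?M) =
         int_refl k a (dir_deriv (lin_refl (fst a) v) f) x + of_real (k a * ?c) * f x"
      unfolding d int_refl_eq[OF Cinf_dir_deriv[OF f]] using * d'[of v ?c]
      by (simp add: lin_refl_def add.assoc)
  qed
qed

lemma dir_deriv_int_refl:
  "f \<in> Cinf \<Longrightarrow> dir_deriv v (int_refl k a f) =
    (\<lambda>x. int_refl k a (dir_deriv (lin_refl (fst a) v) f) x + of_real (k a * blinfun_apply (fst a) v) * f x)"
  by (rule ext) (erule dir_deriv_eqI[OF int_refl_has_derivative])

text \<open>The derivative of Q_a f is Q_a of another smooth function plus a multiple of f, hence
  the induction over all f at once.\<close>

lemma int_refl_Cinf:
  assumes "f \<in> Cinf"
  shows "int_refl k a f \<in> Cinf"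
proof -
  have "Ck_fun n (int_refl k a f)" if "f \<in> Cinf" for n f
    using that
  proof (induction n arbitrary: f)
    case 0
    then show ?case
      using has_derivative_continuous[OF int_refl_has_derivative[OF 0]]
      by (metis Ck_fun.simps(1) continuous_at_imp_continuous_on)
  next
    case (Suc n)
    have "Ck_fun n (\<lambda>x. of_real (k a * blinfun_apply (fst a) v) * f x)" for v
      using Cinf_cmult[OF Suc.prems] by (simp add: Cinf_def)
    then show ?case
      by (intro Ck_fun_SucI[OF int_refl_has_derivative[OF Suc.prems]] Ck_fun_add
          Suc.IH[OF Cinf_dir_deriv[OF Suc.prems]])
  qed
  from this[OF assms] show ?thesis by (simp add: Cinf_def)
qed

lemma int_refl_add:
  assumes "f \<in> Cinf" "g \<in> Cinf"
  shows "int_refl k a (\<lambda>x. f x + g x) = (\<lambda>x. int_refl k a f x + int_refl k a g x)"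
proof
  fix x
  have "integral {0..1} (\<lambda>s. f (x - (s * aff_apply a x) *\<^sub>R coroot (fst a)) + g (x - (s * aff_apply a x) *\<^sub>R coroot (fst a)))
    = integral {0..1} (\<lambda>s. f (x - (s * aff_apply a x) *\<^sub>R coroot (fst a))) + integral {0..1} (\<lambda>s. g (x - (s * aff_apply a x) *\<^sub>R coroot (fst a)))"
    by (intro integral_add integrable_continuous_real segment_integrals(3) assms)
  then show "int_refl k a (\<lambda>x. f x + g x) x = int_refl k a f x + int_refl k a g x"
    by (simp add: int_refl_eq assms Cinf_add algebra_simps)
qed

lemma int_refl_cmult: "f \<in> Cinf \<Longrightarrow> int_refl k a (\<lambda>x. c * f x) = (\<lambda>x. c * int_refl k a f x)"
  by (simp add: int_refl_eq Cinf_cmult fun_eq_iff algebra_simps)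

text \<open>On the wall the reflection is trivial and the interval degenerates. This is the source
  of all vanishing points fed into \<open>intertwiner_eq_0\<close>.\<close>

lemma int_refl_wall: "f \<in> Cinf \<Longrightarrow> aff_apply a x = 0 \<Longrightarrow> int_refl k a f x = f x"
  by (simp add: int_refl_eq aff_refl_def)

text \<open>Differentiating the fundamental theorem along a segment in direction v with respect to w
  shows that the commutator has integral zero over every such segment; shrinking the segment gives
  the pointwise statement.\<close>

lemma dir_deriv_commute:
  assumes f: "f \<in> Cinf"
  shows "dir_deriv v (dir_deriv w f) = dir_deriv w (dir_deriv v f)"
proof
  fix x
  define g where "g = (\<lambda>y. dir_deriv w (dir_deriv v f) y - dir_deriv v (dir_deriv w f) y)"
  have g: "g \<in> Cinf" unfolding g_def by (intro Cinf_diff Cinf_dir_deriv f)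
  have zero: "of_real A * integral {0..1} (\<lambda>s. g (x - (s * A) *\<^sub>R v)) = 0" for A x
  proof -
    \<comment> \<open>A constant functional turns \<open>has_derivative_segment_integral\<close>
      into a statement about segments of fixed length.\<close>
    have a: "aff_apply (0, A) y = A" for y :: 'a by (simp add: aff_apply_def)
    have 1: "of_real A * integral {0..1} (\<lambda>s. dir_deriv v f (y - (s * A) *\<^sub>R v)) = f y - f (y - A *\<^sub>R v)" for y
      by (rule segment_integrals(1)[OF f])
    have "((\<lambda>y. of_real A * integral {0..1} (\<lambda>s. dir_deriv v f (y - (s * A) *\<^sub>R v))) has_derivative
      (\<lambda>w. of_real A * integral {0..1} (\<lambda>s. dir_deriv w (dir_deriv v f) (x - (s * A) *\<^sub>R v)))) (at x)"
      using has_derivative_mult_right[OF has_derivative_segment_integral[OF Cinf_dir_deriv[OF f], where a="(0, A)" and b=v and x=x], of "of_real A"]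
      by (simp add: a)
    from dir_deriv_eqI[OF this, of w]
    have "of_real A * integral {0..1} (\<lambda>s. dir_deriv w (dir_deriv v f) (x - (s * A) *\<^sub>R v)) =
      dir_deriv w (\<lambda>y. f y - f (y - A *\<^sub>R v)) x" by (simp add: 1)
    also have "\<dots> = dir_deriv w f x - dir_deriv w f (x - A *\<^sub>R v)"
    proof -
      have "((\<lambda>y. y - A *\<^sub>R v) has_derivative (\<lambda>h. h)) (at x)" by (auto intro!: derivative_eq_intros)
      from has_derivative_diff[OF Cinf_has_derivative[OF f] has_derivative_compose[OF this Cinf_has_derivative[OF f]]]
      show ?thesis by (rule dir_deriv_eqI)
    qed
    also have "\<dots> = of_real A * integral {0..1} (\<lambda>s. dir_deriv v (dir_deriv w f) (x - (s * A) *\<^sub>R v))"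
      by (rule segment_integrals(1)[OF Cinf_dir_deriv[OF f], symmetric])
    finally have "of_real A * (integral {0..1} (\<lambda>s. dir_deriv w (dir_deriv v f) (x - (s * A) *\<^sub>R v)) -
       integral {0..1} (\<lambda>s. dir_deriv v (dir_deriv w f) (x - (s * A) *\<^sub>R v))) = 0"
      by (simp add: algebra_simps)
    also have "integral {0..1} (\<lambda>s. dir_deriv w (dir_deriv v f) (x - (s * A) *\<^sub>R v)) -
       integral {0..1} (\<lambda>s. dir_deriv v (dir_deriv w f) (x - (s * A) *\<^sub>R v)) =
       integral {0..1} (\<lambda>s. g (x - (s * A) *\<^sub>R v))"
      unfolding g_def
      by (intro integral_diff[symmetric] integrable_continuous_real segment_integrals(3) Cinf_dir_deriv f)
    finally show ?thesis .
  qed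
  have cg: "continuous_on UNIV (\<lambda>A. integral (cbox 0 1) (\<lambda>s. g (x - (s * A) *\<^sub>R v)))"
    by (rule integral_continuous_on_param)
       (auto simp: split_beta intro!: continuous_on_compose2[OF Cinf_continuous_on[OF g, of UNIV]] continuous_intros)
  have "((\<lambda>A. integral {0..1} (\<lambda>s. g (x - (s * A) *\<^sub>R v))) \<longlongrightarrow> integral {0..1} (\<lambda>s. g (x - (s * 0) *\<^sub>R v))) (at 0)"
    using cg[unfolded continuous_on_def, rule_format, of 0] by simp
  moreover have "((\<lambda>A::real. integral {0..1} (\<lambda>s. g (x - (s * A) *\<^sub>R v))) \<longlongrightarrow> 0) (at 0)"
    using zero by (intro tendsto_eventually) (auto simp: eventually_at_filter intro!: always_eventually)
  ultimately have "g x = 0"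
    using tendsto_unique[OF at_neq_bot] by fastforce
  then show "dir_deriv v (dir_deriv w f) x = dir_deriv w (dir_deriv v f) x"
    by (simp add: g_def)
qed

section \<open>Operators intertwining derivatives\<close>

text \<open>The complex polynomial functions of degree less than \<open>m\<close>.\<close>

primrec poly_fun_less :: "nat \<Rightarrow> ('a::euclidean_space \<Rightarrow> complex) set" where
  "poly_fun_less 0 = {\<lambda>x. 0}"
| "poly_fun_less (Suc m) = {f \<in> Cinf. \<forall>v. dir_deriv v f \<in> poly_fun_less m}"

lemma poly_fun_less_Cinf: "f \<in> poly_fun_less m \<Longrightarrow> f \<in> Cinf"
  by (cases m) (auto simp: Cinf_const)

lemma zero_poly_fun_less: "(\<lambda>x. 0) \<in> poly_fun_less m"
  by (induction m) (auto simp: Cinf_const dir_deriv_const)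

lemma poly_fun_less_Suc: "f \<in> poly_fun_less m \<Longrightarrow> f \<in> poly_fun_less (Suc m)"
proof (induction m arbitrary: f)
  case 0
  then show ?case by (simp add: Cinf_const dir_deriv_const)
next
  case (Suc m)
  have "f \<in> Cinf" "dir_deriv v f \<in> poly_fun_less (Suc m)" for v
    using Suc.prems Suc.IH by auto
  then show ?case by (subst poly_fun_less.simps(2)) simp
qed

lemma poly_fun_less_mono: "f \<in> poly_fun_less m \<Longrightarrow> m \<le> n \<Longrightarrow> f \<in> poly_fun_less n"
  by (induction n) (auto simp: le_Suc_eq poly_fun_less_Suc simp del: poly_fun_less.simps)

lemma poly_fun_less_add:
  "f \<in> poly_fun_less m \<Longrightarrow> g \<in> poly_fun_less m \<Longrightarrow> (\<lambda>x. f x + g x) \<in> poly_fun_less m"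
  by (induction m arbitrary: f g) (auto simp: Cinf_add dir_deriv_add_fun)

text \<open>The sharp bound for nonzero factors would be m + n - 1; the weaker one avoids truncated
  subtraction. Each term of the Leibniz rule lowers the bound of one factor, hence the induction on
  m + n.\<close>

lemma poly_fun_less_mult:
  "f \<in> poly_fun_less m \<Longrightarrow> g \<in> poly_fun_less n \<Longrightarrow> (\<lambda>x. f x * g x) \<in> poly_fun_less (m + n)"
proof (induction "m + n" arbitrary: m n f g rule: less_induct)
  case less
  show ?case
  proof (cases "m = 0 \<or> n = 0")
    case True
    then show ?thesis using less.prems zero_poly_fun_less by auto
  next
    case False
    then obtain m' n' where mn: "m = Suc m'" "n = Suc n'" by (metis not0_implies_Suc)
    have C: "f \<in> Cinf" "g \<in> Cinf" using less.prems poly_fun_less_Cinf by auto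
    have d: "dir_deriv v f \<in> poly_fun_less m'" "dir_deriv v g \<in> poly_fun_less n'" for v
      using less.prems by (auto simp: mn)
    have "(\<lambda>x. f x * dir_deriv v g x) \<in> poly_fun_less (m + n')"
      "(\<lambda>x. dir_deriv v f x * g x) \<in> poly_fun_less (m' + n)" for v
      using less.hyps[OF _ less.prems(1) d(2)] less.hyps[OF _ d(1) less.prems(2)] by (simp_all add: mn)
    then have "(\<lambda>x. f x * dir_deriv v g x + dir_deriv v f x * g x) \<in> poly_fun_less (m + n')" for v
      by (intro poly_fun_less_add) (simp_all add: mn del: poly_fun_less.simps)
    then have "dir_deriv v (\<lambda>x. f x * g x) \<in> poly_fun_less (m + n')" for v
      by (simp add: dir_deriv_mult C)
    moreover have "m + n = Suc (m + n')" by (simp add: mn)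
    ultimately show ?thesis by (simp add: Cinf_mult C)
  qed
qed

text \<open>Connects the polynomials supplied by Stone-Weierstrass with the class defined through
  iterated derivatives, by way of real and imaginary parts.\<close>

lemma polynomial_function_poly_fun_less:
  fixes g :: "'a::euclidean_space \<Rightarrow> complex"
  assumes "polynomial_function g"
  shows "\<exists>m. g \<in> poly_fun_less m"
proof -
  have real: "\<exists>m. (\<lambda>x. complex_of_real (h x)) \<in> poly_fun_less m"
    if "real_polynomial_function h" for h :: "'a \<Rightarrow> real"
    using that
  proof (induction rule: real_polynomial_function.induct)
    case (linear f)
    then have l: "bounded_linear (\<lambda>x. complex_of_real (f x))"
      by (rule bounded_linear_compose[OF bounded_linear_of_real])
    show ?case
      by (rule exI[of _ 2])
         (simp add: numeral_2_eq_2 Cinf_bounded_linear[OF l] dir_deriv_bounded_linear[OF l] Cinf_const dir_deriv_const)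
  next
    case (const c)
    show ?case by (rule exI[of _ 1]) (simp add: Cinf_const dir_deriv_const)
  next
    case (add f g)
    then obtain m n where "(\<lambda>x. complex_of_real (f x)) \<in> poly_fun_less m" "(\<lambda>x. complex_of_real (g x)) \<in> poly_fun_less n"
      by blast
    then have "(\<lambda>x. complex_of_real (f x)) \<in> poly_fun_less (max m n)" "(\<lambda>x. complex_of_real (g x)) \<in> poly_fun_less (max m n)"
      by (simp_all add: poly_fun_less_mono[OF _ max.cobounded1] poly_fun_less_mono[OF _ max.cobounded2])
    from poly_fun_less_add[OF this] show ?case by auto
  next
    case (mult f g)
    then obtain m n where "(\<lambda>x. complex_of_real (f x)) \<in> poly_fun_less m" "(\<lambda>x. complex_of_real (g x)) \<in> poly_fun_less n"
      by blast
    from poly_fun_less_mult[OF this] show ?case by auto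
  qed
  have "real_polynomial_function (\<lambda>x. Re (g x))" "real_polynomial_function (\<lambda>x. Im (g x))"
    using assms[unfolded polynomial_function_def o_def] bounded_linear_Re bounded_linear_Im by blast+
  then obtain m n where m: "(\<lambda>x. complex_of_real (Re (g x))) \<in> poly_fun_less m"
    and n: "(\<lambda>x. complex_of_real (Im (g x))) \<in> poly_fun_less n"
    using real by metis
  have "(\<lambda>x. \<i>) \<in> poly_fun_less 1" by (simp add: Cinf_const dir_deriv_const)
  from poly_fun_less_mult[OF this n]
  have "(\<lambda>x. \<i> * complex_of_real (Im (g x))) \<in> poly_fun_less (max m (1 + n))"
    by (rule poly_fun_less_mono) simp
  moreover have "(\<lambda>x. complex_of_real (Re (g x))) \<in> poly_fun_less (max m (1 + n))"
    using m by (rule poly_fun_less_mono) simp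
  ultimately have "(\<lambda>x. complex_of_real (Re (g x)) + \<i> * complex_of_real (Im (g x))) \<in> poly_fun_less (max m (1 + n))"
    by (rule poly_fun_less_add[rotated])
  then show ?thesis unfolding complex_eq[symmetric] by blast
qed

section \<open>Boundedness on balls and the vanishing of intertwiners\<close>

definition op_bound ::
    "(('a::euclidean_space \<Rightarrow> complex) \<Rightarrow> 'a \<Rightarrow> complex) \<Rightarrow> real \<Rightarrow> real \<Rightarrow> real \<Rightarrow> bool" where
  "op_bound D r r' C \<longleftrightarrow> 0 \<le> C \<and> (\<forall>f\<in>Cinf. \<forall>M.
     (\<forall>y. norm y \<le> r' \<longrightarrow> norm (f y) \<le> M) \<longrightarrow> (\<forall>x. norm x \<le> r \<longrightarrow> norm (D f x) \<le> C * M))"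

text \<open>Continuity for uniform convergence on balls. The radius may grow from r to r', because a
  word operator evaluates f at reflected points and along segments.\<close>

definition locally_bounded_op :: "(('a::euclidean_space \<Rightarrow> complex) \<Rightarrow> 'a \<Rightarrow> complex) \<Rightarrow> bool" where
  "locally_bounded_op D \<longleftrightarrow> (\<forall>r. \<exists>r' C. op_bound D r r' C)"

lemma op_boundI:
  assumes "0 \<le> C" and "\<And>f M x. f \<in> Cinf \<Longrightarrow> (\<And>y. norm y \<le> r' \<Longrightarrow> norm (f y) \<le> M) \<Longrightarrow>
    norm x \<le> r \<Longrightarrow> norm (D f x) \<le> C * M"
  shows "op_bound D r r' C"
  unfolding op_bound_def using assms(1) by (intro conjI ballI allI impI assms(2)) auto

lemma op_boundD:
  assumes "op_bound D r r' C" and "f \<in> Cinf" and "\<And>y. norm y \<le> r' \<Longrightarrow> norm (f y) \<le> M" and "norm x \<le> r"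
  shows "norm (D f x) \<le> C * M"
  using assms unfolding op_bound_def by simp

lemma op_bound_nonneg: "op_bound D r r' C \<Longrightarrow> 0 \<le> C"
  by (simp add: op_bound_def)

lemma locally_bounded_op_id: "locally_bounded_op (\<lambda>f. f)"
  unfolding locally_bounded_op_def
proof
  fix r show "\<exists>r' C. op_bound (\<lambda>f. f) r r' C"
    by (intro exI[of _ r] exI[of _ 1] op_boundI) auto
qed

lemma locally_bounded_op_comp:
  fixes D E :: "('a::euclidean_space \<Rightarrow> complex) \<Rightarrow> 'a \<Rightarrow> complex"
  assumes D: "locally_bounded_op D" and E: "locally_bounded_op E" and "\<And>f. f \<in> Cinf \<Longrightarrow> E f \<in> Cinf"
  shows "locally_bounded_op (\<lambda>f. D (E f))"
  unfolding locally_bounded_op_def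
proof
  fix r
  obtain r' C where 1: "op_bound D r r' C" using D unfolding locally_bounded_op_def by metis
  obtain r'' C' where 2: "op_bound E r' r'' C'" using E unfolding locally_bounded_op_def by metis
  have "op_bound (\<lambda>f. D (E f)) r r'' (C * C')"
  proof (rule op_boundI)
    show "0 \<le> C * C'" using 1 2 op_bound_nonneg by (metis mult_nonneg_nonneg)
    fix f :: "'a \<Rightarrow> complex" and M :: real and x :: 'a
    assume f: "f \<in> Cinf" "\<And>y. norm y \<le> r'' \<Longrightarrow> norm (f y) \<le> M" and x: "norm x \<le> r"
    from op_boundD[OF 1 assms(3)[OF f(1)] op_boundD[OF 2 f] x]
    show "norm (D (E f) x) \<le> C * C' * M" by (simp add: mult.assoc)
  qed
  then show "\<exists>r' C. op_bound (\<lambda>f. D (E f)) r r' C" by blast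
qed

lemma locally_bounded_op_diff:
  fixes D E :: "('a::euclidean_space \<Rightarrow> complex) \<Rightarrow> 'a \<Rightarrow> complex"
  assumes D: "locally_bounded_op D" and E: "locally_bounded_op E"
  shows "locally_bounded_op (\<lambda>f x. D f x - E f x)"
  unfolding locally_bounded_op_def
proof
  fix r
  obtain r' C where 1: "op_bound D r r' C" using D unfolding locally_bounded_op_def by metis
  obtain r'' C' where 2: "op_bound E r r'' C'" using E unfolding locally_bounded_op_def by metis
  have "op_bound (\<lambda>f x. D f x - E f x) r (max r' r'') (C + C')"
  proof (rule op_boundI)
    show "0 \<le> C + C'" using 1 2 op_bound_nonneg by (metis add_nonneg_nonneg)
    fix f :: "'a \<Rightarrow> complex" and M :: real and x :: 'a
    assume f: "f \<in> Cinf" and M: "\<And>y. norm y \<le> max r' r'' \<Longrightarrow> norm (f y) \<le> M" and x: "norm x \<le> r"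
    have "norm (D f x) \<le> C * M" by (rule op_boundD[OF 1 f M x]) simp
    moreover have "norm (E f x) \<le> C' * M" by (rule op_boundD[OF 2 f M x]) simp
    ultimately show "norm (D f x - E f x) \<le> (C + C') * M"
      using norm_triangle_ineq4[of "D f x" "E f x"] by (simp add: distrib_right)
  qed
  then show "\<exists>r' C. op_bound (\<lambda>f x. D f x - E f x) r r' C" by blast
qed

lemma locally_bounded_op_int_refl: "locally_bounded_op (int_refl k (a :: 'a::euclidean_space affine_functional))"
  unfolding locally_bounded_op_def
proof
  fix r :: real
  \<comment> \<open>m bounds the absolute value of a on the ball of radius r, and r' below is the
    reach of the segments starting in that ball.\<close>
  define m where "m = norm (fst a) * \<bar>r\<bar> + \<bar>snd a\<bar>"
  define r' where "r' = \<bar>r\<bar> + m * norm (coroot (fst a))"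
  have m0: "0 \<le> m" by (simp add: m_def)
  have "op_bound (int_refl k a) r r' (1 + \<bar>k a\<bar> * m)"
  proof (rule op_boundI)
    show "0 \<le> 1 + \<bar>k a\<bar> * m" using m0 by simp
    fix f :: "'a \<Rightarrow> complex" and M :: real and x :: 'a
    assume f: "f \<in> Cinf" and M: "\<And>y. norm y \<le> r' \<Longrightarrow> norm (f y) \<le> M" and x: "norm x \<le> r"
    have A: "\<bar>aff_apply a x\<bar> \<le> m"
    proof -
      have "\<bar>blinfun_apply (fst a) x\<bar> \<le> norm (fst a) * norm x"
        using norm_blinfun[of "fst a" x] by simp
      also have "\<dots> \<le> norm (fst a) * \<bar>r\<bar>" using x by (intro mult_left_mono) auto
      finally show ?thesis by (simp add: aff_apply_def m_def)
    qed
    have p: "norm (f (x - (s * aff_apply a x) *\<^sub>R coroot (fst a))) \<le> M" if "0 \<le> s" "s \<le> 1" for s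
    proof -
      have "\<bar>s * aff_apply a x\<bar> \<le> 1 * m"
        unfolding abs_mult using that A by (intro mult_mono) auto
      then have "\<bar>s * aff_apply a x\<bar> * norm (coroot (fst a)) \<le> m * norm (coroot (fst a))"
        by (intro mult_right_mono) auto
      then have "norm (x - (s * aff_apply a x) *\<^sub>R coroot (fst a)) \<le> r'"
        using norm_triangle_ineq4[of x "(s * aff_apply a x) *\<^sub>R coroot (fst a)"] x
        by (simp add: r'_def)
      with M show ?thesis by blast
    qed
    have M0: "0 \<le> M" using order_trans[OF norm_ge_zero p[of 0]] by simp
    have I: "norm (integral {0..1} (\<lambda>s. f (x - (s * aff_apply a x) *\<^sub>R coroot (fst a)))) \<le> M * (1 - 0)"
      by (intro integral_bound segment_integrals(3)[OF f] p) auto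
    have "norm (of_real (k a * aff_apply a x) * integral {0..1} (\<lambda>s. f (x - (s * aff_apply a x) *\<^sub>R coroot (fst a))))
      \<le> (\<bar>k a\<bar> * m) * M"
      unfolding norm_mult norm_of_real abs_mult using A I M0 m0 by (intro mult_mono) auto
    moreover have "norm (f (aff_refl a x)) \<le> M" using p[of 1] by (simp add: aff_refl_def)
    ultimately show "norm (int_refl k a f x) \<le> (1 + \<bar>k a\<bar> * m) * M"
      unfolding int_refl_eq[OF f] by (intro norm_triangle_le) (simp add: algebra_simps)
  qed
  then show "\<exists>r' C. op_bound (int_refl k a) r r' C" by blast
qed

text \<open>On polynomials \<open>D\<close> vanishes by induction on the degree: the derivatives of \<open>D f\<close> are
  values of \<open>D\<close> in lower degree, so \<open>D f\<close> is constant. Density of the polynomials does the rest.\<close>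

lemma intertwiner_eq_0:
  fixes D :: "('a::euclidean_space \<Rightarrow> complex) \<Rightarrow> 'a \<Rightarrow> complex"
  assumes bdd: "locally_bounded_op D"
    and Cinf: "\<And>f. f \<in> Cinf \<Longrightarrow> D f \<in> Cinf"
    and diff: "\<And>f g. f \<in> Cinf \<Longrightarrow> g \<in> Cinf \<Longrightarrow> D (\<lambda>x. f x - g x) = (\<lambda>x. D f x - D g x)"
    and twist: "\<And>v f. f \<in> Cinf \<Longrightarrow> dir_deriv v (D f) = D (dir_deriv (w v) f)"
    and point: "\<And>f. f \<in> Cinf \<Longrightarrow> D f z = 0"
    and f: "f \<in> Cinf"
  shows "D f = (\<lambda>x. 0)"
proof -
  have poly: "D p = (\<lambda>x. 0)" if "p \<in> poly_fun_less m" for p m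
    using that
  proof (induction m arbitrary: p)
    case 0
    then have p: "p = (\<lambda>x. 0)" by simp
    show ?case using diff[OF Cinf_const Cinf_const, of 0 0] by (simp add: p)
  next
    case (Suc m)
    then have p: "p \<in> Cinf" by simp
    have "dir_deriv v (D p) = (\<lambda>x. 0)" for v
      using Suc p by (simp add: twist)
    then show ?case
      using dir_deriv_zero_imp_const[OF Cinf[OF p], of _ z] point[OF p] by (simp add: fun_eq_iff)
  qed
  show ?thesis
  proof
    fix x :: 'a
    obtain r C where C: "op_bound D (norm x) r C" using bdd unfolding locally_bounded_op_def by metis
    have C0: "0 \<le> C" by (rule op_bound_nonneg[OF C])
    have "norm (D f x) \<le> e" if "e > 0" for e
    proof -
      \<comment> \<open>The summand 1 keeps the denominator positive when C = 0.\<close>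
      have "0 < e / (C + 1)" using that C0 by simp
      from Stone_Weierstrass_polynomial_function[OF compact_cball[of 0 r] Cinf_continuous_on[OF f] this]
      obtain g where g: "polynomial_function g" "\<forall>y\<in>cball 0 r. norm (f y - g y) < e / (C + 1)"
        by (elim exE conjE)
      obtain m where m: "g \<in> poly_fun_less m" using polynomial_function_poly_fun_less[OF g(1)] ..
      have gC: "g \<in> Cinf" by (rule poly_fun_less_Cinf[OF m])
      have "D f x = D (\<lambda>x. f x - g x) x" by (simp add: diff[OF f gC] poly[OF m])
      also have "norm \<dots> \<le> C * (e / (C + 1))"
        using g(2) by (intro op_boundD[OF C] Cinf_diff f gC) (auto simp: less_imp_le)
      also have "\<dots> \<le> e" using that C0 by (simp add: field_simps)
      finally show ?thesis .
    qed
    then have "norm (D f x) \<le> 0" by (rule field_le_epsilon) simp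
    then show "D f x = 0" by simp
  qed
qed

section \<open>Affine roots and reduced words\<close>

lemma dual_inner_add_left: "dual_inner (x + y) z = dual_inner x z + dual_inner y z"
  by (simp add: dual_inner_def blinfun.add_left algebra_simps sum.distrib)

lemma dual_inner_scaleR_left: "dual_inner (c *\<^sub>R x) z = c * dual_inner x z"
  by (simp add: dual_inner_def blinfun.scaleR_left sum_distrib_left mult_ac)

lemma dual_inner_commute: "dual_inner x y = dual_inner y x"
  by (simp add: dual_inner_def mult.commute)

lemma dual_inner_add_right: "dual_inner z (x + y) = dual_inner z x + dual_inner z y"
  by (simp add: dual_inner_commute[of z] dual_inner_add_left)

lemma dual_inner_scaleR_right: "dual_inner z (c *\<^sub>R x) = c * dual_inner z x"
  by (simp add: dual_inner_commute[of z] dual_inner_scaleR_left)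

lemma dual_inner_diff_left: "dual_inner (x - y) z = dual_inner x z - dual_inner y z"
  using dual_inner_add_left[of "x - y" y z] by simp

lemma dual_inner_diff_right: "dual_inner z (x - y) = dual_inner z x - dual_inner z y"
  by (simp add: dual_inner_commute[of z] dual_inner_diff_left)

lemma dual_inner_sum_right: "dual_inner z (sum f S) = (\<Sum>i\<in>S. dual_inner z (f i))"
  by (induction S rule: infinite_finite_induct)
     (auto simp: dual_inner_add_right, simp_all add: dual_inner_def)

lemma dual_inner_pos: "x \<noteq> 0 \<Longrightarrow> 0 < dual_inner x x"
proof -
  assume "x \<noteq> 0"
  then obtain b where b: "b \<in> Basis" "blinfun_apply x b \<noteq> 0"
    by (metis blinfun_euclidean_eqI zero_blinfun.rep_eq)
  then have "0 < blinfun_apply x b * blinfun_apply x b" by (simp add: zero_less_mult_iff) linarith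
  also have "\<dots> \<le> dual_inner x x"
    unfolding dual_inner_def using b by (intro member_le_sum) auto
  finally show ?thesis .
qed

lemma coroot_eqI:
  "(\<And>\<xi>. blinfun_apply \<xi> x = 2 * dual_inner \<xi> \<alpha> / dual_inner \<alpha> \<alpha>) \<Longrightarrow> coroot \<alpha> = x"
  using coroot_unique[of \<alpha>] coroot_apply[of _ \<alpha>] by blast

lemma coroot_self: "\<alpha> \<noteq> 0 \<Longrightarrow> blinfun_apply \<alpha> (coroot \<alpha>) = 2"
  using dual_inner_pos[of \<alpha>] by (simp add: coroot_apply)

text \<open>The functional \<open>b \<circ> s\<^sub>a\<close>.\<close>

definition root_refl :: "'a::euclidean_space affine_functional \<Rightarrow> 'a affine_functional \<Rightarrow> 'a affine_functional" where
  "root_refl a b = b - blinfun_apply (fst b) (coroot (fst a)) *\<^sub>R a"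

lemma aff_apply_root_refl: "aff_apply (root_refl a b) v = aff_apply b (aff_refl a v)"
  by (simp add: root_refl_def aff_apply_def aff_refl_def blinfun.diff_left blinfun.diff_right
      blinfun.add_right blinfun.scaleR_left blinfun.scaleR_right algebra_simps)

lemma aff_apply_eqD:
  assumes "\<And>v. aff_apply a v = aff_apply b v"
  shows "a = b"
proof -
  have "snd a = snd b" using assms[of 0] by (simp add: aff_apply_def)
  moreover have "fst a = fst b"
    using assms \<open>snd a = snd b\<close> by (intro blinfun_eqI) (simp add: aff_apply_def)
  ultimately show ?thesis by (rule prod_eqI[rotated])
qed

lemma aff_apply_aff_refl_self: "fst a \<noteq> 0 \<Longrightarrow> aff_apply a (aff_refl a v) = - aff_apply a v"
  by (simp add: aff_refl_def aff_apply_def blinfun.diff_right blinfun.scaleR_right coroot_self)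

lemma aff_refl_aff_refl: "fst a \<noteq> 0 \<Longrightarrow> aff_refl a (aff_refl a v) = v"
  by (simp add: aff_refl_def[of a "aff_refl a v"] aff_apply_aff_refl_self) (simp add: aff_refl_def)

lemma aff_refl_comp_self: "fst a \<noteq> 0 \<Longrightarrow> aff_refl a \<circ> aff_refl a = id"
  by (simp add: fun_eq_iff aff_refl_aff_refl)

lemma root_refl_root_refl: "fst a \<noteq> 0 \<Longrightarrow> root_refl a (root_refl a b) = b"
  by (rule aff_apply_eqD) (simp add: aff_apply_root_refl aff_refl_aff_refl)

lemma root_refl_self: "fst a \<noteq> 0 \<Longrightarrow> root_refl a a = - a"
proof -
  have "a - 2 *\<^sub>R a = - a" by (simp add: scaleR_2)
  then show "fst a \<noteq> 0 \<Longrightarrow> ?thesis" by (simp add: root_refl_def coroot_self)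
qed

lemma linear_root_refl: "linear (root_refl a)"
  by (rule linearI) (simp_all add: root_refl_def blinfun.add_left blinfun.scaleR_left algebra_simps)

text \<open>A reflection preserves \<open>dual_inner\<close>, so forming co-roots commutes with it.
  This yields the conjugation rule \<open>aff_refl_root_refl\<close>, on which the exchange argument
  rests.\<close>

lemma coroot_root_refl:
  assumes "fst a \<noteq> 0"
  shows "coroot (fst (root_refl a b)) = lin_refl (fst a) (coroot (fst b))"
proof (rule coroot_eqI)
  fix \<xi> :: "'a \<Rightarrow>\<^sub>L real"
  let ?a = "fst a" and ?b = "fst b"
  define c where "c = blinfun_apply ?b (coroot ?a)"
  have a: "dual_inner ?a ?a > 0" using assms by (rule dual_inner_pos)
  then have c: "c * dual_inner ?a ?a = 2 * dual_inner ?b ?a" by (simp add: c_def coroot_apply)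
  have g: "fst (root_refl a b) = ?b - c *\<^sub>R ?a" by (simp add: root_refl_def c_def)
  have n: "dual_inner (?b - c *\<^sub>R ?a) (?b - c *\<^sub>R ?a) = dual_inner ?b ?b"
    using c by (simp add: dual_inner_diff_left dual_inner_diff_right dual_inner_scaleR_left
        dual_inner_scaleR_right dual_inner_commute[of ?a ?b] algebra_simps)
  have "blinfun_apply \<xi> (lin_refl ?a (coroot ?b)) =
      2 * dual_inner \<xi> ?b / dual_inner ?b ?b - (2 * dual_inner ?a ?b / dual_inner ?b ?b) * (2 * dual_inner \<xi> ?a / dual_inner ?a ?a)"
    by (simp add: lin_refl_def blinfun.diff_right blinfun.scaleR_right coroot_apply)
  also have "\<dots> = 2 * (dual_inner \<xi> ?b - (2 * dual_inner ?b ?a / dual_inner ?a ?a) * dual_inner \<xi> ?a) / dual_inner ?b ?b"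
    by (simp add: dual_inner_commute[of ?a ?b] diff_divide_distrib algebra_simps)
  also have "2 * dual_inner ?b ?a / dual_inner ?a ?a = c"
    by (simp add: c_def coroot_apply)
  finally show "blinfun_apply \<xi> (lin_refl (fst a) (coroot (fst b))) =
    2 * dual_inner \<xi> (fst (root_refl a b)) / dual_inner (fst (root_refl a b)) (fst (root_refl a b))"
    unfolding g n by (simp add: dual_inner_diff_right dual_inner_scaleR_right)
qed

lemma aff_refl_diff_scaleR: "aff_refl a (x - c *\<^sub>R y) = aff_refl a x - c *\<^sub>R lin_refl (fst a) y"
  by (simp add: aff_refl_def lin_refl_def aff_apply_def blinfun.diff_right blinfun.scaleR_right algebra_simps)

lemma aff_refl_root_refl:
  assumes "fst a \<noteq> 0"
  shows "aff_refl (root_refl a b) = aff_refl a \<circ> aff_refl b \<circ> aff_refl a"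
proof
  fix v
  have "aff_refl a (aff_refl b (aff_refl a v)) =
      aff_refl a (aff_refl a v) - aff_apply b (aff_refl a v) *\<^sub>R lin_refl (fst a) (coroot (fst b))"
    by (subst aff_refl_def[of b]) (rule aff_refl_diff_scaleR)
  then show "aff_refl (root_refl a b) v = (aff_refl a \<circ> aff_refl b \<circ> aff_refl a) v"
    by (simp add: aff_refl_aff_refl assms aff_refl_def[of "root_refl a b"] aff_apply_root_refl
        coroot_root_refl)
qed

primrec word_map :: "'a::euclidean_space affine_functional list \<Rightarrow> 'a \<Rightarrow> 'a" where
  "word_map [] = id"
| "word_map (a # u) = aff_refl a \<circ> word_map u"

text \<open>The functional \<open>b \<circ> word_map u\<close>, i.e. \<open>w\<^sup>-\<^sup>1 b\<close> for \<open>w = word_map u\<close>.\<close>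

primrec word_pull :: "'a::euclidean_space affine_functional list \<Rightarrow> 'a affine_functional \<Rightarrow> 'a affine_functional" where
  "word_pull [] b = b"
| "word_pull (a # u) b = word_pull u (root_refl a b)"

lemma word_map_append: "word_map (u @ u') = word_map u \<circ> word_map u'"
  by (induction u) (auto simp: comp_assoc)

lemma word_pull_append: "word_pull (u @ u') b = word_pull u' (word_pull u b)"
  by (induction u arbitrary: b) auto

lemma aff_apply_word_pull: "aff_apply (word_pull u b) v = aff_apply b (word_map u v)"
  by (induction u arbitrary: b v) (auto simp: aff_apply_root_refl)

lemma word_pull_cong: "word_map u = word_map u' \<Longrightarrow> word_pull u b = word_pull u' b"
  by (rule aff_apply_eqD) (simp add: aff_apply_word_pull)

lemma linear_word_pull: "linear (word_pull u)"
proof (induction u)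
  case Nil
  then show ?case by (simp add: linear_id[unfolded id_def] linear_iff)
next
  case (Cons a u)
  from linear_compose[OF linear_root_refl[of a] this] show ?case by (simp add: o_def)
qed

lemma word_pull_const: "word_pull u (0, c) = (0, c)"
  by (rule aff_apply_eqD) (simp add: aff_apply_word_pull, simp add: aff_apply_def)

section \<open>Positive affine roots and the exchange property\<close>

locale affine_root_data =
  fixes R I0 :: "('a::euclidean_space \<Rightarrow>\<^sub>L real) set" and \<phi> :: "'a \<Rightarrow>\<^sub>L real"
  assumes root_system: "root_system R" and crystallographic: "crystallographic R"
    and reduced: "reduced_rs R" and root_basis: "root_basis R I0"
    and highest_root: "highest_root R I0 \<phi>"
begin

abbreviation I where "I \<equiv> affine_basis I0 \<phi>"
abbreviation \<Sigma> where "\<Sigma> \<equiv> affine_roots R"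

lemma independent_I0: "independent I0" and span_I0: "span I0 = UNIV" and I0_R: "I0 \<subseteq> R"
  using root_basis by (auto simp: root_basis_def)

lemma finite_I0: "finite I0"
  using I0_R root_system finite_subset by (auto simp: root_system_def)

lemma finite_I: "finite I"
  by (simp add: affine_basis_def finite_I0)

lemma phi_R: "\<phi> \<in> R"
  using highest_root by (simp add: highest_root_def)

lemma zero_notin_R: "0 \<notin> R"
  using root_system by (simp add: root_system_def)

lemma R_refl: "\<alpha> \<in> R \<Longrightarrow> \<beta> \<in> R \<Longrightarrow> \<beta> - blinfun_apply \<beta> (coroot \<alpha>) *\<^sub>R \<alpha> \<in> R"
  using root_system by (simp add: root_system_def)

lemma R_uminus:
  assumes "\<alpha> \<in> R" shows "- \<alpha> \<in> R"
proof -
  have "\<alpha> - 2 *\<^sub>R \<alpha> = - \<alpha>" by (simp add: scaleR_2)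
  moreover have "blinfun_apply \<alpha> (coroot \<alpha>) = 2" using assms zero_notin_R by (intro coroot_self) blast
  ultimately show ?thesis using R_refl[OF assms assms] by simp
qed

lemma root_fst_neq_0: "a \<in> \<Sigma> \<Longrightarrow> fst a \<noteq> 0"
  using zero_notin_R by (auto simp: affine_roots_def)

lemma I_roots: "I \<subseteq> \<Sigma>"
  using I0_R phi_R by (auto simp: affine_basis_def affine_roots_def R_uminus)

lemma I_root: "a \<in> I \<Longrightarrow> a \<in> \<Sigma>" using I_roots by blast

lemma I_fst_neq_0: "a \<in> I \<Longrightarrow> fst a \<noteq> 0"
  by (simp add: I_root root_fst_neq_0)

lemma root_uminus: "a \<in> \<Sigma> \<Longrightarrow> - a \<in> \<Sigma>"
  by (auto simp: affine_roots_def R_uminus)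

lemma root_refl_root: "a \<in> \<Sigma> \<Longrightarrow> b \<in> \<Sigma> \<Longrightarrow> root_refl a b \<in> \<Sigma>"
  using crystallographic R_refl
  by (auto simp: affine_roots_def root_refl_def crystallographic_def)

lemma word_pull_root: "set u \<subseteq> \<Sigma> \<Longrightarrow> b \<in> \<Sigma> \<Longrightarrow> word_pull u b \<in> \<Sigma>"
  by (induction u arbitrary: b) (auto simp: root_refl_root)

text \<open>The coordinates in the basis \<open>I\<close>, read off from (\<beta>, r) = r (- \<phi>,
  1) + (\<beta> + r \<phi>, 0).\<close>

definition co :: "'a affine_functional \<Rightarrow> 'a affine_functional \<Rightarrow> real" where
  "co a b = (if a = (- \<phi>, 1) then snd b else representation I0 (fst b + snd b *\<^sub>R \<phi>) (fst a))"

lemma linear_representation: "linear (\<lambda>x. representation I0 x \<alpha>)"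
  by (rule linearI)
     (simp_all add: real_vector.representation_add real_vector.representation_scale independent_I0 span_I0)

lemma linear_co: "linear (co a)"
proof (rule linearI)
  note l = linear_representation[of "fst a"]
  fix b c :: "'a affine_functional" and r :: real
  have "fst (b + c) + snd (b + c) *\<^sub>R \<phi> = (fst b + snd b *\<^sub>R \<phi>) + (fst c + snd c *\<^sub>R \<phi>)"
    by (simp add: algebra_simps)
  then show "co a (b + c) = co a b + co a c"
    unfolding co_def using linear_add[OF l] by simp
  have "fst (r *\<^sub>R b) + snd (r *\<^sub>R b) *\<^sub>R \<phi> = r *\<^sub>R (fst b + snd b *\<^sub>R \<phi>)"
    by (simp add: algebra_simps)
  then show "co a (r *\<^sub>R b) = r *\<^sub>R co a b"
    unfolding co_def using linear_cmul[OF l] by simp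
qed

lemmas co_diff = linear_diff[OF linear_co] and co_scaleR = linear_cmul[OF linear_co]
  and co_uminus = linear_neg[OF linear_co] and co_sum = linear_sum[OF linear_co]
  and co_zero = linear_0[OF linear_co] and co_add = linear_add[OF linear_co]

lemma zero_notin_I0: "0 \<notin> I0" using I0_R zero_notin_R by blast

lemma representation_I0: "\<alpha> \<in> I0 \<Longrightarrow> representation I0 \<alpha> \<beta> = (if \<beta> = \<alpha> then 1 else 0)"
  by (simp add: real_vector.representation_basis independent_I0)

lemma co_simple: "a \<in> I \<Longrightarrow> c \<in> I \<Longrightarrow> co a c = (if a = c then 1 else 0)"
  using real_vector.representation_zero[of I0]
  by (auto simp: affine_basis_def co_def representation_I0 split: if_splits)

lemma sum_representation_I0: "(\<Sum>\<alpha>\<in>I0. representation I0 x \<alpha> *\<^sub>R \<alpha>) = x"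
  by (rule real_vector.sum_representation_eq) (simp_all add: independent_I0 span_I0 finite_I0)

lemma co_expand: "(\<Sum>a\<in>I. co a b *\<^sub>R a) = b"
proof -
  have "(\<Sum>a\<in>I. co a b *\<^sub>R a) = co (- \<phi>, 1) b *\<^sub>R (- \<phi>, 1) + (\<Sum>a\<in>(\<lambda>\<alpha>. (\<alpha>, 0)) ` I0. co a b *\<^sub>R a)"
    unfolding affine_basis_def by (subst sum.insert) (auto simp: finite_I0)
  also have "(\<Sum>a\<in>(\<lambda>\<alpha>. (\<alpha>, 0)) ` I0. co a b *\<^sub>R a) = (\<Sum>\<alpha>\<in>I0. co (\<alpha>, 0) b *\<^sub>R (\<alpha>, 0))"
    by (subst sum.reindex) (auto simp: inj_on_def)
  also have "\<dots> = (\<Sum>\<alpha>\<in>I0. (representation I0 (fst b + snd b *\<^sub>R \<phi>) \<alpha> *\<^sub>R \<alpha>, 0))"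
    by (intro sum.cong) (auto simp: co_def)
  also have "\<dots> = (fst b + snd b *\<^sub>R \<phi>, 0)"
    by (intro prod_eqI) (simp_all add: fst_sum snd_sum sum_representation_I0)
  finally show ?thesis by (intro prod_eqI) (simp_all add: co_def)
qed

lemma representation_nat_comb:
  "x = (\<Sum>\<alpha>\<in>I0. real (c \<alpha>) *\<^sub>R \<alpha>) \<Longrightarrow> \<alpha> \<in> I0 \<Longrightarrow> representation I0 x \<alpha> = real (c \<alpha>)"
  using finite_I0
  by (simp add: linear_sum[OF linear_representation] linear_cmul[OF linear_representation] representation_I0
      if_distrib[of "times _"] cong: if_cong)

lemma root_basis_combination:
  "\<beta> \<in> R \<Longrightarrow> \<exists>c :: ('a \<Rightarrow>\<^sub>L real) \<Rightarrow> nat.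
     \<beta> = (\<Sum>\<alpha>\<in>I0. real (c \<alpha>) *\<^sub>R \<alpha>) \<or> \<beta> = - (\<Sum>\<alpha>\<in>I0. real (c \<alpha>) *\<^sub>R \<alpha>)"
  using root_basis[unfolded root_basis_def] by (elim conjE) (erule bspec)

lemma representation_root:
  assumes "\<beta> \<in> R" "\<alpha> \<in> I0"
  shows "representation I0 \<beta> \<alpha> \<in> \<int>" "0 \<le> representation I0 (\<phi> - \<beta>) \<alpha>" "0 \<le> representation I0 (\<phi> + \<beta>) \<alpha>"
proof -
  show "representation I0 \<beta> \<alpha> \<in> \<int>"
  proof -
    obtain c :: "_ \<Rightarrow> nat" where "\<beta> = (\<Sum>\<alpha>\<in>I0. real (c \<alpha>) *\<^sub>R \<alpha>) \<or> \<beta> = - (\<Sum>\<alpha>\<in>I0. real (c \<alpha>) *\<^sub>R \<alpha>)"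
      using root_basis_combination[OF assms(1)] by (elim exE)
    then show ?thesis
    proof
      assume "\<beta> = - (\<Sum>\<alpha>\<in>I0. real (c \<alpha>) *\<^sub>R \<alpha>)"
      then have "- \<beta> = (\<Sum>\<alpha>\<in>I0. real (c \<alpha>) *\<^sub>R \<alpha>)" by simp
      then have "- representation I0 \<beta> \<alpha> = real (c \<alpha>)"
        using representation_nat_comb[OF _ assms(2)] linear_neg[OF linear_representation] by metis
      then have "representation I0 \<beta> \<alpha> = - real (c \<alpha>)" by simp
      then show ?thesis by simp
    next
      assume "\<beta> = (\<Sum>\<alpha>\<in>I0. real (c \<alpha>) *\<^sub>R \<alpha>)"
      then have "representation I0 \<beta> \<alpha> = real (c \<alpha>)" using assms(2) by (rule representation_nat_comb)
      then show ?thesis by simp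
    qed
  qed
  have *: "0 \<le> representation I0 (\<phi> - \<beta>) \<alpha>" if \<beta>: "\<beta> \<in> R" for \<beta>
  proof -
    obtain c :: "_ \<Rightarrow> nat" where "\<phi> - \<beta> = (\<Sum>\<alpha>\<in>I0. real (c \<alpha>) *\<^sub>R \<alpha>)"
      using highest_root[unfolded highest_root_def, THEN conjunct2, rule_format, OF \<beta>] by (elim exE)
    from representation_nat_comb[OF this assms(2)] show ?thesis by simp
  qed
  from *[OF assms(1)] show "0 \<le> representation I0 (\<phi> - \<beta>) \<alpha>" .
  from *[OF R_uminus[OF assms(1)]] show "0 \<le> representation I0 (\<phi> + \<beta>) \<alpha>" by simp
qed

lemma representation_phi_nonneg: "\<alpha> \<in> I0 \<Longrightarrow> 0 \<le> representation I0 \<phi> \<alpha>"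
  using representation_root(3)[OF phi_R, of \<alpha>] by (simp add: linear_add[OF linear_representation])

text \<open>Positivity through coordinates makes sense for every affine functional and passes to
  nonnegative combinations, as \<open>coset_minimal_unique\<close> needs.\<close>

definition pos :: "'a affine_functional \<Rightarrow> bool" where
  "pos b \<longleftrightarrow> (\<forall>a\<in>I. 0 \<le> co a b)"

lemma co_Ints:
  assumes "b \<in> \<Sigma>" "a \<in> I"
  shows "co a b \<in> \<int>"
proof (cases "a = (- \<phi>, 1)")
  case True
  then show ?thesis using assms by (auto simp: co_def affine_roots_def)
next
  case False
  then obtain \<alpha> where "\<alpha> \<in> I0" "a = (\<alpha>, 0)" using assms by (auto simp: affine_basis_def)
  then show ?thesis
    using assms representation_root(1) phi_R
    by (auto simp: co_def affine_roots_def linear_add[OF linear_representation] linear_cmul[OF linear_representation])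
qed

text \<open>The root \<beta> + m has coordinate m at the affine simple root and the coordinates of
  \<beta> + m \<phi> elsewhere. As \<phi> dominates both \<beta> and - \<beta>, the sign of m
  decides when m is nonzero; m = 0 is the property of \<open>I0\<close>.\<close>

lemma pos_or_neg:
  assumes "b \<in> \<Sigma>"
  shows "pos b \<or> pos (- b)"
proof -
  obtain \<beta> m where b: "b = (\<beta>, of_int m)" "\<beta> \<in> R"
    using assms by (auto simp: affine_roots_def Ints_def)
  have l: "representation I0 (\<beta> + of_int m *\<^sub>R \<phi>) \<alpha> = representation I0 \<beta> \<alpha> + of_int m * representation I0 \<phi> \<alpha>" for \<alpha>
    by (simp add: linear_add[OF linear_representation] linear_cmul[OF linear_representation])
  consider "m \<ge> 1" | "m = 0" | "m \<le> -1" by linarith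
  then show ?thesis
  proof cases
    case 1
    have "0 \<le> representation I0 (\<beta> + of_int m *\<^sub>R \<phi>) \<alpha>" if "\<alpha> \<in> I0" for \<alpha>
    proof -
      have "1 * representation I0 \<phi> \<alpha> \<le> of_int m * representation I0 \<phi> \<alpha>"
        using 1 representation_phi_nonneg[OF that] by (intro mult_right_mono) auto
      then show ?thesis using representation_root(3)[OF b(2) that]
        unfolding l by (simp add: linear_add[OF linear_representation])
    qed
    then have "pos b" using 1 by (auto simp: pos_def affine_basis_def co_def b)
    then show ?thesis ..
  next
    case 2
    obtain c :: "_ \<Rightarrow> nat" where "\<beta> = (\<Sum>\<alpha>\<in>I0. real (c \<alpha>) *\<^sub>R \<alpha>) \<or> \<beta> = - (\<Sum>\<alpha>\<in>I0. real (c \<alpha>) *\<^sub>R \<alpha>)"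
      using root_basis_combination[OF b(2)] by (elim exE)
    then show ?thesis
    proof
      assume "\<beta> = (\<Sum>\<alpha>\<in>I0. real (c \<alpha>) *\<^sub>R \<alpha>)"
      from representation_nat_comb[OF this] have "pos b"
        by (auto simp: pos_def affine_basis_def co_def b 2)
      then show ?thesis ..
    next
      assume "\<beta> = - (\<Sum>\<alpha>\<in>I0. real (c \<alpha>) *\<^sub>R \<alpha>)"
      then have "- \<beta> = (\<Sum>\<alpha>\<in>I0. real (c \<alpha>) *\<^sub>R \<alpha>)" by simp
      from representation_nat_comb[OF this] have "pos (- b)"
        by (auto simp: pos_def affine_basis_def co_def b 2)
      then show ?thesis ..
    qed
  next
    case 3
    have "representation I0 (\<beta> + of_int m *\<^sub>R \<phi>) \<alpha> \<le> 0" if "\<alpha> \<in> I0" for \<alpha>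
    proof -
      have "of_int m * representation I0 \<phi> \<alpha> \<le> (-1) * representation I0 \<phi> \<alpha>"
        using 3 representation_phi_nonneg[OF that] by (intro mult_right_mono) auto
      then show ?thesis using representation_root(2)[OF b(2) that]
        unfolding l by (simp add: linear_diff[OF linear_representation])
    qed
    then have "pos (- b)"
      unfolding pos_def co_uminus using 3 by (auto simp: affine_basis_def co_def b)
    then show ?thesis ..
  qed
qed

lemma not_pos_and_neg:
  assumes "b \<in> \<Sigma>" "pos b"
  shows "\<not> pos (- b)"
proof
  assume "pos (- b)"
  then have "co a b = 0" if "a \<in> I" for a
    using assms that by (force simp: pos_def co_uminus)
  then have "b = 0" using co_expand[of b] by simp
  then show False using assms root_fst_neq_0 by fastforce
qed

lemma pos_uminus_iff: "b \<in> \<Sigma> \<Longrightarrow> pos (- b) \<longleftrightarrow> \<not> pos b"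
  using pos_or_neg not_pos_and_neg by blast

lemma pos_simple: "a \<in> I \<Longrightarrow> pos a"
  by (simp add: pos_def co_simple)

text \<open>Only the coordinate at a changes, so a positive coordinate elsewhere survives and fixes
  the sign. If there is none, b is a multiple of a, and reducedness forces b = a.\<close>

lemma pos_root_refl:
  assumes a: "a \<in> I" and b: "b \<in> \<Sigma>" "pos b" "b \<noteq> a"
  shows "pos (root_refl a b)"
proof (cases "\<exists>c\<in>I. c \<noteq> a \<and> co c b > 0")
  case True
  then obtain c where c: "c \<in> I" "c \<noteq> a" "co c b > 0" by blast
  then have "co c (root_refl a b) > 0"
    using a by (simp add: root_refl_def co_diff co_scaleR co_simple)
  then have "\<not> pos (- root_refl a b)" using c by (force simp: pos_def co_uminus)
  then show ?thesis using pos_or_neg root_refl_root I_root a b by blast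
next
  case False
  then have 0: "co c b = 0" if "c \<in> I" "c \<noteq> a" for c
    using b(2) that by (force simp: pos_def)
  have "b = (\<Sum>c\<in>I. if c = a then co a b *\<^sub>R a else 0)"
    by (subst co_expand[of b, symmetric]) (intro sum.cong, auto simp: 0)
  also have "\<dots> = co a b *\<^sub>R a" using a finite_I by simp
  finally have ba: "b = co a b *\<^sub>R a" .
  then have "co a b *\<^sub>R fst a = fst b" by (metis fst_scaleR)
  moreover have "fst a \<in> R" "fst b \<in> R" using b(1) I_root[OF a] by (auto simp: affine_roots_def)
  ultimately have "co a b = 1 \<or> co a b = -1"
    using reduced unfolding reduced_rs_def by metis
  moreover have "co a b \<ge> 0" using b(2) a by (auto simp: pos_def)
  ultimately have "co a b = 1" by linarith
  then show ?thesis using ba b by simp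
qed

text \<open>Carried through the word, the root stays positive until it equals the next letter, and
  that letter is the one deleted. Before that, s_b s_c = s_c s_d with d = s_c b moves the reflection
  one place to the right.\<close>

lemma exchange:
  assumes "set u \<subseteq> I" "b \<in> \<Sigma>" "pos b" "\<not> pos (word_pull u b)"
  shows "\<exists>xs c ys. u = xs @ c # ys \<and> aff_refl b \<circ> word_map u = word_map (xs @ ys)"
  using assms
proof (induction u arbitrary: b)
  case (Cons c u)
  have c: "c \<in> I" "set u \<subseteq> I" "fst c \<noteq> 0" using Cons.prems I_fst_neq_0 by auto
  show ?case
  proof (cases "b = c")
    case True
    have "aff_refl b \<circ> word_map (c # u) = word_map u"
      by (simp add: True aff_refl_comp_self c flip: comp_assoc)
    then show ?thesis by (metis append_Nil)
  next
    case False
    let ?b = "root_refl c b"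
    have "pos ?b" using pos_root_refl[OF c(1)] Cons.prems False by blast
    moreover have "?b \<in> \<Sigma>" using c Cons.prems by (simp add: I_root root_refl_root)
    moreover have "\<not> pos (word_pull u ?b)" using Cons.prems by simp
    ultimately have "\<exists>xs d ys. u = xs @ d # ys \<and> aff_refl ?b \<circ> word_map u = word_map (xs @ ys)"
      using Cons.IH[of ?b] c(2) by blast
    then obtain xs d ys where u: "u = xs @ d # ys" and e: "aff_refl ?b \<circ> word_map u = word_map (xs @ ys)"
      by blast
    have "aff_refl b \<circ> word_map (c # u) = aff_refl c \<circ> (aff_refl c \<circ> aff_refl b \<circ> aff_refl c) \<circ> word_map u"
      by (simp add: aff_refl_comp_self[OF c(3)] flip: comp_assoc)
    also have "\<dots> = aff_refl c \<circ> (aff_refl ?b \<circ> word_map u)"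
      by (simp add: aff_refl_root_refl[OF c(3)] comp_assoc)
    also have "\<dots> = word_map ((c # xs) @ ys)" by (simp add: e)
    finally show ?thesis using u by (metis append_Cons)
  qed
qed simp

section \<open>Length, descents and minimal coset representatives\<close>

definition len :: "('a \<Rightarrow> 'a) \<Rightarrow> nat" where
  "len w = (LEAST n. \<exists>u. set u \<subseteq> I \<and> word_map u = w \<and> length u = n)"

lemma reduced_word:
  assumes "set u \<subseteq> I"
  obtains q where "set q \<subseteq> I" "word_map q = word_map u" "length q = len (word_map u)"
  using LeastI[of "\<lambda>n. \<exists>q. set q \<subseteq> I \<and> word_map q = word_map u \<and> length q = n" "length u"] assms
  unfolding len_def by blast

lemma len_le: "set u \<subseteq> I \<Longrightarrow> len (word_map u) \<le> length u"
  unfolding len_def by (rule Least_le) blast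

text \<open>Exchange is applied to a shortest word for the same element; the sign condition carries
  over because \<open>word_pull\<close> depends on the element only.\<close>

lemma len_descent:
  assumes u: "set u \<subseteq> I" and a: "a \<in> I" and "\<not> pos (word_pull u a)"
  shows "len (aff_refl a \<circ> word_map u) < len (word_map u)"
proof -
  obtain q where q: "set q \<subseteq> I" "word_map q = word_map u" "length q = len (word_map u)"
    using reduced_word[OF u] .
  have "\<not> pos (word_pull q a)" using assms word_pull_cong[OF q(2)] by simp
  then obtain xs c ys where x: "q = xs @ c # ys" "aff_refl a \<circ> word_map q = word_map (xs @ ys)"
    using exchange[OF q(1) I_root[OF a] pos_simple[OF a]] by blast
  have "len (word_map (xs @ ys)) \<le> length (xs @ ys)" using q(1) x(1) by (intro len_le) auto
  then show ?thesis using x q by simp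
qed

lemma len_ascent:
  assumes u: "set u \<subseteq> I" and a: "a \<in> I" and p: "pos (word_pull u a)"
  shows "len (word_map u) < len (aff_refl a \<circ> word_map u)"
proof -
  have fa: "fst a \<noteq> 0" by (rule I_fst_neq_0[OF a])
  have "word_pull u a \<in> \<Sigma>" using u a I_roots by (intro word_pull_root) auto
  \<comment> \<open>Prefixing a changes the sign of the pulled back root, so the ascent of u is a
    descent of a # u.\<close>
  then have "\<not> pos (word_pull (a # u) a)"
    using p by (simp add: root_refl_self[OF fa] linear_neg[OF linear_word_pull] pos_uminus_iff)
  then have "len (aff_refl a \<circ> word_map (a # u)) < len (word_map (a # u))"
    using u a by (intro len_descent) auto
  moreover have "aff_refl a \<circ> word_map (a # u) = word_map u"
    by (simp add: aff_refl_comp_self[OF fa] flip: comp_assoc)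
  ultimately show ?thesis by simp
qed

text \<open>Uniqueness of the minimal element in a coset of the group generated by J. For the first
  letter c of y, the root r obtained by pulling c back through y cannot be negative: -r would be a
  nonnegative combination of J, its pull-back through q would be positive, and this contradicts the
  minimality of y @ q. So r is positive and y can be shortened.\<close>

lemma coset_minimal_unique:
  assumes J: "J \<subseteq> I" and q: "set q \<subseteq> I" "\<And>c. c \<in> J \<Longrightarrow> pos (word_pull q c)"
    and y: "set y \<subseteq> J" "\<And>c. c \<in> J \<Longrightarrow> pos (word_pull (y @ q) c)"
  shows "word_map (y @ q) = word_map q"
  using y
proof (induction y rule: length_induct)
  case (1 y)
  show ?case
  proof (cases y)
    case (Cons c z)
    have c: "c \<in> J" "c \<in> I" "set z \<subseteq> J" "set z \<subseteq> I" "set y \<subseteq> I"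
      using 1 Cons J by auto
    have fc: "fst c \<noteq> 0" by (rule I_fst_neq_0[OF c(2)])
    let ?r = "word_pull y c"
    have r: "?r \<in> \<Sigma>" using c I_roots by (intro word_pull_root) auto
    have "pos ?r"
    proof (rule ccontr)
      assume "\<not> pos ?r"
      then have neg: "pos (- ?r)" using r pos_uminus_iff by blast
      \<comment> \<open>Letters from J do not leave the span of J, so r has coordinates along J
        only; elsewhere the positivity of q says nothing.\<close>
      have "word_pull x b \<in> span J" if "b \<in> span J" "set x \<subseteq> J" for x b
        using that by (induction x arbitrary: b) (auto simp: root_refl_def span_base span_diff span_scale)
      then have "?r \<in> span J" using c 1 by (simp add: span_base)
      moreover have "co a x = 0" if "x \<in> span J" "a \<in> I" "a \<notin> J" for a x
        using that(1)
      proof (induction rule: span_induct_alt)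
        case (step c x y)
        then have "co a x = 0" using that J by (subst co_simple) auto
        then show ?case by (simp add: co_add co_scaleR step)
      qed (simp add: co_zero)
      ultimately have "co a ?r = 0" if "a \<in> I" "a \<notin> J" for a using that by blast
      then have "(\<Sum>a\<in>I. co a ?r *\<^sub>R a) = (\<Sum>a\<in>J. co a ?r *\<^sub>R a)"
        using J finite_I by (intro sum.mono_neutral_right) auto
      then have "?r = (\<Sum>a\<in>J. co a ?r *\<^sub>R a)" by (simp add: co_expand)
      then have "word_pull q ?r = word_pull q (\<Sum>a\<in>J. co a ?r *\<^sub>R a)" by simp
      also have "\<dots> = (\<Sum>a\<in>J. co a ?r *\<^sub>R word_pull q a)"
        by (simp add: linear_sum[OF linear_word_pull] linear_cmul[OF linear_word_pull])
      finally have "co d (- word_pull q ?r) = (\<Sum>a\<in>J. co a (- ?r) * co d (word_pull q a))" for d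
        by (simp add: co_sum co_scaleR co_uminus sum_negf)
      moreover have "0 \<le> (\<Sum>a\<in>J. co a (- ?r) * co d (word_pull q a))" if "d \<in> I" for d
        using neg q(2) J that by (intro sum_nonneg mult_nonneg_nonneg) (auto simp: pos_def)
      ultimately have "pos (- word_pull q ?r)" by (simp add: pos_def)
      moreover have "word_pull q ?r \<in> \<Sigma>" using q(1) I_roots by (intro word_pull_root[OF _ r]) auto
      moreover have "pos (word_pull q ?r)" using 1(3)[OF c(1)] by (simp add: word_pull_append)
      ultimately show False using not_pos_and_neg by blast
    qed
    moreover have "word_pull z c \<in> \<Sigma>" using c I_roots by (intro word_pull_root) auto
    \<comment> \<open>Removing the first letter c of y reverses the sign of r. Exchange then deletes
      a letter of z as well, so y loses two letters.\<close>
    ultimately have "\<not> pos (word_pull z c)"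
      by (simp add: Cons root_refl_self[OF fc] linear_neg[OF linear_word_pull] pos_uminus_iff)
    then obtain xs d ys where x: "z = xs @ d # ys" "aff_refl c \<circ> word_map z = word_map (xs @ ys)"
      using exchange[OF c(4) I_root[OF c(2)] pos_simple[OF c(2)]] by blast
    have e: "word_map ((xs @ ys) @ q) = word_map (y @ q)"
      using x(2) by (simp add: Cons word_map_append flip: comp_assoc)
    have "word_map ((xs @ ys) @ q) = word_map q"
    proof (rule 1(1)[rule_format])
      show "length (xs @ ys) < length y" by (simp add: Cons x)
      show "set (xs @ ys) \<subseteq> J" using c x by auto
      show "pos (word_pull ((xs @ ys) @ q) c)" if "c \<in> J" for c
        using 1(3)[OF that] word_pull_cong[OF e] by simp
    qed
    then show ?thesis using e by simp
  qed simp
qed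

text \<open>Walls of two roots in \<open>I0\<close> meet at the origin. The wall of (- \<phi>, 1)
  meets that of (\<alpha>, 0) unless \<phi> is proportional to \<alpha>; then \<phi> = \<alpha>, the
  two roots add up to the constant 1, and they cannot both become negative.\<close>

lemma descents_meet:
  assumes u: "set u \<subseteq> I" and a: "a \<in> I" "\<not> pos (word_pull u a)" and b: "b \<in> I" "\<not> pos (word_pull u b)"
    and "a \<noteq> b"
  shows "\<exists>v. aff_apply a v = 0 \<and> aff_apply b v = 0"
proof -
  have main: "\<exists>v. aff_apply (- \<phi>, 1) v = 0 \<and> aff_apply (\<alpha>, 0) v = 0"
    if \<alpha>: "\<alpha> \<in> I0" and neg: "\<not> pos (word_pull u (- \<phi>, 1))" "\<not> pos (word_pull u (\<alpha>, 0))" for \<alpha>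
  proof (cases "\<exists>v. blinfun_apply \<alpha> v = 0 \<and> blinfun_apply \<phi> v \<noteq> 0")
    case True
    then obtain v where v: "blinfun_apply \<alpha> v = 0" "blinfun_apply \<phi> v \<noteq> 0" by blast
    then show ?thesis
      by (intro exI[of _ "(1 / blinfun_apply \<phi> v) *\<^sub>R v"])
         (simp add: aff_apply_def blinfun.scaleR_right blinfun.minus_left)
  next
    case False
    have a0: "\<alpha> \<noteq> 0" using \<alpha> zero_notin_I0 by blast
    define c where "c = blinfun_apply \<phi> (coroot \<alpha>) / 2"
    have "\<phi> = c *\<^sub>R \<alpha>"
    proof (rule blinfun_eqI)
      fix v
      have "blinfun_apply \<alpha> (v - (blinfun_apply \<alpha> v / 2) *\<^sub>R coroot \<alpha>) = 0"
        by (simp add: blinfun.diff_right blinfun.scaleR_right coroot_self[OF a0])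
      then have "blinfun_apply \<phi> (v - (blinfun_apply \<alpha> v / 2) *\<^sub>R coroot \<alpha>) = 0" using False by blast
      then show "blinfun_apply \<phi> v = blinfun_apply (c *\<^sub>R \<alpha>) v"
        by (simp add: blinfun.diff_right blinfun.scaleR_right blinfun.scaleR_left c_def)
    qed
    moreover from this have "c = 1 \<or> c = -1"
      using reduced \<alpha> I0_R phi_R unfolding reduced_rs_def by blast
    moreover have "c \<ge> 0"
      using representation_phi_nonneg[OF \<alpha>] \<open>\<phi> = c *\<^sub>R \<alpha>\<close>
      by (simp add: linear_cmul[OF linear_representation] representation_I0[OF \<alpha>])
    ultimately have "\<phi> = \<alpha>" by auto
    \<comment> \<open>Constants are invariant under pull-back.\<close>
    then have "word_pull u (- \<phi>, 1) + word_pull u (\<alpha>, 0) = (0, 1)"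
      using linear_add[OF linear_word_pull, of u "(- \<phi>, 1)" "(\<alpha>, 0)"] by (simp add: word_pull_const)
    then have s: "snd (word_pull u (- \<phi>, 1)) + snd (word_pull u (\<alpha>, 0)) = 1"
      by (metis snd_add snd_conv)
    have i: "(- \<phi>, 1) \<in> I" "(\<alpha>, 0) \<in> I" using \<alpha> by (auto simp: affine_basis_def)
    \<comment> \<open>\<open>snd\<close> is the coordinate at the affine simple root, hence
      nonpositive on negative roots.\<close>
    have "snd (word_pull u b) \<le> 0" if "b \<in> I" "\<not> pos (word_pull u b)" for b
    proof -
      have "word_pull u b \<in> \<Sigma>" using u that I_roots by (intro word_pull_root) auto
      then have "pos (- word_pull u b)" using that pos_uminus_iff by blast
      then show ?thesis using i(1) by (auto simp: pos_def co_def)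
    qed
    from this[OF i(1) neg(1)] this[OF i(2) neg(2)] s show ?thesis by simp
  qed
  show ?thesis
  proof (cases "a = (- \<phi>, 1)")
    case True
    then show ?thesis using main a b \<open>a \<noteq> b\<close> by (auto simp: affine_basis_def)
  next
    case False
    then obtain \<alpha> where \<alpha>: "\<alpha> \<in> I0" "a = (\<alpha>, 0)" using a by (auto simp: affine_basis_def)
    show ?thesis
    proof (cases "b = (- \<phi>, 1)")
      case True
      then show ?thesis using main[OF \<alpha>(1)] a b \<alpha> by auto
    next
      case False
      then obtain \<beta> where "\<beta> \<in> I0" "b = (\<beta>, 0)" using b by (auto simp: affine_basis_def)
      then show ?thesis using \<alpha> by (intro exI[of _ 0]) (simp add: aff_apply_def)
    qed
  qed
qed

section \<open>Generation of the affine Weyl group by simple reflections\<close>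

lemma aff_refl_uminus:
  fixes b :: "'a affine_functional"
  shows "aff_refl (- b) = aff_refl b"
proof -
  have "coroot (- \<alpha>) = - coroot \<alpha>" for \<alpha> :: "'a \<Rightarrow>\<^sub>L real"
  proof (rule coroot_eqI)
    fix \<xi> :: "'a \<Rightarrow>\<^sub>L real"
    have n: "dual_inner x (- y) = - dual_inner x y" for x y :: "'a \<Rightarrow>\<^sub>L real"
      by (simp add: dual_inner_def blinfun.minus_left sum_negf)
    show "blinfun_apply \<xi> (- coroot \<alpha>) = 2 * dual_inner \<xi> (- \<alpha>) / dual_inner (- \<alpha>) (- \<alpha>)"
      by (simp add: n dual_inner_commute[of "- \<alpha>"] blinfun.minus_right coroot_apply)
  qed
  moreover have "aff_apply (- b) v = - aff_apply b v" for v
    by (simp add: aff_apply_def blinfun.minus_left)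
  ultimately show ?thesis by (simp add: fun_eq_iff aff_refl_def)
qed

text \<open>Induction on the height, i.e. the sum of the coordinates. Since the gradient of b has
  positive norm, some simple a has positive inner product with it; reflecting in a lowers the
  height, and s_b is conjugated by s_a.\<close>

lemma pos_reflection_word:
  assumes "b \<in> \<Sigma>" "pos b" "(\<Sum>a\<in>I. co a b) \<le> real n"
  shows "\<exists>u. set u \<subseteq> I \<and> word_map u = aff_refl b"
  using assms
proof (induction n arbitrary: b)
  case 0
  then have "(\<Sum>a\<in>I. co a b) = 0" by (intro antisym sum_nonneg) (auto simp: pos_def)
  then have "co a b = 0" if "a \<in> I" for a
    using 0 that by (subst (asm) sum_nonneg_eq_0_iff) (auto simp: pos_def finite_I)
  then have "b = 0" using co_expand[of b] by simp
  then show ?case using 0 root_fst_neq_0 by fastforce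
next
  case (Suc n)
  have "fst b = (\<Sum>a\<in>I. co a b *\<^sub>R fst a)"
    by (subst co_expand[of b, symmetric]) (simp add: fst_sum)
  then have "dual_inner (fst b) (fst b) = (\<Sum>a\<in>I. co a b * dual_inner (fst b) (fst a))"
    by (metis (no_types, lifting) dual_inner_scaleR_right dual_inner_sum_right sum.cong)
  moreover have "0 < dual_inner (fst b) (fst b)"
    by (intro dual_inner_pos root_fst_neq_0 Suc.prems)
  ultimately have pos_sum: "0 < (\<Sum>a\<in>I. co a b * dual_inner (fst b) (fst a))" by simp
  have "\<exists>a\<in>I. 0 < co a b * dual_inner (fst b) (fst a)"
  proof (rule ccontr)
    assume "\<not> ?thesis"
    then have "(\<Sum>a\<in>I. co a b * dual_inner (fst b) (fst a)) \<le> 0" by (intro sum_nonpos) (simp add: not_less)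
    with pos_sum show False by simp
  qed
  then obtain a where a: "a \<in> I" "0 < co a b * dual_inner (fst b) (fst a)" by blast
  then have "0 < dual_inner (fst b) (fst a)"
    using Suc.prems by (auto simp: pos_def zero_less_mult_iff)
  then have c: "0 < blinfun_apply (fst b) (coroot (fst a))"
    using dual_inner_pos[OF I_fst_neq_0[OF a(1)]] by (simp add: coroot_apply)
  show ?case
  proof (cases "b = a")
    case True
    then show ?thesis using a(1) by (intro exI[of _ "[a]"]) simp
  next
    case False
    let ?b = "root_refl a b"
    have b: "?b \<in> \<Sigma>" "pos ?b"
      using root_refl_root I_root pos_root_refl a Suc.prems False by auto
    have "(\<Sum>d\<in>I. co d a) = 1" using a finite_I by (simp add: co_simple)
    then have "(\<Sum>d\<in>I. co d ?b) = (\<Sum>d\<in>I. co d b) - blinfun_apply (fst b) (coroot (fst a))"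
      by (simp add: root_refl_def co_diff co_scaleR sum_subtractf flip: sum_distrib_left)
    then have "(\<Sum>d\<in>I. co d ?b) < real (Suc n)" using c Suc.prems by simp
    moreover have "(\<Sum>d\<in>I. co d ?b) \<in> \<int>" by (intro Ints_sum co_Ints b)
    \<comment> \<open>Heights of roots are integers, so a strict drop below n + 1 is enough.\<close>
    ultimately have "(\<Sum>d\<in>I. co d ?b) \<le> real n"
    proof (elim Ints_cases)
      fix z assume z: "(\<Sum>d\<in>I. co d ?b) = of_int z" and "(\<Sum>d\<in>I. co d ?b) < real (Suc n)"
      then have "z \<le> int n" by linarith
      then show ?thesis unfolding z by linarith
    qed
    then obtain u where u: "set u \<subseteq> I" "word_map u = aff_refl ?b"
      using Suc.IH[OF b] by blast
    have f: "fst a \<noteq> 0" by (rule I_fst_neq_0[OF a(1)])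
    have "aff_refl b = aff_refl (root_refl a ?b)" by (simp add: root_refl_root_refl[OF f])
    also have "\<dots> = word_map (a # u @ [a])"
      by (simp add: aff_refl_root_refl[OF f] word_map_append u comp_assoc)
    finally show ?thesis using a u by (intro exI[of _ "a # u @ [a]"]) auto
  qed
qed

text \<open>\<open>affine_weyl\<close> is generated by all affine reflections; opposite roots give
  the same reflection, so the positive roots suffice.\<close>

lemma affine_weyl_word:
  assumes "w \<in> affine_weyl R"
  shows "\<exists>u. set u \<subseteq> I \<and> word_map u = w"
  using assms
proof induction
  case id
  then show ?case by (intro exI[of _ "[]"]) simp
next
  case (refl a)
  have "\<exists>u. set u \<subseteq> I \<and> word_map u = aff_refl b" if "b \<in> \<Sigma>" "pos b" for b
    using pos_reflection_word[OF that] real_arch_simple by blast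
  then show ?case using pos_or_neg[OF refl] root_uminus[OF refl] refl aff_refl_uminus by metis
next
  case (comp w w')
  then obtain u u' where "set u \<subseteq> I" "word_map u = w" "set u' \<subseteq> I" "word_map u' = w'" by blast
  then show ?case by (intro exI[of _ "u @ u'"]) (auto simp: word_map_append)
qed

lemma word_map_affine_weyl: "set u \<subseteq> I \<Longrightarrow> word_map u \<in> affine_weyl R"
  by (induction u) (auto intro: affine_weyl.intros I_root)

end

section \<open>Words of integral-reflection operators\<close>

lemma lin_refl_lin_refl: "\<alpha> \<noteq> 0 \<Longrightarrow> lin_refl \<alpha> (lin_refl \<alpha> v) = v"
  by (simp add: lin_refl_def blinfun.diff_right blinfun.scaleR_right coroot_self)

lemma blinfun_lin_refl_self: "\<alpha> \<noteq> 0 \<Longrightarrow> blinfun_apply \<alpha> (lin_refl \<alpha> v) = - blinfun_apply \<alpha> v"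
  by (simp add: lin_refl_def blinfun.diff_right blinfun.scaleR_right coroot_self)

lemma aff_refl_add: "aff_refl a (x + y) = aff_refl a x + lin_refl (fst a) y"
  using aff_refl_diff_scaleR[of a x "-1" y] by simp

lemma int_refl_diff:
  assumes "f \<in> Cinf" "g \<in> Cinf"
  shows "int_refl k a (\<lambda>x. f x - g x) = (\<lambda>x. int_refl k a f x - int_refl k a g x)"
  using int_refl_add[OF assms(1) Cinf_cmult[OF assms(2), of "-1"], of k a]
  by (simp add: int_refl_cmult[OF assms(2), of k a "-1", simplified])

text \<open>Q_a Q_a - 1 commutes with every directional derivative, because the two correction terms
  have opposite signs, and it vanishes on the wall of a. Hence \<open>intertwiner_eq_0\<close>
  applies with trivial twist.\<close>

lemma int_refl_involution:
  assumes a: "fst a \<noteq> 0" and f: "f \<in> Cinf"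
  shows "int_refl k a (int_refl k a f) = f"
proof -
  define D where "D = (\<lambda>f x. int_refl k a (int_refl k a f) x - f x)"
  \<comment> \<open>A point of the wall, found on the co-root line by means of
    Da(\<open>coroot\<close>) = 2.\<close>
  let ?x0 = "- (snd a / 2) *\<^sub>R coroot (fst a)"
  have x0: "aff_apply a ?x0 = 0"
    by (simp add: aff_apply_def blinfun.scaleR_right blinfun.minus_right coroot_self[OF a])
  have "D f = (\<lambda>x. 0)"
  proof (rule intertwiner_eq_0[where D=D and f=f and w="\<lambda>v. v" and z="?x0"])
    have "locally_bounded_op (\<lambda>f. int_refl k a (int_refl k a f))"
      by (rule locally_bounded_op_comp[OF locally_bounded_op_int_refl locally_bounded_op_int_refl int_refl_Cinf])
    from locally_bounded_op_diff[OF this locally_bounded_op_id] show "locally_bounded_op D"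
      by (simp add: D_def)
    fix f g :: "'a \<Rightarrow> complex" and v assume f: "f \<in> Cinf"
    show "D f \<in> Cinf" unfolding D_def by (intro Cinf_diff int_refl_Cinf f)
    show "D f ?x0 = 0" by (simp only: D_def int_refl_wall[OF int_refl_Cinf[OF f] x0] int_refl_wall[OF f x0]) simp
    let ?v = "lin_refl (fst a) v" and ?c = "blinfun_apply (fst a) v"
    have "dir_deriv v (int_refl k a (int_refl k a f)) =
        (\<lambda>x. int_refl k a (dir_deriv ?v (int_refl k a f)) x + of_real (k a * ?c) * int_refl k a f x)"
      by (rule dir_deriv_int_refl[OF int_refl_Cinf[OF f]])
    \<comment> \<open>Here Da(s_a v) = - Da(v) produces the sign that cancels the first correction
      term.\<close>
    also have "dir_deriv ?v (int_refl k a f) =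
        (\<lambda>x. int_refl k a (dir_deriv v f) x + (- of_real (k a * ?c)) * f x)"
      using dir_deriv_int_refl[OF f, of ?v k a] a by (simp add: lin_refl_lin_refl blinfun_lin_refl_self)
    also have "int_refl k a \<dots> = (\<lambda>x. int_refl k a (int_refl k a (dir_deriv v f)) x + (- of_real (k a * ?c)) * int_refl k a f x)"
      by (subst int_refl_add) (simp_all only: int_refl_cmult int_refl_Cinf Cinf_dir_deriv Cinf_cmult f)
    finally have "dir_deriv v (int_refl k a (int_refl k a f)) = int_refl k a (int_refl k a (dir_deriv v f))"
      by simp
    then show "dir_deriv v (D f) = D (dir_deriv v f)"
      unfolding D_def by (subst dir_deriv_diff_fun) (simp_all add: int_refl_Cinf f)
    assume g: "g \<in> Cinf"
    show "D (\<lambda>x. f x - g x) = (\<lambda>x. D f x - D g x)"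
      unfolding D_def by (simp add: int_refl_diff int_refl_Cinf f g algebra_simps)
  qed (fact f)
  then show ?thesis by (simp add: D_def fun_eq_iff)
qed

primrec word_op ::
    "('a::euclidean_space affine_functional \<Rightarrow> real) \<Rightarrow> 'a affine_functional list \<Rightarrow>
      ('a \<Rightarrow> complex) \<Rightarrow> 'a \<Rightarrow> complex" where
  "word_op k [] f = f"
| "word_op k (a # u) f = int_refl k a (word_op k u f)"

lemma word_op_Cinf: "f \<in> Cinf \<Longrightarrow> word_op k u f \<in> Cinf"
  by (induction u) (auto simp: int_refl_Cinf)

lemma word_op_add: "f \<in> Cinf \<Longrightarrow> g \<in> Cinf \<Longrightarrow>
    word_op k u (\<lambda>x. f x + g x) = (\<lambda>x. word_op k u f x + word_op k u g x)"
  by (induction u) (auto simp: int_refl_add word_op_Cinf)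

lemma word_op_diff: "f \<in> Cinf \<Longrightarrow> g \<in> Cinf \<Longrightarrow>
    word_op k u (\<lambda>x. f x - g x) = (\<lambda>x. word_op k u f x - word_op k u g x)"
  by (induction u) (auto simp: int_refl_diff word_op_Cinf)

lemma word_op_cmult: "f \<in> Cinf \<Longrightarrow> word_op k u (\<lambda>x. c * f x) = (\<lambda>x. c * word_op k u f x)"
  by (induction u) (auto simp: int_refl_cmult word_op_Cinf)

lemma locally_bounded_word_op: "locally_bounded_op (word_op k u)"
proof (induction u)
  case Nil
  then show ?case using locally_bounded_op_id by simp
next
  case (Cons a u)
  from locally_bounded_op_comp[OF locally_bounded_op_int_refl Cons word_op_Cinf]
  show ?case by simp
qed

text \<open>Moving \<open>\<partial>\<^sub>v\<close> to the right through a word applies \<open>word_lin\<close>, the inverse of the linear part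
  of the word, to \<open>v\<close> and leaves correction terms in which one letter has been deleted; these
  are listed by \<open>word_del\<close> with their coefficients.\<close>

primrec word_lin :: "'a::euclidean_space affine_functional list \<Rightarrow> 'a \<Rightarrow> 'a" where
  "word_lin [] v = v"
| "word_lin (a # u) v = word_lin u (lin_refl (fst a) v)"

primrec word_del ::
    "('a::euclidean_space affine_functional \<Rightarrow> real) \<Rightarrow> 'a affine_functional list \<Rightarrow> 'a \<Rightarrow>
      (real \<times> 'a affine_functional list) list" where
  "word_del k [] v = []"
| "word_del k (a # u) v = (k a * blinfun_apply (fst a) v, u) #
     map (\<lambda>p. (fst p, a # snd p)) (word_del k u (lin_refl (fst a) v))"

lemma word_del_length: "p \<in> set (word_del k u v) \<Longrightarrow> length (snd p) < length u \<and> set (snd p) \<subseteq> set u"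
  by (induction u arbitrary: v p) fastforce+

text \<open>Identifies \<open>word_lin\<close> as the inverse linear part, so that it depends on the
  element and not on the word.\<close>

lemma word_map_add_word_lin:
  "\<forall>a\<in>set u. fst a \<noteq> 0 \<Longrightarrow> word_map u (x + word_lin u v) = word_map u x + v"
  by (induction u arbitrary: x v) (auto simp: aff_refl_add lin_refl_lin_refl)

lemma inj_word_map:
  assumes "\<forall>a\<in>set u. fst a \<noteq> 0"
  shows "inj (word_map u)"
proof -
  have "inj (aff_refl a)" if "fst a \<noteq> 0" for a :: "'a affine_functional"
    using aff_refl_aff_refl[OF that] by (metis injI)
  then show ?thesis using assms by (induction u) (auto intro: inj_compose)
qed

lemma word_lin_cong:
  assumes "\<forall>a\<in>set u. fst a \<noteq> 0" "\<forall>a\<in>set u'. fst a \<noteq> 0" "word_map u = word_map u'"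
  shows "word_lin u v = word_lin u' v"
proof -
  have "word_map u (0 + word_lin u v) = word_map u (0 + word_lin u' v)"
    using word_map_add_word_lin[OF assms(1)] word_map_add_word_lin[OF assms(2)] assms(3) by metis
  then show ?thesis using inj_word_map[OF assms(1)] by (simp add: inj_eq)
qed

lemma Cinf_sum_list: "(\<And>p. p \<in> set L \<Longrightarrow> F p \<in> Cinf) \<Longrightarrow> (\<lambda>x. \<Sum>p\<leftarrow>L. F p x) \<in> Cinf"
  by (induction L) (auto intro: Cinf_const Cinf_add)

lemma int_refl_sum_list:
  "(\<And>p. p \<in> set L \<Longrightarrow> F p \<in> Cinf) \<Longrightarrow>
    int_refl k a (\<lambda>x. \<Sum>p\<leftarrow>L. F p x) = (\<lambda>x. \<Sum>p\<leftarrow>L. int_refl k a (F p) x)"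
proof (induction L)
  case Nil
  then show ?case using int_refl_cmult[OF Cinf_const, of k a 0 0] by simp
next
  case (Cons p L)
  then show ?case by (simp add: int_refl_add Cinf_sum_list)
qed

text \<open>The operator counterpart of \<open>iS_gen_iW_word\<close>: both contain the same
  \<open>word_lin\<close> and the same list \<open>word_del\<close>, which is what lets
  cancellations in H be transferred.\<close>

lemma dir_deriv_word_op:
  "f \<in> Cinf \<Longrightarrow> dir_deriv v (word_op k u f) = (\<lambda>x. word_op k u (dir_deriv (word_lin u v) f) x +
     (\<Sum>p\<leftarrow>word_del k u v. of_real (fst p) * word_op k (snd p) f x))"
proof (induction u arbitrary: v)
  case (Cons a u)
  let ?v = "lin_refl (fst a) v"
  let ?S = "\<lambda>x. \<Sum>p\<leftarrow>word_del k u ?v. of_real (fst p) * word_op k (snd p) f x"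
  note C = word_op_Cinf[OF Cons.prems] Cinf_cmult[OF word_op_Cinf[OF Cons.prems]]
  have "dir_deriv v (word_op k (a # u) f) = (\<lambda>x. int_refl k a (dir_deriv ?v (word_op k u f)) x +
      of_real (k a * blinfun_apply (fst a) v) * word_op k u f x)"
    by (simp add: dir_deriv_int_refl C)
  also have "dir_deriv ?v (word_op k u f) = (\<lambda>x. word_op k u (dir_deriv (word_lin u ?v) f) x + ?S x)"
    by (rule Cons.IH[OF Cons.prems])
  also have "int_refl k a \<dots> = (\<lambda>x. int_refl k a (word_op k u (dir_deriv (word_lin u ?v) f)) x + int_refl k a ?S x)"
    by (intro int_refl_add word_op_Cinf Cinf_dir_deriv Cons.prems Cinf_sum_list C)
  also have "int_refl k a ?S = (\<lambda>x. \<Sum>p\<leftarrow>word_del k u ?v. of_real (fst p) * int_refl k a (word_op k (snd p) f) x)"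
    by (simp add: int_refl_sum_list C int_refl_cmult)
  finally show ?case by (simp add: fun_eq_iff o_def)
qed simp

text \<open>Collects terms with the same group element. The additive map s is kept general so that
  one grouping serves both H and the complex numbers.\<close>

lemma sum_list_fibres:
  fixes s :: "complex \<Rightarrow> 'b \<Rightarrow> 'c::ab_group_add"
  assumes "finite G" "m ` set L \<subseteq> G"
    and add: "\<And>c d y. s (c + d) y = s c y + s d y"
  shows "(\<Sum>p\<leftarrow>L. s (c p) (m p)) = (\<Sum>w\<in>G. s (\<Sum>p\<leftarrow>L. if m p = w then c p else 0) w)"
  using assms(2)
proof (induction L)
  case Nil
  have "s 0 y = 0" for y using add[of 0 0 y] by simp
  then show ?case by simp
next
  case (Cons p L)
  have 0: "s 0 y = 0" for y using add[of 0 0 y] by simp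
  have "(\<Sum>w\<in>G. s (if m p = w then c p else 0) w) = (\<Sum>w\<in>G. if m p = w then s (c p) w else 0)"
    by (intro sum.cong) (auto simp: 0)
  also have "\<dots> = s (c p) (m p)" using Cons.prems assms(1) by simp
  finally show ?case using Cons by (simp add: add sum.distrib)
qed

text \<open>Every element of \<open>sym_ideal\<close> has constant term 0, so the scalars embed into
  the quotient.\<close>

lemma sym_const_eq_0:
  assumes "sym_const c = (0 :: 'a::real_vector sym_alg)"
  shows "c = 0"
proof -
  have "free_const c \<in> (sym_ideal :: 'a free_calg set)"
    using assms by transfer (simp add: sym_rel_def)
  from sym_ideal_lookup_empty[OF this] show ?thesis by (simp add: free_const_def)
qed

section \<open>Transfer of relations from the Hecke algebra, and Gutkin's theorem\<close>

locale affine_hecke = affine_root_data R I0 \<phi> + Hk_algebra cscale R I0 \<phi> k iS iW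
  for R I0 :: "('a::euclidean_space \<Rightarrow>\<^sub>L real) set" and \<phi> :: "'a \<Rightarrow>\<^sub>L real"
    and cscale :: "complex \<Rightarrow> 'h::ring_1 \<Rightarrow> 'h" and k :: "'a affine_functional \<Rightarrow> real"
    and iS :: "'a sym_alg \<Rightarrow> 'h" and iW :: "('a \<Rightarrow> 'a) \<Rightarrow> 'h"
begin

lemma iS_sym_const: "iS (sym_const c) = cscale c 1"
  using iS_scale[of c 1] by (simp add: sym_scale_def iS_one)

lemma iS_zero: "iS 0 = 0"
  using iS_add[of 0 0] by simp

text \<open>The uniqueness part of \<open>tensor\<close> at h = 0, compared with the zero expansion;
  \<open>sym_const_eq_0\<close> brings the coefficients back to scalars.\<close>

lemma iW_independent:
  assumes G: "finite G" "G \<subseteq> affine_weyl R" and "(\<Sum>w\<in>G. cscale (g w) (iW w)) = 0" and w: "w \<in> G"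
  shows "g w = 0"
proof -
  define F :: "('a \<Rightarrow> 'a) \<Rightarrow>\<^sub>0 'a sym_alg" where "F = (\<Sum>w\<in>G. Poly_Mapping.single w (sym_const (g w)))"
  have l: "Poly_Mapping.lookup F w = (if w \<in> G then sym_const (g w) else 0)" for w
    using G(1) by (simp add: F_def lookup_sum lookup_single when_def)
  then have kG: "Poly_Mapping.keys F \<subseteq> G" by (auto simp: in_keys_iff split: if_splits)
  have "(\<Sum>w\<in>Poly_Mapping.keys F. iS (Poly_Mapping.lookup F w) * iW w) =
      (\<Sum>w\<in>G. iS (Poly_Mapping.lookup F w) * iW w)"
    using kG G(1) by (intro sum.mono_neutral_left) (auto simp: in_keys_iff iS_zero)
  also have "\<dots> = (\<Sum>w\<in>G. cscale (g w) (iW w))"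
    by (intro sum.cong) (auto simp: l iS_sym_const scale_mult_left)
  finally have F0: "0 = (\<Sum>w\<in>Poly_Mapping.keys F. iS (Poly_Mapping.lookup F w) * iW w)" using assms(3) by simp
  have "F = 0" using tensor[of 0] F0 kG G(2) by (metis (no_types, lifting) empty_subsetI keys_zero subset_trans sum.empty)
  then show ?thesis using l[of w] w by (intro sym_const_eq_0) auto
qed

text \<open>By independence the coefficient of each group element is zero, so the relation persists
  for any scalars \<tau> put in place of the group elements.\<close>

lemma word_combination_eq_0:
  assumes L: "\<And>p. p \<in> set L \<Longrightarrow> set (snd p) \<subseteq> I"
    and "(\<Sum>p\<leftarrow>L. cscale (of_real (fst p)) (iW (word_map (snd p)))) = 0"
  shows "(\<Sum>p\<leftarrow>L. of_real (fst p) * \<tau> (word_map (snd p))) = (0 :: complex)"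
proof -
  let ?m = "\<lambda>p :: real \<times> 'a affine_functional list. word_map (snd p)"
  define G where "G = ?m ` set L"
  define g where "g w = (\<Sum>p\<leftarrow>L. if ?m p = w then complex_of_real (fst p) else 0)" for w
  have G: "finite G" "?m ` set L \<subseteq> G" "G \<subseteq> affine_weyl R"
    using L word_map_affine_weyl by (auto simp: G_def)
  have "(\<Sum>w\<in>G. cscale (g w) (iW w)) = 0"
    using sum_list_fibres[OF G(1,2), of "\<lambda>c w. cscale c (iW w)" "\<lambda>p. complex_of_real (fst p)"] assms(2)
    by (simp add: g_def scale_left_distrib)
  then have "g w = 0" if "w \<in> G" for w using iW_independent G that by blast
  moreover have "(\<Sum>p\<leftarrow>L. of_real (fst p) * \<tau> (?m p)) = (\<Sum>w\<in>G. g w * \<tau> w)"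
    using sum_list_fibres[OF G(1,2), of "\<lambda>c w. c * \<tau> w" "\<lambda>p. complex_of_real (fst p)"]
    by (simp add: g_def distrib_right)
  ultimately show ?thesis by simp
qed

text \<open>The cross relation at s_a v, rearranged so that the vector moves to the right as in
  \<open>dir_deriv_int_refl\<close>.\<close>

lemma iS_gen_iW_simple:
  assumes "a \<in> I"
  shows "iS (sym_gen v) * iW (aff_refl a) = iW (aff_refl a) * iS (sym_gen (lin_refl (fst a) v)) +
    cscale (of_real (k a * blinfun_apply (fst a) v)) 1"
  using cross[OF assms, of "lin_refl (fst a) v"] I_fst_neq_0[OF assms]
  by (simp add: lin_refl_lin_refl blinfun_lin_refl_self scale_minus_left algebra_simps)

lemma mult_sum_list: "x * (\<Sum>p\<leftarrow>L. F p) = (\<Sum>p\<leftarrow>L. x * F p :: 'h)"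
  by (induction L) (auto simp: distrib_left)

lemma iS_gen_iW_word:
  "set u \<subseteq> I \<Longrightarrow> iS (sym_gen v) * iW (word_map u) = iW (word_map u) * iS (sym_gen (word_lin u v)) +
     (\<Sum>p\<leftarrow>word_del k u v. cscale (of_real (fst p)) (iW (word_map (snd p))))"
proof (induction u arbitrary: v)
  case Nil
  then show ?case by (simp add: iW_id[unfolded id_def] id_def)
next
  case (Cons a u)
  let ?v = "lin_refl (fst a) v"
  have a: "a \<in> I" and u: "set u \<subseteq> I" using Cons.prems by auto
  have sa: "aff_refl a \<in> affine_weyl R" using a by (intro affine_weyl.refl I_root)
  have W: "iW (word_map (a # y)) = iW (aff_refl a) * iW (word_map y)" if "set y \<subseteq> I" for y
    using iW_comp[OF sa word_map_affine_weyl[OF that]] by simp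
  have "iS (sym_gen v) * iW (word_map (a # u)) =
      iW (aff_refl a) * (iS (sym_gen ?v) * iW (word_map u)) + cscale (of_real (k a * blinfun_apply (fst a) v)) (iW (word_map u))"
    unfolding W[OF u] mult.assoc[symmetric] iS_gen_iW_simple[OF a] by (simp add: distrib_right scale_mult_left mult.assoc)
  also have "\<dots> = iW (word_map (a # u)) * iS (sym_gen (word_lin u ?v)) +
      (\<Sum>p\<leftarrow>word_del k u ?v. cscale (of_real (fst p)) (iW (aff_refl a) * iW (word_map (snd p)))) +
      cscale (of_real (k a * blinfun_apply (fst a) v)) (iW (word_map u))"
    unfolding Cons.IH[OF u] W[OF u] by (simp add: distrib_left mult_sum_list scale_mult_right mult.assoc)
  also have "(\<Sum>p\<leftarrow>word_del k u ?v. cscale (of_real (fst p)) (iW (aff_refl a) * iW (word_map (snd p)))) =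
      (\<Sum>p\<leftarrow>word_del k u ?v. cscale (of_real (fst p)) (iW (word_map (a # snd p))))"
  proof (intro arg_cong[where f=sum_list] map_cong refl)
    fix p assume "p \<in> set (word_del k u ?v)"
    then have "set (snd p) \<subseteq> I" using word_del_length u by blast
    then show "cscale (of_real (fst p)) (iW (aff_refl a) * iW (word_map (snd p))) =
        cscale (of_real (fst p)) (iW (word_map (a # snd p)))" by (simp only: W)
  qed simp
  finally show ?case by (simp add: o_def add_ac)
qed

text \<open>The bound concerns the lengths of the words, which need not be reduced: correction terms
  arise by deleting letters and are in general not reduced.\<close>

definition words_agree :: "nat \<Rightarrow> bool" where
  "words_agree n \<longleftrightarrow> (\<forall>u u'. set u \<subseteq> I \<longrightarrow> set u' \<subseteq> I \<longrightarrow> length u \<le> n \<longrightarrow> length u' \<le> n \<longrightarrow>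
     word_map u = word_map u' \<longrightarrow> (\<forall>f\<in>Cinf. word_op k u f = word_op k u' f))"

lemma words_agreeD:
  "words_agree n \<Longrightarrow> word_map u = word_map u' \<Longrightarrow> f \<in> Cinf \<Longrightarrow> set u \<subseteq> I \<Longrightarrow> set u' \<subseteq> I \<Longrightarrow>
    length u \<le> n \<Longrightarrow> length u' \<le> n \<Longrightarrow> word_op k u f = word_op k u' f"
  unfolding words_agree_def by blast

lemma I_word_fst_neq_0: "set u \<subseteq> I \<Longrightarrow> \<forall>a\<in>set u. fst a \<noteq> 0"
  using I_fst_neq_0 by blast

text \<open>The correction terms of \<open>u\<close> and \<open>u'\<close> cancel in \<open>H\<close>, where \<open>iW\<close> is linearly independent.
  They involve shorter words only, so they also cancel as operators, and the difference of
  the two operators intertwines derivatives.\<close>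

lemma word_op_eqI:
  assumes agree: "words_agree n" and u: "set u \<subseteq> I" "length u \<le> Suc n" and u': "set u' \<subseteq> I" "length u' \<le> Suc n"
    and eq: "word_map u = word_map u'"
    and point: "\<And>f. f \<in> Cinf \<Longrightarrow> word_op k u f x0 = word_op k u' f x0"
    and f: "f \<in> Cinf"
  shows "word_op k u f = word_op k u' f"
proof -
  define D where "D f x = word_op k u f x - word_op k u' f x" for f x
  have lin: "word_lin u' v = word_lin u v" for v
    by (intro word_lin_cong I_word_fst_neq_0 u u' eq[symmetric])
  have "D f = (\<lambda>x. 0)"
  proof (rule intertwiner_eq_0[where D=D and f=f and w="word_lin u" and z=x0])
    show "locally_bounded_op D"
      using locally_bounded_op_diff[OF locally_bounded_word_op locally_bounded_word_op] by (simp add: D_def[abs_def])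
    fix f g :: "'a \<Rightarrow> complex" and v assume f: "f \<in> Cinf"
    show "D f \<in> Cinf" unfolding D_def by (intro Cinf_diff word_op_Cinf f)
    show "D f x0 = 0" by (simp add: D_def point f)
    show "dir_deriv v (D f) = D (dir_deriv (word_lin u v) f)"
    proof
      fix x
      \<comment> \<open>The value at x of the operator attached to w through any word of length at
        most n; \<open>agree\<close> makes the choice irrelevant.\<close>
      define \<tau> where "\<tau> w = word_op k (SOME y. set y \<subseteq> I \<and> length y \<le> n \<and> word_map y = w) f x" for w
      have \<tau>: "word_op k y f x = \<tau> (word_map y)" if "set y \<subseteq> I" "length y \<le> n" for y
      proof -
        let ?y = "SOME z. set z \<subseteq> I \<and> length z \<le> n \<and> word_map z = word_map y"
        have "set ?y \<subseteq> I \<and> length ?y \<le> n \<and> word_map ?y = word_map y"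
          by (rule someI[of _ y]) (use that in simp)
        then show ?thesis unfolding \<tau>_def using words_agreeD[OF agree _ f, of y ?y] that by simp
      qed
      let ?L = "word_del k u v" and ?L' = "word_del k u' v"
      \<comment> \<open>The difference of the two correction sums, written as one list so that
        \<open>word_combination_eq_0\<close> applies.\<close>
      define L where "L = ?L @ map (\<lambda>p. (- fst p, snd p)) ?L'"
      have LI: "set (snd p) \<subseteq> I" "length (snd p) \<le> n" if "p \<in> set ?L \<union> set ?L'" for p
        using that u u' word_del_length[of p k u v] word_del_length[of p k u' v] by auto
      have sgn: "(\<Sum>p\<leftarrow>M. - cscale (of_real (fst p)) (iW (word_map (snd p)))) =
        - (\<Sum>p\<leftarrow>M. cscale (of_real (fst p)) (iW (word_map (snd p))))" for M :: "(real \<times> 'a affine_functional list) list"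
        by (induction M) auto
      have sgn': "(\<Sum>p\<leftarrow>M. - (of_real (fst p) * \<tau> (word_map (snd p)))) =
        - (\<Sum>p\<leftarrow>M. of_real (fst p) * \<tau> (word_map (snd p)))" for M :: "(real \<times> 'a affine_functional list) list"
        by (induction M) auto
      have "(\<Sum>p\<leftarrow>L. cscale (of_real (fst p)) (iW (word_map (snd p)))) = 0"
        using iS_gen_iW_word[OF u(1), of v] iS_gen_iW_word[OF u'(1), of v]
        by (simp add: L_def o_def eq lin sgn)
      moreover have "set (snd p) \<subseteq> I" if p: "p \<in> set L" for p
      proof -
        have "snd ` set L = snd ` (set ?L \<union> set ?L')" by (simp add: L_def image_Un image_image)
        then have "snd p \<in> snd ` (set ?L \<union> set ?L')" using p by blast
        then show ?thesis using LI(1) by (elim imageE) simp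
      qed
      ultimately have "(\<Sum>p\<leftarrow>L. of_real (fst p) * \<tau> (word_map (snd p))) = 0"
        by (intro word_combination_eq_0)
      then have "(\<Sum>p\<leftarrow>?L. of_real (fst p) * \<tau> (word_map (snd p))) = (\<Sum>p\<leftarrow>?L'. of_real (fst p) * \<tau> (word_map (snd p)))"
        by (simp add: L_def o_def sgn')
      moreover have "(\<Sum>p\<leftarrow>M. of_real (fst p) * word_op k (snd p) f x) = (\<Sum>p\<leftarrow>M. of_real (fst p) * \<tau> (word_map (snd p)))"
        if "set M \<subseteq> set ?L \<union> set ?L'" for M
      proof (intro arg_cong[where f=sum_list] map_cong refl)
        fix p assume "p \<in> set M"
        then have "p \<in> set ?L \<union> set ?L'" using that by blast
        then show "of_real (fst p) * word_op k (snd p) f x = of_real (fst p) * \<tau> (word_map (snd p))"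
          using \<tau>[OF LI] by simp
      qed simp
      ultimately have "(\<Sum>p\<leftarrow>?L. of_real (fst p) * word_op k (snd p) f x) =
          (\<Sum>p\<leftarrow>?L'. of_real (fst p) * word_op k (snd p) f x)" by simp
      moreover have "dir_deriv v (D f) = (\<lambda>x. dir_deriv v (word_op k u f) x - dir_deriv v (word_op k u' f) x)"
        unfolding D_def by (rule dir_deriv_diff_fun[OF word_op_Cinf[OF f] word_op_Cinf[OF f]])
      ultimately show "dir_deriv v (D f) x = D (dir_deriv (word_lin u v) f) x"
        by (simp add: dir_deriv_word_op[OF f] D_def lin)
    qed
    assume g: "g \<in> Cinf"
    show "D (\<lambda>x. f x - g x) = (\<lambda>x. D f x - D g x)"
      unfolding D_def by (simp add: word_op_diff f g algebra_simps)
  qed (fact f)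
  then show ?thesis by (simp add: D_def fun_eq_iff)
qed

text \<open>Let u = a # t. If a lengthens the element of u, then t and a # r represent the same
  element within the bound, and Q_a Q_a = 1 removes a. Otherwise t may be replaced by a reduced q,
  and a # q and r are both within the bound.\<close>

lemma word_op_eq_reduced:
  assumes agree: "words_agree n" and u: "set u \<subseteq> I" "length u \<le> Suc n"
    and r: "set r \<subseteq> I" "word_map r = word_map u" "length r = len (word_map u)" "length r \<le> n"
    and f: "f \<in> Cinf"
  shows "word_op k u f = word_op k r f"
proof (cases u)
  case Nil
  then show ?thesis using assms words_agreeD[OF agree, of u r f] by auto
next
  case (Cons a t)
  have a: "a \<in> I" "fst a \<noteq> 0" and t: "set t \<subseteq> I" "length t \<le> n"
    using u Cons I_fst_neq_0 by auto
  have wt: "word_map t = aff_refl a \<circ> word_map u"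
    by (simp add: Cons aff_refl_comp_self[OF a(2)] flip: comp_assoc)
  show ?thesis
  proof (cases "pos (word_pull u a)")
    case True
    have "len (word_map u) < len (word_map t)"
      using len_ascent[OF u(1) a(1) True] by (simp only: wt)
    then have "length (a # r) \<le> n" using len_le[OF t(1)] t(2) r(3) by simp
    then have "word_op k t f = word_op k (a # r) f"
      using t a r f by (intro words_agreeD[OF agree]) (simp_all add: wt)
    then show ?thesis by (simp add: Cons int_refl_involution a word_op_Cinf f)
  next
    case False
    have "len (word_map t) < len (word_map u)"
      using len_descent[OF u(1) a(1) False] by (simp only: wt)
    moreover obtain q where q: "set q \<subseteq> I" "word_map q = word_map t" "length q = len (word_map t)"
      using reduced_word[OF t(1)] .
    ultimately have l: "length (a # q) \<le> n" "length q \<le> n" using r by auto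
    have "word_op k t f = word_op k q f"
      using t q l f by (intro words_agreeD[OF agree]) simp_all
    moreover have "word_op k (a # q) f = word_op k r f"
      using a q r l f Cons by (intro words_agreeD[OF agree]) simp_all
    ultimately show ?thesis by (simp add: Cons)
  qed
qed

text \<open>Letters from J act trivially on values at x0, so stripping them from the left leads to
  the minimal coset representative without changing the value there.\<close>

lemma word_op_descend:
  assumes agree: "words_agree n" and J: "J \<subseteq> I" "\<And>c. c \<in> J \<Longrightarrow> aff_apply c x0 = 0"
    and "set t \<subseteq> I" "length t \<le> n"
  shows "\<exists>y q. set y \<subseteq> J \<and> set q \<subseteq> I \<and> length q \<le> n \<and> word_map t = word_map (y @ q) \<and>
    (\<forall>c\<in>J. pos (word_pull q c)) \<and> (\<forall>f\<in>Cinf. word_op k t f x0 = word_op k q f x0)"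
  using assms(4,5)
proof (induction "len (word_map t)" arbitrary: t rule: less_induct)
  case less
  show ?case
  proof (cases "\<forall>c\<in>J. pos (word_pull t c)")
    case True
    then show ?thesis using less.prems by (intro exI[of _ "[]"] exI[of _ t]) simp
  next
    case False
    then obtain c where c: "c \<in> J" "\<not> pos (word_pull t c)" by blast
    have "c \<in> I" using c J by auto
    then have cI: "c \<in> I" "fst c \<noteq> 0" by (simp_all add: I_fst_neq_0)
    let ?w = "aff_refl c \<circ> word_map t"
    have lt: "len ?w < len (word_map t)" by (rule len_descent[OF less.prems(1) cI(1) c(2)])
    have ct: "set (c # t) \<subseteq> I" using cI less.prems by simp
    obtain q where q: "set q \<subseteq> I" "word_map q = ?w" "length q = len ?w"
      using reduced_word[OF ct] by auto
    have lq: "length (c # q) \<le> n" using lt q len_le[OF less.prems(1)] less.prems(2) by simp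
    have e: "word_map (c # q) = word_map t"
      by (simp add: q aff_refl_comp_self[OF cI(2)] flip: comp_assoc)
    obtain y r where r: "set y \<subseteq> J" "set r \<subseteq> I" "length r \<le> n" "word_map q = word_map (y @ r)"
      "\<forall>c\<in>J. pos (word_pull r c)" "\<forall>f\<in>Cinf. word_op k q f x0 = word_op k r f x0"
      using less.hyps[of q] lt q lq by auto
    have "word_op k t f x0 = word_op k r f x0" if f: "f \<in> Cinf" for f
    proof -
      \<comment> \<open>Stripping c shortens the element, so c # q still has length at most n and
        \<open>agree\<close> applies.\<close>
      have "word_op k t f = word_op k (c # q) f"
        using less.prems q lq cI f e by (intro words_agreeD[OF agree]) simp_all
      then show ?thesis using r f by (simp add: int_refl_wall word_op_Cinf J(2) c(1))
    qed
    moreover have "word_map t = word_map ((c # y) @ r)" using e r(4) by simp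
    ultimately show ?thesis using r c by (intro exI[of _ "c # y"] exI[of _ r]) simp
  qed
qed

text \<open>If two words of length \<open>n + 1\<close> are reduced and start with different letters \<open>a\<close>, \<open>b\<close>, then
  at a common zero of \<open>a\<close> and \<open>b\<close> both operators reduce to that of the shortest element of the
  coset modulo the group generated by \<open>s\<^sub>a\<close> and \<open>s\<^sub>b\<close>. This replaces the braid relations.\<close>

lemma words_agree_Suc:
  assumes agree: "words_agree n"
  shows "words_agree (Suc n)"
  unfolding words_agree_def
proof (intro allI impI ballI)
  fix u u' f
  assume u: "set u \<subseteq> I" "length u \<le> Suc n" and u': "set u' \<subseteq> I" "length u' \<le> Suc n"
    and eq: "word_map u = word_map u'" and f: "f \<in> (Cinf :: ('a \<Rightarrow> complex) set)"
  show "word_op k u f = word_op k u' f"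
  \<comment> \<open>If the element has a word of length at most n, both operators equal the one of a
    reduced word.\<close>
  proof (cases "len (word_map u) \<le> n")
    case True
    obtain r where r: "set r \<subseteq> I" "word_map r = word_map u" "length r = len (word_map u)"
      using reduced_word[OF u(1)] .
    then show ?thesis
      using True word_op_eq_reduced[OF agree u r(1) _ _ _ f] word_op_eq_reduced[OF agree u' r(1) _ _ _ f] eq by simp
  next
    case False
    then have len: "len (word_map u) = Suc n" and "length u = Suc n" "length u' = Suc n"
      using len_le[OF u(1)] len_le[OF u'(1)] u u' eq by auto
    then obtain a t b t' where ut: "u = a # t" "u' = b # t'" and l: "length t = n" "length t' = n"
      by (metis length_Suc_conv)
    have a: "a \<in> I" "fst a \<noteq> 0" and t: "set t \<subseteq> I" and b: "b \<in> I" "fst b \<noteq> 0" and t': "set t' \<subseteq> I"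
      using u u' ut I_fst_neq_0 by auto
    have wt: "word_map t = aff_refl a \<circ> word_map u"
      by (simp add: ut aff_refl_comp_self[OF a(2)] flip: comp_assoc)
    have wt': "word_map t' = aff_refl b \<circ> word_map u"
      by (simp add: eq, simp add: ut aff_refl_comp_self[OF b(2)] flip: comp_assoc)
    show ?thesis
    proof (cases "a = b")
      case True
      then have "word_op k t f = word_op k t' f"
        using t t' l f by (intro words_agreeD[OF agree]) (simp_all add: wt wt')
      then show ?thesis by (simp add: ut True)
    next
      case False
      \<comment> \<open>The element has length n + 1 while t has only n letters, so removing a
        shortens it; the same holds for b.\<close>
      have "\<not> pos (word_pull u a)"
        using len_ascent[OF u(1) a(1)] len_le[OF t] len l(1) wt by force
      moreover have "\<not> pos (word_pull u b)"
        using len_ascent[OF u(1) b(1)] len_le[OF t'] len l(2) wt' by force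
      ultimately obtain x0 where x0: "aff_apply a x0 = 0" "aff_apply b x0 = 0"
        using descents_meet[OF u(1) a(1) _ b(1) _ False] by blast
      let ?J = "{a, b}"
      have J: "?J \<subseteq> I" "\<And>c. c \<in> ?J \<Longrightarrow> aff_apply c x0 = 0" using a b x0 by auto
      obtain y q where q: "set y \<subseteq> ?J" "set q \<subseteq> I" "length q \<le> n" "word_map t = word_map (y @ q)"
        "\<forall>c\<in>?J. pos (word_pull q c)" "\<forall>f\<in>Cinf. word_op k t f x0 = word_op k q f x0"
        using word_op_descend[OF agree J t] l(1) by auto
      obtain y' q' where q': "set y' \<subseteq> ?J" "set q' \<subseteq> I" "length q' \<le> n" "word_map t' = word_map (y' @ q')"
        "\<forall>c\<in>?J. pos (word_pull q' c)" "\<forall>f\<in>Cinf. word_op k t' f x0 = word_op k q' f x0"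
        using word_op_descend[OF agree J t'] l(2) by auto
      \<comment> \<open>The word for y' inverse times s_b s_a y: it has letters in {a, b} and
        carries q to q', so uniqueness of the minimal representative identifies the two.\<close>
      let ?z = "rev y' @ [b, a] @ y"
      have rev: "word_map (rev y) \<circ> word_map y = id" if "set y \<subseteq> I" for y
        using that
      proof (induction y)
        case (Cons c y)
        have "word_map (rev (c # y)) \<circ> word_map (c # y) = word_map (rev y) \<circ> (aff_refl c \<circ> aff_refl c) \<circ> word_map y"
          by (simp add: word_map_append comp_assoc)
        also have "aff_refl c \<circ> aff_refl c = id" using Cons.prems by (intro aff_refl_comp_self I_fst_neq_0) simp
        also have "word_map (rev y) \<circ> id \<circ> word_map y = word_map (rev y) \<circ> word_map y" by simp
        also have "\<dots> = id" by (rule Cons.IH) (use Cons.prems in simp)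
        finally show ?case .
      qed simp
      have rev': "word_map (rev y') \<circ> word_map y' = id" by (rule rev) (use q'(1) J(1) in blast)
      have "word_map (?z @ q) = word_map (rev y') \<circ> (aff_refl b \<circ> (aff_refl a \<circ> word_map t))"
        by (simp add: word_map_append q(4) comp_assoc)
      also have "aff_refl a \<circ> word_map t = word_map u" by (simp add: ut)
      also have "aff_refl b \<circ> word_map u = word_map t'" by (simp add: wt')
      also have "word_map (rev y') \<circ> word_map t' = word_map q'"
        using rev'  by (simp add: q'(4) word_map_append flip: comp_assoc)
      finally have e: "word_map (?z @ q) = word_map q'" .
      have "word_map (?z @ q) = word_map q"
      proof (rule coset_minimal_unique[OF J(1) q(2)])
        show "set ?z \<subseteq> ?J" using q(1) q'(1) by auto
        show "pos (word_pull q c)" if "c \<in> ?J" for c using q(5) that by blast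
        show "pos (word_pull (?z @ q) c)" if "c \<in> ?J" for c
          unfolding word_pull_cong[OF e] using q'(5) that by blast
      qed
      then have qq: "word_map q = word_map q'" using e by simp
      show ?thesis
      proof (rule word_op_eqI[OF agree u u' eq _ f])
        fix f :: "'a \<Rightarrow> complex" assume f: "f \<in> Cinf"
        have "word_op k q f = word_op k q' f"
          using q q' qq f by (intro words_agreeD[OF agree]) simp_all
        then show "word_op k u f x0 = word_op k u' f x0"
          using q(6) q'(6) f by (simp add: ut int_refl_wall word_op_Cinf x0)
      qed
    qed
  qed
qed

lemma words_agree: "words_agree n"
proof (induction n)
  case 0
  show ?case by (simp add: words_agree_def)
qed (rule words_agree_Suc)

text \<open>Gutkin's theorem on smooth functions, with the larger of the two lengths as
  bound.\<close>

theorem word_op_cong: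
  assumes "set u \<subseteq> I" "set u' \<subseteq> I" "word_map u = word_map u'" "f \<in> Cinf"
  shows "word_op k u f = word_op k u' f"
  by (rule words_agreeD[OF words_agree[of "max (length u) (length u')"] assms(3,4,1,2)]) simp_all

end

section \<open>The action of the symmetric algebra\<close>

lemma poly_mapping_add_induct [case_names single add]:
  fixes p :: "'b \<Rightarrow>\<^sub>0 'c::comm_monoid_add"
  assumes "\<And>m c. P (Poly_Mapping.single m c)" and "\<And>p q. P p \<Longrightarrow> P q \<Longrightarrow> P (p + q)"
  shows "P p"
proof -
  have P0: "P 0" using assms(1)[of _ 0] by simp
  have "p = (\<Sum>m\<in>Poly_Mapping.keys p. Poly_Mapping.single m (Poly_Mapping.lookup p m))"
    by (rule poly_mapping_eqI) (simp add: lookup_sum lookup_single when_def in_keys_iff)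
  moreover have "P (\<Sum>m\<in>K. Poly_Mapping.single m (Poly_Mapping.lookup p m))" if "finite K" for K
    using that by induction (auto intro: assms P0)
  ultimately show ?thesis by (metis finite_keys)
qed

text \<open>Derivatives are extended by zero outside \<open>Cinf\<close> so that they commute everywhere, as
  \<open>fold_mset\<close> requires.\<close>

definition total_deriv :: "'a::euclidean_space \<Rightarrow> ('a \<Rightarrow> complex) \<Rightarrow> 'a \<Rightarrow> complex" where
  "total_deriv v f = (if f \<in> Cinf then dir_deriv v f else (\<lambda>x. 0))"

lemma comp_fun_commute_total_deriv: "comp_fun_commute total_deriv"
  by unfold_locales
     (auto simp: fun_eq_iff total_deriv_def Cinf_dir_deriv dir_deriv_commute dir_deriv_const Cinf_const)

definition mset_deriv :: "'a::euclidean_space multiset \<Rightarrow> ('a \<Rightarrow> complex) \<Rightarrow> 'a \<Rightarrow> complex" where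
  "mset_deriv M f = fold_mset total_deriv f M"

lemma mset_deriv_empty: "mset_deriv {#} f = f"
  by (simp add: mset_deriv_def)

lemma mset_deriv_add_mset: "mset_deriv (add_mset v M) f = total_deriv v (mset_deriv M f)"
  unfolding mset_deriv_def by (rule comp_fun_commute.fold_mset_add_mset[OF comp_fun_commute_total_deriv])

lemma mset_deriv_union: "mset_deriv (M + N) f = mset_deriv M (mset_deriv N f)"
  by (induction M) (simp_all add: mset_deriv_empty mset_deriv_add_mset)

lemma mset_deriv_Cinf: "f \<in> Cinf \<Longrightarrow> mset_deriv M f \<in> Cinf"
  by (induction M) (simp_all add: mset_deriv_empty mset_deriv_add_mset total_deriv_def Cinf_dir_deriv)

lemma mset_deriv_add:
  "f \<in> Cinf \<Longrightarrow> g \<in> Cinf \<Longrightarrow> mset_deriv M (\<lambda>x. f x + g x) = (\<lambda>x. mset_deriv M f x + mset_deriv M g x)"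
  by (induction M)
     (simp_all add: mset_deriv_empty mset_deriv_add_mset total_deriv_def mset_deriv_Cinf Cinf_add dir_deriv_add_fun)

lemma mset_deriv_cmult:
  "f \<in> Cinf \<Longrightarrow> mset_deriv M (\<lambda>x. c * f x) = (\<lambda>x. c * mset_deriv M f x)"
  by (induction M)
     (simp_all add: mset_deriv_empty mset_deriv_add_mset total_deriv_def mset_deriv_Cinf Cinf_cmult dir_deriv_cmult)

definition free_deriv :: "'a::euclidean_space free_calg \<Rightarrow> ('a \<Rightarrow> complex) \<Rightarrow> 'a \<Rightarrow> complex" where
  "free_deriv p f x = (\<Sum>M\<in>Poly_Mapping.keys p. Poly_Mapping.lookup p M * mset_deriv M f x)"

lemma free_deriv_plus: "free_deriv (p + q) f = (\<lambda>x. free_deriv p f x + free_deriv q f x)"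
  unfolding free_deriv_def
  by (rule ext, rule setsum_keys_plus_distrib[where f="\<lambda>M c. c * mset_deriv M f _"]) (simp_all add: distrib_right)

lemma free_deriv_single: "free_deriv (Poly_Mapping.single M c) f = (\<lambda>x. c * mset_deriv M f x)"
  by (cases "c = 0") (simp_all add: free_deriv_def[abs_def])

lemma free_deriv_zero: "free_deriv 0 f = (\<lambda>x. 0)"
  by (simp add: free_deriv_def[abs_def])

lemma free_deriv_Cinf: "f \<in> Cinf \<Longrightarrow> free_deriv p f \<in> Cinf"
  unfolding free_deriv_def[abs_def] by (intro Cinf_sum Cinf_cmult mset_deriv_Cinf)

lemma free_deriv_add:
  "f \<in> Cinf \<Longrightarrow> g \<in> Cinf \<Longrightarrow> free_deriv p (\<lambda>x. f x + g x) = (\<lambda>x. free_deriv p f x + free_deriv p g x)"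
  by (simp add: free_deriv_def[abs_def] mset_deriv_add distrib_left sum.distrib)

lemma free_deriv_cmult: "f \<in> Cinf \<Longrightarrow> free_deriv p (\<lambda>x. c * f x) = (\<lambda>x. c * free_deriv p f x)"
  by (simp add: free_deriv_def[abs_def] mset_deriv_cmult sum_distrib_left mult_ac)

lemma free_deriv_times: "f \<in> Cinf \<Longrightarrow> free_deriv (p * q) f = free_deriv p (free_deriv q f)"
proof (induction p rule: poly_mapping_add_induct)
  case (single M c)
  show ?case
  proof (induction q rule: poly_mapping_add_induct)
    case (single N d)
    then show ?case
      by (simp add: mult_single free_deriv_single mset_deriv_union mset_deriv_cmult mset_deriv_Cinf
          \<open>f \<in> Cinf\<close> mult.assoc)
  next
    case (add q r)
    then show ?case
      by (simp add: distrib_left free_deriv_plus free_deriv_add free_deriv_Cinf \<open>f \<in> Cinf\<close>)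
  qed
qed (simp add: distrib_right free_deriv_plus)

lemma free_deriv_gen: "f \<in> Cinf \<Longrightarrow> free_deriv (free_gen v) f = dir_deriv v f"
  by (simp add: free_gen_def free_deriv_single mset_deriv_add_mset mset_deriv_empty total_deriv_def)

lemma free_deriv_const: "free_deriv (free_const c) f = (\<lambda>x. c * f x)"
  by (simp add: free_const_def free_deriv_single mset_deriv_empty)

lemma free_deriv_diff: "free_deriv (p - q) f = (\<lambda>x. free_deriv p f x - free_deriv q f x)"
  using free_deriv_plus[of "p - q" q f] by (simp add: fun_eq_iff)

text \<open>The generators of the ideal express real linearity in the vector, which directional
  derivatives of smooth functions satisfy; composing with further operators keeps the result
  zero.\<close>

lemma free_deriv_sym_ideal: "p \<in> sym_ideal \<Longrightarrow> f \<in> Cinf \<Longrightarrow> free_deriv p f = (\<lambda>x. 0)"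
proof (induction rule: sym_ideal.induct)
  case (mult p q)
  then show ?case
    using free_deriv_cmult[OF Cinf_const, of q 0 0] by (simp add: free_deriv_times)
qed (simp_all add: free_deriv_zero free_deriv_diff free_deriv_gen free_deriv_plus free_deriv_times
    free_deriv_const dir_deriv_add dir_deriv_scaleR scaleR_conv_of_real)

text \<open>Independence of the representative is known on \<open>Cinf\<close> only, so a common
  value is fixed elsewhere.\<close>

lift_definition sym_deriv :: "'a::euclidean_space sym_alg \<Rightarrow> ('a \<Rightarrow> complex) \<Rightarrow> 'a \<Rightarrow> complex"
  is "\<lambda>p f. if f \<in> Cinf then free_deriv p f else undefined"
proof -
  fix p q :: "'a free_calg"
  assume "sym_rel p q"
  then have "free_deriv p f = free_deriv q f" if "f \<in> Cinf" for f
    using free_deriv_sym_ideal[OF _ that, of "p - q"]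
    by (simp add: sym_rel_def free_deriv_diff fun_eq_iff)
  then show "(\<lambda>f. if f \<in> Cinf then free_deriv p f else undefined) =
      (\<lambda>f. if f \<in> Cinf then free_deriv q f else undefined)"
    by auto
qed

lemma sym_deriv_Cinf: "f \<in> Cinf \<Longrightarrow> sym_deriv p f \<in> Cinf"
  by transfer (simp add: free_deriv_Cinf)

lemma sym_deriv_plus: "f \<in> Cinf \<Longrightarrow> sym_deriv (p + q) f = (\<lambda>x. sym_deriv p f x + sym_deriv q f x)"
  by transfer (simp add: free_deriv_plus)

lemma sym_deriv_zero: "f \<in> Cinf \<Longrightarrow> sym_deriv 0 f = (\<lambda>x. 0)"
  by transfer (simp add: free_deriv_zero)

lemma sym_deriv_times: "f \<in> Cinf \<Longrightarrow> sym_deriv (p * q) f = sym_deriv p (sym_deriv q f)"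
  by transfer (simp add: free_deriv_times free_deriv_Cinf)

lemma sym_deriv_gen: "f \<in> Cinf \<Longrightarrow> sym_deriv (sym_gen v) f = dir_deriv v f"
  by transfer (simp add: free_deriv_gen)

lemma sym_deriv_const: "f \<in> Cinf \<Longrightarrow> sym_deriv (sym_const c) f = (\<lambda>x. c * f x)"
  by transfer (simp add: free_deriv_const)

lemma sym_deriv_add:
  "f \<in> Cinf \<Longrightarrow> g \<in> Cinf \<Longrightarrow> sym_deriv p (\<lambda>x. f x + g x) = (\<lambda>x. sym_deriv p f x + sym_deriv p g x)"
  by transfer (simp add: free_deriv_add Cinf_add)

lemma sym_deriv_cmult: "f \<in> Cinf \<Longrightarrow> sym_deriv p (\<lambda>x. c * f x) = (\<lambda>x. c * sym_deriv p f x)"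
  by transfer (simp add: free_deriv_cmult Cinf_cmult)

lemma sym_const_one: "sym_const 1 = 1"
  by transfer (simp add: free_const_def sym_rel_def sym_ideal.zero)

text \<open>Multiplying by one vector at a time is the form in which the cross relation can be
  used.\<close>

lemma sym_alg_induct [case_names const gen add]:
  fixes p :: "'a::real_vector sym_alg"
  assumes const: "\<And>c. P (sym_const c)" and gen: "\<And>v p. P p \<Longrightarrow> P (sym_gen v * p)"
    and add: "\<And>p q. P p \<Longrightarrow> P q \<Longrightarrow> P (p + q)"
  shows "P p"
proof (induct p rule: sym_alg.abs_induct)
  case (1 q)
  show ?case
  proof (induction q rule: poly_mapping_add_induct)
    case (single M c)
    show ?case
    proof (induction M)
      case empty
      then show ?case using const[of c] by (simp add: sym_const.abs_eq free_const_def)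
    next
      case (add v M)
      have "Poly_Mapping.single (add_mset v M) c = free_gen v * Poly_Mapping.single M c"
        by (simp add: free_gen_def mult_single)
      then show ?case using gen[OF add, of v] by (simp add: sym_gen.abs_eq times_sym_alg.abs_eq)
    qed
  next
    case (add q r)
    then show ?case using assms(3) by (simp flip: plus_sym_alg.abs_eq)
  qed
qed


section \<open>The representation of the Hecke algebra\<close>

context affine_hecke
begin

text \<open>The choice of a word is harmless on \<open>Cinf\<close> by
  \<open>word_op_cong\<close>.\<close>

definition weyl_op :: "('a \<Rightarrow> 'a) \<Rightarrow> ('a \<Rightarrow> complex) \<Rightarrow> 'a \<Rightarrow> complex" where
  "weyl_op w = word_op k (SOME u. set u \<subseteq> I \<and> word_map u = w)"

lemma weyl_op_word_map:
  assumes "set u \<subseteq> I" "f \<in> Cinf"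
  shows "weyl_op (word_map u) f = word_op k u f"
proof -
  let ?u = "SOME v. set v \<subseteq> I \<and> word_map v = word_map u"
  have "set ?u \<subseteq> I \<and> word_map ?u = word_map u"
    by (rule someI[of _ u]) (use assms in simp)
  then show ?thesis unfolding weyl_op_def using assms by (intro word_op_cong) auto
qed

lemma weyl_op_Cinf: "f \<in> Cinf \<Longrightarrow> weyl_op w f \<in> Cinf"
  by (simp add: weyl_op_def word_op_Cinf)

lemma weyl_op_id: "f \<in> Cinf \<Longrightarrow> weyl_op id f = f"
  using weyl_op_word_map[of "[]" f] by simp

lemma simple_affine_weyl: "a \<in> I \<Longrightarrow> aff_refl a \<in> affine_weyl R"
  by (simp add: affine_weyl.refl I_root)

lemma weyl_op_simple_comp:
  assumes "a \<in> I" "w \<in> affine_weyl R" "f \<in> Cinf"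
  shows "weyl_op (aff_refl a \<circ> w) f = int_refl k a (weyl_op w f)"
proof -
  obtain u where u: "set u \<subseteq> I" "word_map u = w" using affine_weyl_word assms by blast
  then show ?thesis using weyl_op_word_map[of "a # u" f] weyl_op_word_map[of u f] assms by simp
qed

section \<open>Coordinates in the tensor decomposition and the operators built from them\<close>

definition tensor_eval :: "(('a \<Rightarrow> 'a) \<Rightarrow>\<^sub>0 'a sym_alg) \<Rightarrow> 'h" where
  "tensor_eval F = (\<Sum>w\<in>Poly_Mapping.keys F. iS (Poly_Mapping.lookup F w) * iW w)"

definition tensor_coeffs :: "'h \<Rightarrow> ('a \<Rightarrow> 'a) \<Rightarrow>\<^sub>0 'a sym_alg" where
  "tensor_coeffs h = (THE F. Poly_Mapping.keys F \<subseteq> affine_weyl R \<and> h = tensor_eval F)"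

lemma tensor_coeffs: "Poly_Mapping.keys (tensor_coeffs h) \<subseteq> affine_weyl R" "tensor_eval (tensor_coeffs h) = h"
  using theI'[OF tensor[of h]] by (simp_all add: tensor_coeffs_def tensor_eval_def)

lemma tensor_coeffs_eval: "Poly_Mapping.keys F \<subseteq> affine_weyl R \<Longrightarrow> tensor_coeffs (tensor_eval F) = F"
  unfolding tensor_coeffs_def using tensor[of "tensor_eval F"]
  by (intro the1_equality) (simp_all add: tensor_eval_def)

lemma tensor_eval_add: "tensor_eval (F + G) = tensor_eval F + tensor_eval G"
  unfolding tensor_eval_def
  by (rule setsum_keys_plus_distrib[where f="\<lambda>w p. iS p * iW w"]) (simp_all add: iS_zero iS_add distrib_right)

lemma tensor_coeffs_add: "tensor_coeffs (h + h') = tensor_coeffs h + tensor_coeffs h'"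
proof -
  have "Poly_Mapping.keys (tensor_coeffs h + tensor_coeffs h') \<subseteq> affine_weyl R"
    using keys_add tensor_coeffs(1) by (metis Un_subset_iff subset_trans)
  from tensor_coeffs_eval[OF this] show ?thesis by (simp add: tensor_eval_add tensor_coeffs(2))
qed

lemma tensor_eval_single: "tensor_eval (Poly_Mapping.single w p) = iS p * iW w"
  by (cases "p = 0") (simp_all add: tensor_eval_def iS_zero)

lemma algebra_induct [case_names basic add]:
  assumes basic: "\<And>p w. w \<in> affine_weyl R \<Longrightarrow> P (iS p * iW w)" and add: "\<And>h h'. P h \<Longrightarrow> P h' \<Longrightarrow> P (h + h')"
  shows "P h"
proof -
  have P0: "P 0" using basic[OF affine_weyl.id, of 0] by (simp add: iS_zero)
  have "P (\<Sum>w\<in>K. iS (g w) * iW w)" if "finite K" "K \<subseteq> affine_weyl R" for K g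
    using that by induction (auto intro: assms P0)
  from this[OF finite_keys tensor_coeffs(1), of "Poly_Mapping.lookup (tensor_coeffs h)" h]
  show ?thesis using tensor_coeffs(2)[of h] by (simp add: tensor_eval_def)
qed

text \<open>The only possible formula: p \<otimes> w stands for \<open>iS p * iW w\<close>, so the
  group element acts first and the derivative afterwards.\<close>

definition tensor_op :: "(('a \<Rightarrow> 'a) \<Rightarrow>\<^sub>0 'a sym_alg) \<Rightarrow> ('a \<Rightarrow> complex) \<Rightarrow> 'a \<Rightarrow> complex" where
  "tensor_op F f x = (\<Sum>w\<in>Poly_Mapping.keys F. sym_deriv (Poly_Mapping.lookup F w) (weyl_op w f) x)"

definition hecke_op :: "'h \<Rightarrow> ('a \<Rightarrow> complex) \<Rightarrow> 'a \<Rightarrow> complex" where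
  "hecke_op h f = (if f \<in> Cinf then tensor_op (tensor_coeffs h) f else undefined)"

lemma hecke_op_Cinf: "f \<in> Cinf \<Longrightarrow> hecke_op h f \<in> Cinf"
  by (simp add: hecke_op_def tensor_op_def[abs_def] Cinf_sum sym_deriv_Cinf weyl_op_Cinf)

lemma hecke_op_plus: "f \<in> Cinf \<Longrightarrow> hecke_op (h + h') f = (\<lambda>x. hecke_op h f x + hecke_op h' f x)"
proof
  fix x assume f: "f \<in> Cinf"
  have "tensor_op (F + G) f x = tensor_op F f x + tensor_op G f x" for F G
    unfolding tensor_op_def
    by (rule setsum_keys_plus_distrib[where f="\<lambda>w p. sym_deriv p (weyl_op w f) x"])
       (simp_all add: sym_deriv_zero sym_deriv_plus weyl_op_Cinf f)
  then show "hecke_op (h + h') f x = hecke_op h f x + hecke_op h' f x"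
    by (simp add: hecke_op_def f tensor_coeffs_add)
qed

lemma hecke_op_basic:
  assumes "w \<in> affine_weyl R" and f: "f \<in> Cinf"
  shows "hecke_op (iS p * iW w) f = sym_deriv p (weyl_op w f)"
proof -
  have "tensor_coeffs (tensor_eval (Poly_Mapping.single w p)) = Poly_Mapping.single w p"
    using assms by (intro tensor_coeffs_eval) simp
  then have "hecke_op (iS p * iW w) f = tensor_op (Poly_Mapping.single w p) f"
    by (simp only: hecke_op_def f tensor_eval_single if_True)
  then show ?thesis
    by (cases "p = 0") (simp_all add: tensor_op_def[abs_def] sym_deriv_zero weyl_op_Cinf f)
qed

lemma hecke_op_iS_mult:
  assumes f: "f \<in> Cinf"
  shows "hecke_op (iS p * h) f = sym_deriv p (hecke_op h f)"
proof (induction h rule: algebra_induct)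
  case (basic q w)
  have "iS p * (iS q * iW w) = iS (p * q) * iW w" by (simp add: iS_mult mult.assoc)
  then show ?case by (simp add: hecke_op_basic basic f sym_deriv_times weyl_op_Cinf)
next
  case (add h h')
  then show ?case by (simp add: distrib_left hecke_op_plus f sym_deriv_add hecke_op_Cinf)
qed

lemma cscale_eq: "cscale c h = iS (sym_const c) * h"
  by (simp add: iS_sym_const scale_mult_left)

lemma hecke_op_scale: "f \<in> Cinf \<Longrightarrow> hecke_op (cscale c h) f = (\<lambda>x. c * hecke_op h f x)"
  by (simp add: cscale_eq hecke_op_iS_mult sym_deriv_const hecke_op_Cinf)

text \<open>The one place where the two halves of the algebra interact. For constants it is
  \<open>weyl_op_simple_comp\<close>; for a further vector factor the cross relation moves s_a past
  it, and \<open>dir_deriv_int_refl\<close> performs the same exchange on operators.\<close>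

lemma hecke_op_simple_mult:
  assumes a: "a \<in> I" and f: "f \<in> Cinf"
  shows "hecke_op (iW (aff_refl a) * h) f = int_refl k a (hecke_op h f)"
proof (induction h rule: algebra_induct)
  case (basic p w)
  show ?case
  proof (induction p rule: sym_alg_induct)
    case (const c)
    have "iW (aff_refl a) * (iS (sym_const c) * iW w) = iS (sym_const c) * iW (aff_refl a \<circ> w)"
      by (simp add: iW_comp[OF simple_affine_weyl[OF a] basic] scale_mult_right flip: cscale_eq)
    then show ?case
      by (simp add: hecke_op_basic affine_weyl.comp simple_affine_weyl a basic f sym_deriv_const weyl_op_Cinf
          weyl_op_simple_comp int_refl_cmult int_refl_Cinf)
  next
    case (gen v p)
    define h where "h = iS p * iW w"
    let ?v = "lin_refl (fst a) v" and ?c = "of_real (k a * blinfun_apply (fst a) v) :: complex"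
    let ?g = "hecke_op h f"
    have g: "?g \<in> Cinf" by (rule hecke_op_Cinf[OF f])
    have IH: "hecke_op (iW (aff_refl a) * h) f = int_refl k a ?g" using gen by (simp add: h_def)
    have v: "lin_refl (fst a) ?v = v" "blinfun_apply (fst a) ?v = - blinfun_apply (fst a) v"
      by (simp_all add: lin_refl_lin_refl blinfun_lin_refl_self I_fst_neq_0 a)
    have vh: "iS (sym_gen v * p) * iW w = iS (sym_gen v) * h" by (simp add: iS_mult h_def mult.assoc)
    have "iW (aff_refl a) * iS (sym_gen v) = iS (sym_gen ?v) * iW (aff_refl a) + cscale ?c 1"
      using cross[OF a, of v] by (simp add: algebra_simps)
    then have "iW (aff_refl a) * (iS (sym_gen v) * h) = iS (sym_gen ?v) * (iW (aff_refl a) * h) + cscale ?c h"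
      by (simp add: scale_mult_left distrib_right flip: mult.assoc)
    then have "hecke_op (iW (aff_refl a) * (iS (sym_gen v * p) * iW w)) f =
        (\<lambda>x. dir_deriv ?v (int_refl k a ?g) x + ?c * ?g x)"
      unfolding vh
      by (simp add: hecke_op_plus f hecke_op_iS_mult IH hecke_op_scale sym_deriv_gen int_refl_Cinf g)
    \<comment> \<open>The derivative formula at s_a v contributes - k_a Da(v), which cancels the
      scalar of the cross relation.\<close>
    also have "\<dots> = int_refl k a (dir_deriv v ?g)"
      by (simp add: dir_deriv_int_refl[OF g] v)
    also have "dir_deriv v ?g = hecke_op (iS (sym_gen v * p) * iW w) f"
      unfolding vh by (simp add: hecke_op_iS_mult f sym_deriv_gen g)
    finally show ?case .
  next
    case (add p q)
    then show ?case
      by (simp add: iS_add distrib_left distrib_right hecke_op_plus f int_refl_add hecke_op_Cinf)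
  qed
next
  case (add h h')
  then show ?case by (simp add: distrib_left hecke_op_plus f int_refl_add hecke_op_Cinf)
qed

lemma hecke_op_word_mult:
  "set u \<subseteq> I \<Longrightarrow> f \<in> Cinf \<Longrightarrow> hecke_op (iW (word_map u) * h) f = word_op k u (hecke_op h f)"
proof (induction u)
  case Nil
  show ?case unfolding word_map.simps iW_id by simp
next
  case (Cons a u)
  then have e: "iW (word_map (a # u)) = iW (aff_refl a) * iW (word_map u)"
    by (simp add: iW_comp simple_affine_weyl word_map_affine_weyl)
  show ?case unfolding e using Cons by (simp add: mult.assoc hecke_op_simple_mult)
qed

text \<open>The left factor may be taken to be \<open>iS p * iW w\<close> with w given by a word;
  left multiplication by each kind of generator is already settled.\<close>

lemma hecke_op_mult:
  assumes f: "f \<in> Cinf"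
  shows "hecke_op (h * h') f = hecke_op h (hecke_op h' f)"
proof (induction h rule: algebra_induct)
  case (basic p w)
  obtain u where u: "set u \<subseteq> I" "word_map u = w" using affine_weyl_word[OF basic] by blast
  show ?case
    unfolding mult.assoc hecke_op_iS_mult[OF f] u(2)[symmetric] hecke_op_word_mult[OF u(1) f]
    using basic by (simp add: u(2) hecke_op_basic hecke_op_Cinf f weyl_op_word_map[OF u(1), unfolded u(2)])
next
  case (add h1 h2)
  then show ?case by (simp add: distrib_right hecke_op_plus f hecke_op_Cinf)
qed

lemma hecke_op_one: "f \<in> Cinf \<Longrightarrow> hecke_op 1 f = f"
  using hecke_op_basic[OF affine_weyl.id, of f 1] sym_deriv_const[of f 1]
  unfolding iS_one iW_id sym_const_one by (simp add: weyl_op_id)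

lemma hecke_op_End: "hecke_op h \<in> End_Cinf"
  unfolding End_Cinf_def
proof (intro CollectI conjI ballI allI PiE_I)
  fix f g :: "'a \<Rightarrow> complex" and c assume f: "f \<in> Cinf"
  show "hecke_op h f \<in> Cinf" by (rule hecke_op_Cinf[OF f])
  show "hecke_op h (\<lambda>x. c * f x) = (\<lambda>x. c * hecke_op h f x)"
    by (simp add: hecke_op_def tensor_op_def[abs_def] f Cinf_cmult weyl_op_def word_op_cmult word_op_Cinf
        sym_deriv_cmult sum_distrib_left)
  assume g: "g \<in> Cinf"
  show "hecke_op h (\<lambda>x. f x + g x) = (\<lambda>x. hecke_op h f x + hecke_op h g x)"
    by (simp add: hecke_op_def tensor_op_def[abs_def] f g Cinf_add weyl_op_def word_op_add word_op_Cinf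
        sym_deriv_add sum.distrib)
qed (simp add: hecke_op_def)

lemma representation_hecke_op: "representation_on_Cinf cscale hecke_op"
  unfolding representation_on_Cinf_def
  by (simp add: hecke_op_End hecke_op_one hecke_op_mult hecke_op_plus hecke_op_scale)

lemma hecke_op_gen: "f \<in> Cinf \<Longrightarrow> hecke_op (iS (sym_gen v)) f = dir_deriv v f"
  using hecke_op_iS_mult[of f "sym_gen v" 1] by (simp add: hecke_op_one sym_deriv_gen)

lemma hecke_op_simple: "a \<in> I \<Longrightarrow> f \<in> Cinf \<Longrightarrow> hecke_op (iW (aff_refl a)) f = int_refl k a f"
  using hecke_op_simple_mult[of a f 1] by (simp add: hecke_op_one)

text \<open>Vectors, scalars and simple reflections generate H; extensionality of
  \<open>End_Cinf\<close> settles the arguments outside \<open>Cinf\<close>.\<close>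

lemma representation_unique:
  assumes Q: "representation_on_Cinf cscale Q"
    and Q_gen: "\<And>v f. f \<in> Cinf \<Longrightarrow> Q (iS (sym_gen v)) f = dir_deriv v f"
    and Q_simple: "\<And>a f. a \<in> I \<Longrightarrow> f \<in> Cinf \<Longrightarrow> Q (iW (aff_refl a)) f = int_refl k a f"
  shows "Q = hecke_op"
proof -
  have Q_End: "Q h \<in> End_Cinf"
    and Q_one: "f \<in> Cinf \<Longrightarrow> Q 1 f = f"
    and Q_mult: "f \<in> Cinf \<Longrightarrow> Q (h * h') f = Q h (Q h' f)"
    and Q_plus: "f \<in> Cinf \<Longrightarrow> Q (h + h') f = (\<lambda>x. Q h f x + Q h' f x)"
    and Q_scale: "f \<in> Cinf \<Longrightarrow> Q (cscale c h) f = (\<lambda>x. c * Q h f x)" for h h' f c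
    using Q unfolding representation_on_Cinf_def by auto
  have iS: "Q (iS p) f = hecke_op (iS p) f" if "f \<in> Cinf" for p f
    using that
  proof (induction p arbitrary: f rule: sym_alg_induct)
    case (const c)
    then show ?case by (simp add: iS_sym_const Q_scale hecke_op_scale Q_one hecke_op_one)
  next
    case (gen v p)
    then show ?case by (simp add: iS_mult Q_mult hecke_op_mult Q_gen hecke_op_gen hecke_op_Cinf)
  next
    case (add p q)
    then show ?case by (simp add: iS_add Q_plus hecke_op_plus)
  qed
  have iW: "Q (iW (word_map u)) f = hecke_op (iW (word_map u)) f" if "set u \<subseteq> I" "f \<in> Cinf" for u f
    using that
  proof (induction u)
    case Nil
    then show ?case unfolding word_map.simps iW_id by (simp add: Q_one hecke_op_one)
  next
    case (Cons a u)
    then have e: "iW (word_map (a # u)) = iW (aff_refl a) * iW (word_map u)"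
      by (simp add: iW_comp simple_affine_weyl word_map_affine_weyl)
    show ?case unfolding e using Cons by (simp add: Q_mult hecke_op_mult Q_simple hecke_op_simple hecke_op_Cinf)
  qed
  have "Q h f = hecke_op h f" if f: "f \<in> Cinf" for h f
  proof (induction h rule: algebra_induct)
    case (basic p w)
    obtain u where u: "set u \<subseteq> I" "word_map u = w" using affine_weyl_word[OF basic] by blast
    then show ?case
      using iW[OF u(1) f] by (simp add: Q_mult hecke_op_mult f iS hecke_op_Cinf)
  next
    case (add h h')
    then show ?case by (simp add: Q_plus hecke_op_plus f)
  qed
  \<comment> \<open>Needed because uniqueness is asserted for Q as a total function.\<close>
  moreover have "T f = undefined" if "T \<in> End_Cinf" "f \<notin> Cinf" for T and f :: "'a \<Rightarrow> complex"
  proof -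
    have "T \<in> Cinf \<rightarrow>\<^sub>E Cinf" using that(1) unfolding End_Cinf_def by (elim CollectE conjE)
    then show ?thesis using that(2) by (rule PiE_arb)
  qed
  ultimately have "Q h f = hecke_op h f" for h f
    by (cases "f \<in> Cinf") (simp_all only: Q_End hecke_op_End not_False_eq_True)
  then show ?thesis by (intro ext) simp
qed

end

theorem theorem5p2:
  fixes Sigma0 I0 :: "('a::euclidean_space \<Rightarrow>\<^sub>L real) set"
    and phi :: "'a \<Rightarrow>\<^sub>L real"
    and k :: "'a affine_functional \<Rightarrow> real"
    and cscale :: "complex \<Rightarrow> 'h::ring_1 \<Rightarrow> 'h"
    and iS :: "'a sym_alg \<Rightarrow> 'h"
    and iW :: "('a \<Rightarrow> 'a) \<Rightarrow> 'h"
  assumes "root_system Sigma0" and "crystallographic Sigma0"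
    and "reduced_rs Sigma0" and "irreducible_rs Sigma0"
    and "root_basis Sigma0 I0"
    and "highest_root Sigma0 I0 phi"
    and "multiplicity_function Sigma0 k"
    and "Hk_algebra cscale Sigma0 I0 phi k iS iW"
  shows "\<exists>!Q. representation_on_Cinf cscale Q \<and>
           (\<forall>v. \<forall>f\<in>Cinf. Q (iS (sym_gen v)) f = dir_deriv v f) \<and>
           (\<forall>a\<in>affine_basis I0 phi. \<forall>f\<in>Cinf. Q (iW (aff_refl a)) f = int_refl k a f)"
proof -
  interpret Hk: Hk_algebra cscale Sigma0 I0 phi k iS iW by fact
  interpret affine_hecke Sigma0 I0 phi cscale k iS iW
    by unfold_locales (fact assms)+
  show ?thesis
  proof (rule ex1I[of _ hecke_op])
    show "representation_on_Cinf cscale hecke_op \<and>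
        (\<forall>v. \<forall>f\<in>Cinf. hecke_op (iS (sym_gen v)) f = dir_deriv v f) \<and>
        (\<forall>a\<in>affine_basis I0 phi. \<forall>f\<in>Cinf. hecke_op (iW (aff_refl a)) f = int_refl k a f)"
      by (intro conjI allI ballI representation_hecke_op hecke_op_gen hecke_op_simple)
  next
    fix Q
    assume Q: "representation_on_Cinf cscale Q \<and>
        (\<forall>v. \<forall>f\<in>Cinf. Q (iS (sym_gen v)) f = dir_deriv v f) \<and>
        (\<forall>a\<in>affine_basis I0 phi. \<forall>f\<in>Cinf. Q (iW (aff_refl a)) f = int_refl k a f)"
    show "Q = hecke_op"
    proof (rule representation_unique)
      show "representation_on_Cinf cscale Q" using Q by (rule conjunct1)
      fix f :: "'a \<Rightarrow> complex" assume f: "f \<in> Cinf"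
      show "Q (iS (sym_gen v)) f = dir_deriv v f" for v using Q f by simp
      show "Q (iW (aff_refl a)) f = int_refl k a f" if "a \<in> affine_basis I0 phi" for a
        using Q f that by simp
    qed
  qed
qed

end
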